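(* The proper Dupin hypersurface $\widetilde{\mathcal{B}}_{4,\mathbb{R}}$ of the unit sphere $S(4,\mathbb{R})$ is weakly irreducible.
   Context: $E(4,\mathbb{R})$ is the $9$-dimensional space of traceless real symmetric $4\times4$ matrices with inner product $\langle A,B\rangle=\operatorname{tr}(AB^t)$, and $S(4,\mathbb{R})$ is its unit sphere ($\cong S^8$). $\operatorname{SO}(4)$ acts by $P\cdot A=P^tAP$. Let $\widetilde{\mathcal{D}}_4=\{\operatorname{diag}(\lambda_1,-\lambda_1,\lambda_2,-\lambda_2)\in S(4,\mathbb{R}):\lambda_1>\lambda_2>0\}$ and $\widetilde{\mathcal{B}}_{4,\mathbb{R}}=\operatorname{SO}(4)\cdot\widetilde{\mathcal{D}}_4$; it is a $7$-dimensional embedded hypersurface of $S(4,\mathbb{R})$ with the induced metric, and it is proper Dupin (the number of distinct principal curvatures is constant and each principal curvature is constant along its curvature surfaces, i.e. the submanifolds tangent at each point to the full principal space). A proper Dupin hypersurface $M$ (in a Euclidean space or a unit sphere) is weakly reducible if it has a principal curvature function $\lambda$ such that the conullity $E_\lambda^{\perp}$, the distribution in $TM$ orthogonal to the principal distribution $E_\lambda$ of $\lambda$, is integrable. It is weakly irreducible if it is not weakly reducible. *)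

theory Defs
  imports "HOL-Analysis.Analysis"
begin

section \<open>Smooth maps and embedded submanifolds of a Euclidean space\<close>

text \<open>\<open>Ck_on k U f\<close> is meant for open \<open>U\<close>: it says that all iterated directional derivatives
  of \<open>f\<close> of order at most \<open>k\<close> exist and are continuous on \<open>U\<close>.\<close>

primrec Ck_on ::
  "nat \<Rightarrow> 'a::euclidean_space set \<Rightarrow> ('a \<Rightarrow> 'b::real_normed_vector) \<Rightarrow> bool"
where
  "Ck_on 0 U f \<longleftrightarrow> continuous_on U f"
| "Ck_on (Suc k) U f \<longleftrightarrow>
     (\<forall>x\<in>U. f differentiable (at x)) \<and>
     (\<forall>v. Ck_on k U (\<lambda>x. frechet_derivative f (at x) v))"

definition smooth_on ::
  "'a::euclidean_space set \<Rightarrow> ('a \<Rightarrow> 'b::real_normed_vector) \<Rightarrow> bool"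
where
  "smooth_on U f \<longleftrightarrow> open U \<and> (\<forall>k. Ck_on k U f)"

definition smooth_along ::
  "'a::euclidean_space set \<Rightarrow> ('a \<Rightarrow> 'b::real_normed_vector) \<Rightarrow> bool"
where
  "smooth_along M f \<longleftrightarrow>
     (\<forall>p\<in>M. \<exists>U g. p \<in> U \<and> smooth_on U g \<and> (\<forall>x\<in>M \<inter> U. f x = g x))"

text \<open>A \<open>k\<close>-dimensional embedded submanifold is locally the zero set of a smooth submersion
  onto a linear space \<open>W\<close> of codimension \<open>k\<close>.\<close>

definition embedded_submanifold :: "nat \<Rightarrow> 'a::euclidean_space set \<Rightarrow> bool" where
  "embedded_submanifold k M \<longleftrightarrow>
     (\<forall>p\<in>M. \<exists>U W. \<exists>F::'a \<Rightarrow> 'a.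
        p \<in> U \<and> subspace W \<and> dim W + k = DIM('a) \<and>
        smooth_on U F \<and> F ` U \<subseteq> W \<and> M \<inter> U = {x\<in>U. F x = 0} \<and>
        (\<forall>x\<in>M \<inter> U. range (frechet_derivative F (at x)) = W))"

definition tangent_space :: "'a::euclidean_space set \<Rightarrow> 'a \<Rightarrow> 'a set" where
  "tangent_space M x =
     {v. \<exists>e>0. \<exists>\<gamma>::real \<Rightarrow> 'a.
          smooth_on {-e<..<e} \<gamma> \<and> \<gamma> ` {-e<..<e} \<subseteq> M \<and>
          \<gamma> 0 = x \<and> (\<gamma> has_vector_derivative v) (at 0)}"

definition integral_manifold ::
  "('a::euclidean_space \<Rightarrow> 'a set) \<Rightarrow> 'a set \<Rightarrow> bool"
where
  "integral_manifold D S \<longleftrightarrow>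
     (\<exists>k. embedded_submanifold k S) \<and> (\<forall>x\<in>S. tangent_space S x = D x)"

definition integrable_distribution ::
  "'a::euclidean_space set \<Rightarrow> ('a \<Rightarrow> 'a set) \<Rightarrow> bool"
where
  "integrable_distribution M D \<longleftrightarrow>
     (\<forall>p\<in>M. \<exists>S. p \<in> S \<and> S \<subseteq> M \<and> integral_manifold D S)"


section \<open>Hypersurfaces of unit spheres\<close>

definition unit_sphere :: "'a::euclidean_space set \<Rightarrow> 'a set" where
  "unit_sphere E = {x\<in>E. norm x = 1}"

definition sphere_hypersurface :: "'a::euclidean_space set \<Rightarrow> 'a set \<Rightarrow> bool" where
  "sphere_hypersurface E M \<longleftrightarrow>
     subspace E \<and> M \<subseteq> unit_sphere E \<and>
     (\<exists>k. k + 2 = dim E \<and> embedded_submanifold k M)"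

definition unit_normal_field ::
  "'a::euclidean_space set \<Rightarrow> 'a set \<Rightarrow> ('a \<Rightarrow> 'a) \<Rightarrow> bool"
where
  "unit_normal_field E M \<xi> \<longleftrightarrow>
     smooth_along M \<xi> \<and>
     (\<forall>x\<in>M. \<xi> x \<in> E \<and> \<xi> x \<bullet> x = 0 \<and> norm (\<xi> x) = 1 \<and>
        (\<forall>v\<in>tangent_space M x. \<xi> x \<bullet> v = 0))"

text \<open>For the Levi-Civita connection \<open>\<nabla>\<close> of the unit sphere,
  \<open>\<nabla>\<^sub>v \<xi> = d\<xi>(v) + (v \<bullet> \<xi> x) x = d\<xi>(v)\<close> for tangent \<open>v\<close>, so the shape operator
  \<open>v \<mapsto> - \<nabla>\<^sub>v \<xi>\<close> is \<open>- d\<xi>\<close>.  The derivative within \<open>M\<close> is a linear map on the whole ambient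
  space that is determined only on tangent vectors, and it is only applied to those; see the
  lemma below.\<close>

definition shape_operator ::
  "'a::euclidean_space set \<Rightarrow> ('a \<Rightarrow> 'a) \<Rightarrow> 'a \<Rightarrow> 'a \<Rightarrow> 'a"
where
  "shape_operator M \<xi> x v = - frechet_derivative \<xi> (at x within M) v"

lemma shape_operator_along_curve:
  assumes "\<xi> differentiable (at x within M)"
    and e: "e > 0" "\<gamma> ` {-e<..<e} \<subseteq> M"
    and \<gamma>: "\<gamma> 0 = x" "(\<gamma> has_vector_derivative v) (at 0)"
  shows "((\<lambda>t. \<xi> (\<gamma> t)) has_vector_derivative - shape_operator M \<xi> x v) (at 0)"
proof -
  let ?D = "frechet_derivative \<xi> (at x within M)" and ?I = "{-e<..<e}"
  have D: "(\<xi> has_derivative ?D) (at x within M)"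
    using assms(1) frechet_derivative_works by blast
  have "(\<gamma> has_derivative (\<lambda>t. t *\<^sub>R v)) (at 0 within ?I)"
    using \<gamma>(2) by (simp add: has_vector_derivative_def has_derivative_at_withinI)
  moreover have "(\<xi> has_derivative ?D) (at (\<gamma> 0) within \<gamma> ` ?I)"
    using D e(2) \<gamma>(1) by (auto intro: has_derivative_subset)
  ultimately have "(\<xi> \<circ> \<gamma> has_derivative ?D \<circ> (\<lambda>t. t *\<^sub>R v)) (at 0 within ?I)"
    by (rule diff_chain_within)
  moreover have "at (0::real) within ?I = at 0"
    using e(1) by (intro at_within_open) auto
  moreover have "linear ?D"
    using D by (rule has_derivative_linear)
  ultimately show ?thesis
    by (simp add: has_vector_derivative_def shape_operator_def o_def linear_cmul)
qed

definition principal_space ::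
  "'a::euclidean_space set \<Rightarrow> ('a \<Rightarrow> 'a) \<Rightarrow> real \<Rightarrow> 'a \<Rightarrow> 'a set"
where
  "principal_space M \<xi> c x = {v\<in>tangent_space M x. shape_operator M \<xi> x v = c *\<^sub>R v}"

definition principal_curvatures ::
  "'a::euclidean_space set \<Rightarrow> ('a \<Rightarrow> 'a) \<Rightarrow> 'a \<Rightarrow> real set"
where
  "principal_curvatures M \<xi> x = {c. \<exists>v\<in>principal_space M \<xi> c x. v \<noteq> 0}"

text \<open>On a hypersurface with a constant number of distinct principal curvatures, continuity of
  a principal curvature function already entails its smoothness.\<close>

definition principal_curvature_function ::
  "'a::euclidean_space set \<Rightarrow> ('a \<Rightarrow> 'a) \<Rightarrow> ('a \<Rightarrow> real) \<Rightarrow> bool"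
where
  "principal_curvature_function M \<xi> \<kappa> \<longleftrightarrow>
     continuous_on M \<kappa> \<and> (\<forall>x\<in>M. \<kappa> x \<in> principal_curvatures M \<xi> x)"

definition principal_distribution ::
  "'a::euclidean_space set \<Rightarrow> ('a \<Rightarrow> 'a) \<Rightarrow> ('a \<Rightarrow> real) \<Rightarrow> 'a \<Rightarrow> 'a set"
where
  "principal_distribution M \<xi> \<kappa> x = principal_space M \<xi> (\<kappa> x) x"

definition conullity ::
  "'a::euclidean_space set \<Rightarrow> ('a \<Rightarrow> 'a) \<Rightarrow> ('a \<Rightarrow> real) \<Rightarrow> 'a \<Rightarrow> 'a set"
where
  "conullity M \<xi> \<kappa> x =
     {v\<in>tangent_space M x. \<forall>w\<in>principal_distribution M \<xi> \<kappa> x. v \<bullet> w = 0}"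

definition curvature_surface ::
  "'a::euclidean_space set \<Rightarrow> ('a \<Rightarrow> 'a) \<Rightarrow> ('a \<Rightarrow> real) \<Rightarrow> 'a set \<Rightarrow> bool"
where
  "curvature_surface M \<xi> \<kappa> S \<longleftrightarrow>
     connected S \<and> S \<subseteq> M \<and> integral_manifold (principal_distribution M \<xi> \<kappa>) S"


section \<open>Proper Dupin hypersurfaces and weak reducibility\<close>

text \<open>Hypersurfaces are taken to be orientable, so that principal curvatures are globally
  defined functions.  The choice of the unit normal field \<open>\<xi>\<close> is immaterial: reversing it on
  components of \<open>M\<close> changes the signs of the principal curvatures there, but neither their
  number nor their principal spaces.\<close>

definition proper_dupin :: "'a::euclidean_space set \<Rightarrow> 'a set \<Rightarrow> bool" where
  "proper_dupin E M \<longleftrightarrow>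
     sphere_hypersurface E M \<and>
     (\<exists>\<xi>. unit_normal_field E M \<xi> \<and>
        (\<exists>g. \<forall>x\<in>M. card (principal_curvatures M \<xi> x) = g) \<and>
        (\<forall>\<kappa> S. principal_curvature_function M \<xi> \<kappa> \<and> curvature_surface M \<xi> \<kappa> S
           \<longrightarrow> \<kappa> constant_on S))"

definition weakly_reducible :: "'a::euclidean_space set \<Rightarrow> 'a set \<Rightarrow> bool" where
  "weakly_reducible E M \<longleftrightarrow>
     proper_dupin E M \<and>
     (\<exists>\<xi> \<kappa>. unit_normal_field E M \<xi> \<and> principal_curvature_function M \<xi> \<kappa> \<and>
        integrable_distribution M (conullity M \<xi> \<kappa>))"

definition weakly_irreducible :: "'a::euclidean_space set \<Rightarrow> 'a set \<Rightarrow> bool" where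
  "weakly_irreducible E M \<longleftrightarrow> proper_dupin E M \<and> \<not> weakly_reducible E M"


section \<open>The hypersurface of symmetric matrices\<close>

text \<open>The ambient Euclidean space is \<open>real^4^4\<close>, whose inner product is the required one:\<close>

lemma inner_matrix_eq_trace:
  fixes A B :: "real^'n^'n"
  shows "A \<bullet> B = trace (A ** transpose B)"
  by (simp add: inner_vec_def trace_def matrix_matrix_mult_def transpose_def)

definition E4 :: "(real^4^4) set" where
  "E4 = {A. transpose A = A \<and> trace A = 0}"

definition S4 :: "(real^4^4) set" where
  "S4 = unit_sphere E4"

definition diag4 :: "real \<Rightarrow> real \<Rightarrow> real \<Rightarrow> real \<Rightarrow> real^4^4" where
  "diag4 a b c d = (\<chi> i j. if i = j then vector [a, b, c, d] $ i else 0)"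

definition D4_tilde :: "(real^4^4) set" where
  "D4_tilde = {diag4 a (-a) b (-b) | a b. a > b \<and> b > 0 \<and> diag4 a (-a) b (-b) \<in> S4}"

definition B4_tilde :: "(real^4^4) set" where
  "B4_tilde = {transpose P ** A ** P | P A. rotation_matrix P \<and> A \<in> D4_tilde}"

end

theory Submission
  imports Defs
begin

text \<open>
  Why the hypersurface is proper Dupin.  A point \<open>x\<close> has an orthonormal eigenbasis \<open>e1, e2, e3, e4\<close>
  with eigenvalues \<open>\<mu>, -\<mu>, \<nu>, -\<nu>\<close>, and the unit normal \<open>\<xi>\<close> at \<open>x\<close> is half the difference of the
  orthogonal projections onto the planes of \<open>e1, e2\<close> and of \<open>e3, e4\<close>.  Hence \<open>\<xi>\<^sup>2 = 1/4\<close>,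
  \<open>x \<xi> = \<xi> x\<close> and \<open>x\<^sup>2 = 1/4 + m \<xi>\<close> for a function \<open>m\<close> (\<open>normal_identities\<close>).  Differentiating the
  first two identities in a tangent direction \<open>v\<close> determines \<open>Z = d\<xi>(v)\<close>: in the eigenbasis,
  \<open>Z\<close> vanishes on each of the two planes, and \<open>Z i j = v i j / (\<lambda> i - \<lambda> j)\<close> between them.
  So the principal curvatures are \<open>0\<close>, of multiplicity three, and the four numbers
  \<open>-1 / (\<lambda> i - \<lambda> j)\<close> with \<open>\<lambda> i = \<plusminus>\<mu>\<close> and \<open>\<lambda> j = \<plusminus>\<nu>\<close>, which are simple; the principal direction of
  the latter is the symmetrised tensor product of \<open>e i\<close> and \<open>e j\<close>
  (\<open>principal_space_normal_frame\<close>, \<open>principal_curvatures_B4\<close>).  All of them are functions of \<open>m\<close>, and \<open>m\<close> is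
  stationary in the simple principal directions (\<open>block_gap_stationary\<close>); this gives the Dupin property.

  Why no conullity is integrable.  If \<open>S\<close> is an integral manifold through \<open>p\<close> of the distribution of solutions
  \<open>v\<close> of a linear equation \<open>L(x) v = 0\<close>, take two commuting vector fields along \<open>S\<close> with values
  \<open>u, v\<close> at \<open>p\<close> and differentiate the equation for each along the other.  As they commute, this gives
  \<open>dL(u) v = dL(v) u\<close>.  For the zero curvature the equation is \<open>\<xi> v + v \<xi> = 0\<close>
  (\<open>conullity_zero_anticommutes\<close>), for a simple curvature it is \<open>G v H = 0\<close> with \<open>G\<close> and \<open>H\<close> multiples of
  the projections onto the two eigenvectors involved (\<open>conullity_simple_factors\<close>).  The symmetry
  condition fails for suitable \<open>u\<close> and \<open>v\<close>, for the reason that the infinitesimal rotations of two coordinate planes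
  sharing an axis bracket to that of a third one.

  Tangent spaces are given by velocities of smooth curves.  To have enough curves,
  the submanifolds are parametrised by a smooth inverse function theorem, which also provides the commuting fields.
\<close>

section \<open>Calculus of iterated directional derivatives\<close>

lemma Ck_on_cong:
  assumes "open U" "Ck_on k U f" "\<And>x. x \<in> U \<Longrightarrow> f x = g x"
  shows "Ck_on k U g"
  using assms(2,3)
proof (induction k arbitrary: f g)
  case 0
  then show ?case by (simp cong: continuous_on_cong)
next
  case (Suc k)
  have der: "(g has_derivative frechet_derivative f (at x)) (at x)" if "x \<in> U" for x
    using Suc.prems that assms(1)
    by (auto intro: has_derivative_transform_within_open[where s=U] simp: frechet_derivative_works)
  then have "frechet_derivative f (at x) = frechet_derivative g (at x)" if "x \<in> U" for x
    using that frechet_derivative_at by blast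
  then have "Ck_on k U (\<lambda>x. frechet_derivative g (at x) v)" for v
    using Suc.IH[of "\<lambda>x. frechet_derivative f (at x) v" "\<lambda>x. frechet_derivative g (at x) v"] Suc.prems(1)
    by simp
  then show ?case using der by (auto simp: differentiable_def)
qed

lemma Ck_on_SucI:
  assumes "open U" "\<And>x. x \<in> U \<Longrightarrow> (f has_derivative f' x) (at x)"
    and "\<And>v. Ck_on k U (\<lambda>x. f' x v)"
  shows "Ck_on (Suc k) U f"
proof -
  have "f' x = frechet_derivative f (at x)" if "x \<in> U" for x
    using assms(2) that frechet_derivative_at by blast
  then have "Ck_on k U (\<lambda>x. frechet_derivative f (at x) v)" for v
    using Ck_on_cong[OF assms(1) assms(3)[of v]] by simp
  then show ?thesis using assms(2) by (auto simp: differentiable_def)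
qed

lemma Ck_on_Suc_has_derivative:
  "Ck_on (Suc k) U f \<Longrightarrow> x \<in> U \<Longrightarrow> (f has_derivative frechet_derivative f (at x)) (at x)"
  by (simp add: frechet_derivative_works)

lemma Ck_on_SucD: "Ck_on (Suc k) U f \<Longrightarrow> Ck_on k U f"
proof (induction k arbitrary: f)
  case 0
  then show ?case
    by (auto intro!: continuous_at_imp_continuous_on differentiable_imp_continuous_within)
next
  case (Suc k)
  then show ?case by (metis Ck_on.simps(2))
qed

lemma Ck_on_imp_continuous_on: "Ck_on k U f \<Longrightarrow> continuous_on U f"
proof (induction k)
  case (Suc k)
  then show ?case using Ck_on_SucD by blast
qed simp

lemma Ck_on_subset: "Ck_on k U f \<Longrightarrow> V \<subseteq> U \<Longrightarrow> Ck_on k V f"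
  by (induction k arbitrary: f) (auto intro: continuous_on_subset)

lemma Ck_on_const: "Ck_on k U (\<lambda>x. c)"
  by (induction k arbitrary: c) (auto)

lemma Ck_on_bounded_linear:
  assumes "bounded_linear f" shows "Ck_on k U f"
proof (cases k)
  case 0
  then show ?thesis using assms by (simp add: linear_continuous_on)
next
  case (Suc j)
  have "frechet_derivative f (at x) = f" for x
    using assms bounded_linear_imp_has_derivative frechet_derivative_at by metis
  then show ?thesis using Suc assms
    by (auto intro: Ck_on_const bounded_linear_imp_differentiable)
qed

lemma Ck_on_compose_bounded_linear:
  assumes "open U" "bounded_linear h" "Ck_on k U f"
  shows "Ck_on k U (\<lambda>x. h (f x))"
  using assms(3)
proof (induction k arbitrary: f)
  case 0
  then show ?case using bounded_linear.continuous_on[OF assms(2)] by simp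
next
  case (Suc k)
  show ?case
  proof (rule Ck_on_SucI[OF assms(1)])
    show "((\<lambda>x. h (f x)) has_derivative (\<lambda>v. h (frechet_derivative f (at x) v))) (at x)" if "x \<in> U" for x
      using bounded_linear.has_derivative[OF assms(2) Ck_on_Suc_has_derivative[OF Suc.prems that]] .
    show "Ck_on k U (\<lambda>x. h (frechet_derivative f (at x) v))" for v
      using Suc by simp
  qed
qed

lemma Ck_on_add:
  assumes "open U" "Ck_on k U f" "Ck_on k U g"
  shows "Ck_on k U (\<lambda>x. f x + g x)"
  using assms(2,3)
proof (induction k arbitrary: f g)
  case 0
  then show ?case by (auto intro: continuous_intros)
next
  case (Suc k)
  show ?case
  proof (rule Ck_on_SucI[OF assms(1)])
    show "((\<lambda>x. f x + g x) has_derivative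
        (\<lambda>v. frechet_derivative f (at x) v + frechet_derivative g (at x) v)) (at x)" if "x \<in> U" for x
      using Suc.prems that by (intro has_derivative_add Ck_on_Suc_has_derivative)
  qed (use Suc in auto)
qed

lemma Ck_on_sum:
  assumes "open U" "\<And>i. i \<in> I \<Longrightarrow> Ck_on k U (f i)"
  shows "Ck_on k U (\<lambda>x. \<Sum>i\<in>I. f i x)"
  using assms(2) by (induction I rule: infinite_finite_induct) (auto intro: Ck_on_add Ck_on_const assms(1))

lemma Ck_on_bilinear:
  assumes "open U" "bounded_bilinear h" "Ck_on k U f" "Ck_on k U g"
  shows "Ck_on k U (\<lambda>x. h (f x) (g x))"
  using assms(3,4)
proof (induction k arbitrary: f g)
  case 0
  then show ?case using bounded_bilinear.continuous_on[OF assms(2)] by simp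
next
  case (Suc k)
  show ?case
  proof (rule Ck_on_SucI[OF assms(1)])
    show "((\<lambda>x. h (f x) (g x)) has_derivative
        (\<lambda>v. h (f x) (frechet_derivative g (at x) v) + h (frechet_derivative f (at x) v) (g x))) (at x)" if "x \<in> U" for x
      using Suc.prems that by (intro bounded_bilinear.FDERIV[OF assms(2)] Ck_on_Suc_has_derivative)
    show "Ck_on k U (\<lambda>x. h (f x) (frechet_derivative g (at x) v) + h (frechet_derivative f (at x) v) (g x))" for v
      using Suc.prems by (intro Ck_on_add Suc.IH assms(1)) (auto intro: Ck_on_SucD[of k])
  qed
qed

lemma linear_basis_expansion:
  fixes L :: "'a::euclidean_space \<Rightarrow> 'b::real_vector"
  assumes "linear L" shows "L v = (\<Sum>b\<in>Basis. (v \<bullet> b) *\<^sub>R L b)"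
proof -
  have "L v = L (\<Sum>b\<in>Basis. (v \<bullet> b) *\<^sub>R b)" by (simp add: euclidean_representation)
  then show ?thesis by (simp add: linear_sum[OF assms] linear_cmul[OF assms])
qed

text \<open>The derivative of the composite is expanded over the basis, so that only compositions
  with the same codomain occur in the induction.\<close>

lemma Ck_on_compose:
  fixes f :: "'a::euclidean_space \<Rightarrow> 'b::real_normed_vector" and g :: "'c::euclidean_space \<Rightarrow> 'a"
  assumes "open U" "open V" "g ` U \<subseteq> V" "Ck_on k V f" "Ck_on k U g"
  shows "Ck_on k U (\<lambda>x. f (g x))"
  using assms(4,5)
proof (induction k arbitrary: f)
  case 0
  then show ?case using assms(3) by (auto intro: continuous_on_compose2)
next
  case (Suc k)
  let ?f = "\<lambda>y. frechet_derivative f (at y)" and ?g = "\<lambda>x. frechet_derivative g (at x)"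
  have f: "(f has_derivative ?f (g x)) (at (g x))" if "x \<in> U" for x
    using assms(3) that Ck_on_Suc_has_derivative[OF Suc.prems(1)] by auto
  have g: "(g has_derivative ?g x) (at x)" if "x \<in> U" for x
    using that Ck_on_Suc_has_derivative[OF Suc.prems(2)] by auto
  have exp: "?f (g x) (?g x v) = (\<Sum>b\<in>Basis. (?g x v \<bullet> b) *\<^sub>R ?f (g x) b)" if "x \<in> U" for x v
    using linear_basis_expansion[OF has_derivative_linear[OF f[OF that]]] .
  have "Ck_on k U (\<lambda>x. (?g x v \<bullet> b) *\<^sub>R ?f (g x) b)" for v b
  proof (rule Ck_on_bilinear[OF assms(1) bounded_bilinear_scaleR])
    show "Ck_on k U (\<lambda>x. ?g x v \<bullet> b)"
      using Suc.prems(2) by (intro Ck_on_compose_bounded_linear[OF assms(1) bounded_linear_inner_left]) auto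
    show "Ck_on k U (\<lambda>x. ?f (g x) b)"
      using Suc.prems Suc.IH[of "\<lambda>y. ?f y b"] Ck_on_SucD by auto
  qed
  then have *: "Ck_on k U (\<lambda>x. \<Sum>b\<in>Basis. (?g x v \<bullet> b) *\<^sub>R ?f (g x) b)" for v
    by (intro Ck_on_sum assms(1))
  have "Ck_on k U (\<lambda>x. ?f (g x) (?g x v))" for v
    using Ck_on_cong[OF assms(1) *[of v]] exp by simp
  then show ?case
    by (intro Ck_on_SucI[where f'="\<lambda>x v. ?f (g x) (?g x v)"] assms(1))
       (auto intro: has_derivative_compose[OF g f])
qed

lemma Ck_on_powr: "Ck_on k {0<..} (\<lambda>r::real. r powr c)"
proof (induction k arbitrary: c)
  case 0
  then show ?case by (auto intro!: continuous_intros)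
next
  case (Suc k)
  have "Ck_on k {0<..} (\<lambda>r::real. (v * c) * r powr (c - 1))" for v
    by (rule Ck_on_compose_bounded_linear[OF _ bounded_linear_mult_right Suc]) auto
  moreover have "((\<lambda>r. r powr c) has_derivative (\<lambda>v. (v * c) * r powr (c - 1))) (at r)" if "r \<in> {0<..}" for r :: real
  proof -
    have "(\<lambda>v. (v * c) * r powr (c - 1)) = (*) (c * r powr (c - 1))" by (auto simp: mult_ac)
    then show ?thesis
      using has_real_derivative_powr[of r c] that by (simp add: has_field_derivative_def)
  qed
  ultimately show ?case by (intro Ck_on_SucI[where f'="\<lambda>r v. (v * c) * r powr (c - 1)"]) auto
qed

lemma smooth_onI: "open U \<Longrightarrow> (\<And>k. Ck_on k U f) \<Longrightarrow> smooth_on U f"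
  by (simp add: smooth_on_def)

lemma smooth_on_has_derivative:
  "smooth_on U f \<Longrightarrow> x \<in> U \<Longrightarrow> (f has_derivative frechet_derivative f (at x)) (at x)"
  unfolding smooth_on_def using Ck_on_Suc_has_derivative by blast

lemma smooth_on_frechet_derivative:
  "smooth_on U f \<Longrightarrow> smooth_on U (\<lambda>x. frechet_derivative f (at x) v)"
  unfolding smooth_on_def by (metis Ck_on.simps(2))

lemma smooth_on_imp_continuous_on: "smooth_on U f \<Longrightarrow> continuous_on U f"
  unfolding smooth_on_def by (metis Ck_on.simps(1))

lemma smooth_on_subset: "smooth_on U f \<Longrightarrow> open V \<Longrightarrow> V \<subseteq> U \<Longrightarrow> smooth_on V f"
  unfolding smooth_on_def using Ck_on_subset by blast

lemma smooth_on_compose: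
  "smooth_on V f \<Longrightarrow> smooth_on U g \<Longrightarrow> g ` U \<subseteq> V \<Longrightarrow> smooth_on U (\<lambda>x. f (g x))"
  unfolding smooth_on_def using Ck_on_compose by blast

lemma smooth_on_const: "open U \<Longrightarrow> smooth_on U (\<lambda>x. c)"
  unfolding smooth_on_def using Ck_on_const by blast

lemma smooth_on_bounded_linear: "open U \<Longrightarrow> bounded_linear f \<Longrightarrow> smooth_on U f"
  unfolding smooth_on_def using Ck_on_bounded_linear by blast

lemma smooth_on_compose_bounded_linear:
  "bounded_linear h \<Longrightarrow> smooth_on U f \<Longrightarrow> smooth_on U (\<lambda>x. h (f x))"
  unfolding smooth_on_def using Ck_on_compose_bounded_linear by blast

lemma smooth_on_add: "smooth_on U f \<Longrightarrow> smooth_on U g \<Longrightarrow> smooth_on U (\<lambda>x. f x + g x)"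
  unfolding smooth_on_def using Ck_on_add by blast

lemma smooth_on_bilinear:
  "bounded_bilinear h \<Longrightarrow> smooth_on U f \<Longrightarrow> smooth_on U g \<Longrightarrow> smooth_on U (\<lambda>x. h (f x) (g x))"
  unfolding smooth_on_def using Ck_on_bilinear by blast

lemma smooth_on_ident: "open U \<Longrightarrow> smooth_on U (\<lambda>x. x)"
  by (intro smooth_on_bounded_linear bounded_linear_ident)

section \<open>The smooth inverse function theorem\<close>

text \<open>The product rule with one factor merely continuous, at a zero of the other factor.  It is what
  the resolvent identity \<open>G y = G x - G y (A y - A x) G x\<close> asks for when an inverse \<open>G\<close> of \<open>A\<close> is differentiated.\<close>

lemma has_derivative_bilinear_vanishing:
  fixes h :: "'b::real_normed_vector \<Rightarrow> 'c::real_normed_vector \<Rightarrow> 'd::real_normed_vector"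
    and f :: "'a::real_normed_vector \<Rightarrow> 'b"
  assumes h: "bounded_bilinear h" and f: "isCont f x"
    and g: "(g has_derivative g') (at x)" "g x = 0"
  shows "((\<lambda>y. h (f y) (g y)) has_derivative (\<lambda>v. h (f x) (g' v))) (at x)"
proof -
  obtain K where K: "K > 0" "\<And>a b. norm (h a b) \<le> norm a * norm b * K"
    using bounded_bilinear.pos_bounded[OF h] by blast
  have bl: "bounded_linear g'" using g has_derivative_bounded_linear by blast
  have small: "((\<lambda>y. h (f y - f x) (g y)) has_derivative (\<lambda>v. 0)) (at x)"
  proof -
    obtain C where C: "C > 0" "\<And>v. norm (g' v) \<le> norm v * C"
      using bounded_linear.pos_bounded[OF bl] by blast
    have "((\<lambda>v. h (f (x + v) - f x) (g (x + v)) /\<^sub>R norm v) \<longlongrightarrow> 0) (at 0)"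
    proof (rule Lim_null_comparison)
      have lim: "((\<lambda>v. norm (g (x + v) - g x - g' v) / norm v) \<longlongrightarrow> 0) (at 0)"
        using g(1) by (simp add: has_derivative_at)
      have "eventually (\<lambda>v. norm (g (x + v) - g x - g' v) / norm v < 1) (at 0)"
        using order_tendstoD(2)[OF lim] by simp
      then show "\<forall>\<^sub>F v in at 0. norm (h (f (x + v) - f x) (g (x + v)) /\<^sub>R norm v)
          \<le> norm (f (x + v) - f x) * ((1 + C) * K)"
        unfolding eventually_at_filter
      proof eventually_elim
        case (elim v)
        show ?case
        proof (intro impI)
          assume v: "v \<noteq> 0"
          then have "norm (g (x + v) - g' v) < norm v" using elim g(2) by (simp add: divide_less_eq)
          moreover have "norm (g (x + v)) \<le> norm (g (x + v) - g' v) + norm (g' v)"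
            using norm_triangle_sub[of "g (x+v)" "g' v"] by simp
          ultimately have gg: "norm (g (x + v)) \<le> (1 + C) * norm v"
            using C(2)[of v] by (simp add: algebra_simps)
          have "norm (h (f (x + v) - f x) (g (x + v))) \<le> norm (f (x + v) - f x) * norm (g (x + v)) * K"
            by (rule K)
          also have "\<dots> \<le> norm (f (x + v) - f x) * ((1 + C) * norm v) * K"
            using gg K(1) by (intro mult_right_mono mult_left_mono) auto
          finally show "norm (h (f (x + v) - f x) (g (x + v)) /\<^sub>R norm v)
              \<le> norm (f (x + v) - f x) * ((1 + C) * K)"
            using v by (simp add: divide_simps mult_ac)
        qed
      qed
      have "((\<lambda>v. f (x + v)) \<longlongrightarrow> f x) (at 0)" using f by (simp add: isCont_iff)
      then have "((\<lambda>v. norm (f (x + v) - f x) * ((1 + C) * K)) \<longlongrightarrow> norm (f x - f x) * ((1+C)*K)) (at 0)"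
        by (intro tendsto_intros)
      then show "((\<lambda>v. norm (f (x + v) - f x) * ((1 + C) * K)) \<longlongrightarrow> 0) (at 0)" by simp
    qed
    then have "((\<lambda>v. norm (h (f (x + v) - f x) (g (x + v))) / norm v) \<longlongrightarrow> 0) (at 0)"
      using tendsto_norm_zero_iff[of "\<lambda>v. h (f (x + v) - f x) (g (x + v)) /\<^sub>R norm v"]
      by (simp add: divide_inverse_commute)
    then show ?thesis
      by (simp add: has_derivative_at g(2) bounded_bilinear.zero_right[OF h])
  qed
  have lin: "((\<lambda>y. h (f x) (g y)) has_derivative (\<lambda>v. h (f x) (g' v))) (at x)"
    using bounded_linear.has_derivative[OF bounded_bilinear.bounded_linear_right[OF h] g(1)] .
  show ?thesis
    using has_derivative_add[OF lin small] by (simp add: bounded_bilinear.diff_left[OF h])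
qed

text \<open>The resolvent identity bounds \<open>G y - G x\<close> once \<open>norm (G y)\<close> is bounded, and it bounds
  \<open>norm (G y)\<close> by twice \<open>norm (G x)\<close> as soon as \<open>A y\<close> is close to \<open>A x\<close>.\<close>

lemma continuous_on_blinfun_inverse:
  fixes A G :: "'a::topological_space \<Rightarrow> 'b::real_normed_vector \<Rightarrow>\<^sub>L 'b"
  assumes "continuous_on U A"
    and AG: "\<And>x. x \<in> U \<Longrightarrow> A x o\<^sub>L G x = id_blinfun" and GA: "\<And>x. x \<in> U \<Longrightarrow> G x o\<^sub>L A x = id_blinfun"
  shows "continuous_on U G"
  unfolding continuous_on_def
proof
  fix x assume x: "x \<in> U"
  let ?F = "at x within U"
  have lim: "((\<lambda>y. norm (A y - A x) * (2 * norm (G x) * norm (G x))) \<longlongrightarrow> norm (A x - A x) * (2 * norm (G x) * norm (G x))) ?F"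
    using assms(1) x by (intro tendsto_intros) (auto simp: continuous_on_def)
  have lim2: "((\<lambda>y. norm (A y - A x) * norm (G x)) \<longlongrightarrow> norm (A x - A x) * norm (G x)) ?F"
    using assms(1) x by (intro tendsto_intros) (auto simp: continuous_on_def)
  then have "eventually (\<lambda>y. norm (A y - A x) * norm (G x) < 1/2) ?F"
    by (rule order_tendstoD) simp
  moreover have "eventually (\<lambda>y. y \<in> U) ?F" by (simp add: eventually_at_filter)
  ultimately have "eventually (\<lambda>y. norm (G y - G x) \<le> norm (A y - A x) * (2 * norm (G x) * norm (G x))) ?F"
  proof eventually_elim
    case (elim y)
    have ap: "A x (G x i) = i" "G y (A y i) = i" for i
      using arg_cong[OF AG[OF x], of "\<lambda>B. blinfun_apply B i"] arg_cong[OF GA[OF elim(2)], of "\<lambda>B. blinfun_apply B i"]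
      by simp_all
    have *: "G y - G x = - (G y o\<^sub>L (A y - A x) o\<^sub>L G x)"
      by (rule blinfun_eqI) (simp add: blinfun.diff_left blinfun.diff_right blinfun.minus_left ap)
    have b: "norm (G y - G x) \<le> norm (G y) * norm (A y - A x) * norm (G x)"
      unfolding * norm_minus_cancel
      by (meson norm_blinfun_compose order_trans mult_right_mono norm_ge_zero)
    have "norm (G y) \<le> norm (G y - G x) + norm (G x)" using norm_triangle_sub[of "G y" "G x"] by simp
    also have "\<dots> \<le> norm (G y) * (norm (A y - A x) * norm (G x)) + norm (G x)" using b by (simp add: mult_ac)
    also have "\<dots> \<le> norm (G y) * (1/2) + norm (G x)"
      using elim by (intro add_right_mono mult_left_mono) auto
    finally have "norm (G y) \<le> 2 * norm (G x)" by simp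
    then have "norm (G y) * norm (A y - A x) * norm (G x) \<le> 2 * norm (G x) * norm (A y - A x) * norm (G x)"
      by (intro mult_right_mono) auto
    with b show ?case by (simp add: mult_ac)
  qed
  then have "((\<lambda>y. G y - G x) \<longlongrightarrow> 0) ?F"
    by (rule Lim_null_comparison) (use lim in simp)
  then show "(G \<longlongrightarrow> G x) ?F" by (simp add: LIM_zero_iff)
qed

text \<open>The derivative \<open>- G (dA v) G\<close> is as often differentiable as \<open>G\<close> is already known to be.\<close>

lemma Ck_on_blinfun_inverse:
  fixes A G :: "'a::euclidean_space \<Rightarrow> 'b::real_normed_vector \<Rightarrow>\<^sub>L 'b"
  assumes U: "open U" and "Ck_on k U A"
    and AG: "\<And>x. x \<in> U \<Longrightarrow> A x o\<^sub>L G x = id_blinfun" and GA: "\<And>x. x \<in> U \<Longrightarrow> G x o\<^sub>L A x = id_blinfun"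
  shows "Ck_on k U G"
  using assms(2)
proof (induction k)
  case 0
  then show ?case using continuous_on_blinfun_inverse AG GA by auto
next
  case (Suc k)
  have IH: "Ck_on k U G" using Suc Ck_on_SucD by blast
  have cont: "isCont G x" if "x \<in> U" for x
  proof -
    have "continuous_on U G"
      using continuous_on_blinfun_inverse[OF Ck_on_imp_continuous_on[OF Suc.prems] AG GA] by simp
    then show ?thesis using U that by (simp add: continuous_on_eq_continuous_at)
  qed
  let ?A = "\<lambda>x. frechet_derivative A (at x)"
  show ?case
  proof (rule Ck_on_SucI[OF U])
    fix x assume x: "x \<in> U"
    have "((\<lambda>y. (A y - A x) o\<^sub>L G x) has_derivative (\<lambda>v. (?A x v - 0) o\<^sub>L G x)) (at x)"
      by (intro bounded_linear.has_derivative[OF bounded_bilinear.bounded_linear_left[OF bounded_bilinear_blinfun_compose]]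
           has_derivative_diff has_derivative_const Ck_on_Suc_has_derivative[OF Suc.prems x])
    from has_derivative_bilinear_vanishing[OF bounded_bilinear_blinfun_compose cont[OF x] this]
    have "((\<lambda>y. G y o\<^sub>L ((A y - A x) o\<^sub>L G x)) has_derivative (\<lambda>v. G x o\<^sub>L (?A x v o\<^sub>L G x))) (at x)"
      by (simp add: bounded_bilinear.zero_left[OF bounded_bilinear_blinfun_compose])
    from has_derivative_diff[OF has_derivative_const[where c="G x"] this]
    have d: "((\<lambda>y. G x - (G y o\<^sub>L ((A y - A x) o\<^sub>L G x))) has_derivative (\<lambda>v. - (G x o\<^sub>L (?A x v o\<^sub>L G x)))) (at x)"
      by simp
    have "G x - (G y o\<^sub>L ((A y - A x) o\<^sub>L G x)) = G y" if y: "y \<in> U" for y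
    proof -
      have ap: "A x (G x i) = i" "G y (A y i) = i" for i
        using arg_cong[OF AG[OF x], of "\<lambda>B. blinfun_apply B i"] arg_cong[OF GA[OF y], of "\<lambda>B. blinfun_apply B i"]
        by simp_all
      show ?thesis
        by (rule blinfun_eqI) (simp add: blinfun.diff_left blinfun.diff_right ap)
    qed
    with d show "(G has_derivative (\<lambda>v. - (G x o\<^sub>L (?A x v o\<^sub>L G x)))) (at x)"
      using has_derivative_transform_within_open[OF d U x] by blast
  next
    fix v
    have "Ck_on k U (\<lambda>x. ?A x v)" using Suc.prems by simp
    then show "Ck_on k U (\<lambda>x. - (G x o\<^sub>L (?A x v o\<^sub>L G x)))"
      by (intro Ck_on_compose_bounded_linear[OF U bounded_linear_minus[OF bounded_linear_ident]]
           Ck_on_bilinear[OF U bounded_bilinear_blinfun_compose] IH)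
  qed
qed

lemma Ck_on_Blinfun_derivative:
  fixes f :: "'a::euclidean_space \<Rightarrow> 'b::real_normed_vector"
  assumes U: "open U" and f: "Ck_on (Suc k) U f"
  shows "Ck_on k U (\<lambda>x. Blinfun (frechet_derivative f (at x)))"
proof -
  let ?f = "\<lambda>x. frechet_derivative f (at x)"
  have "Ck_on k U (\<lambda>x. \<Sum>b\<in>Basis. blinfun_scaleR_left (?f x b) o\<^sub>L blinfun_inner_left b)"
    by (intro Ck_on_sum U Ck_on_compose_bounded_linear[OF U bounded_bilinear.bounded_linear_left[OF bounded_bilinear_blinfun_compose]]
         Ck_on_compose_bounded_linear[OF U bounded_linear_blinfun_scaleR_left])
       (use f in auto)
  then show ?thesis
  proof (rule Ck_on_cong[OF U])
    fix x assume x: "x \<in> U"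
    have d: "(f has_derivative ?f x) (at x)" using Ck_on_Suc_has_derivative[OF f x] .
    then have bl: "bounded_linear (?f x)" by (rule has_derivative_bounded_linear)
    show "(\<Sum>b\<in>Basis. blinfun_scaleR_left (?f x b) o\<^sub>L blinfun_inner_left b) = Blinfun (?f x)"
      by (rule blinfun_eqI)
         (simp add: blinfun.sum_left bounded_linear_Blinfun_apply[OF bl]
           linear_basis_expansion[OF has_derivative_linear[OF d], symmetric])
  qed
qed

text \<open>The inverse function theorem for continuously differentiable maps gives a differentiable inverse \<open>g\<close> with derivative the inverse of
  \<open>f' (g y)\<close>; each order of differentiability of \<open>g\<close> therefore yields the next.\<close>

lemma smooth_inverse_function:
  fixes f :: "'a::euclidean_space \<Rightarrow> 'a"
  assumes f: "smooth_on U f" and x0: "x0 \<in> U" and inj: "inj (frechet_derivative f (at x0))"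
  obtains U' V g where "open U'" "U' \<subseteq> U" "x0 \<in> U'" "open V" "f x0 \<in> V"
    "homeomorphism U' V f g" "smooth_on V g"
proof -
  have U: "open U" using f by (simp add: smooth_on_def)
  let ?D = "\<lambda>x. frechet_derivative f (at x)" and ?A = "\<lambda>x. Blinfun (frechet_derivative f (at x))"
  have D: "(f has_derivative ?D x) (at x)" if "x \<in> U" for x
    using smooth_on_has_derivative[OF f that] .
  have app: "blinfun_apply (?A x) = ?D x" if "x \<in> U" for x
    by (rule bounded_linear_Blinfun_apply[OF has_derivative_bounded_linear[OF D[OF that]]])
  have DA: "(f has_derivative blinfun_apply (?A x)) (at x)" if "x \<in> U" for x
    using D app that by simp
  have CkA: "Ck_on k U ?A" for k
    using Ck_on_Blinfun_derivative[OF U, of k f] f unfolding smooth_on_def by blast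
  have contA: "continuous_on U ?A" using CkA[of 0] by simp
  have lin: "linear (?D x0)" using D[OF x0] by (rule has_derivative_linear)
  obtain h where h: "linear h" "\<And>x. h (?D x0 x) = x"
    using linear_injective_left_inverse[OF lin inj] by (metis comp_apply id_apply)
  have inv: "Blinfun h o\<^sub>L ?A x0 = id_blinfun"
    using h x0 by (intro blinfun_eqI) (simp add: app bounded_linear_Blinfun_apply linear_conv_bounded_linear)
  obtain U' V g g' where U': "open U'" "U' \<subseteq> U" "x0 \<in> U'" and V: "open V" "f x0 \<in> V"
    and hom: "homeomorphism U' V f g"
    and g: "\<And>y. y \<in> V \<Longrightarrow> (g has_derivative (g' y)) (at y)"
    and g': "\<And>y. y \<in> V \<Longrightarrow> g' y = inv (blinfun_apply (?A (g y)))"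
    and bij: "\<And>y. y \<in> V \<Longrightarrow> bij (blinfun_apply (?A (g y)))"
    using inverse_function_theorem[OF U DA contA x0 inv] by blast
  have gV: "g ` V \<subseteq> U" using hom U'(2) by (auto simp: homeomorphism_def)
  define G where "G = (\<lambda>y. Blinfun (g' y))"
  have G: "blinfun_apply (G y) = g' y" if "y \<in> V" for y
    unfolding G_def using g[OF that] by (intro bounded_linear_Blinfun_apply has_derivative_bounded_linear)
  have AG: "?A (g y) o\<^sub>L G y = id_blinfun" "G y o\<^sub>L ?A (g y) = id_blinfun" if "y \<in> V" for y
    using bij[OF that] by (auto intro!: blinfun_eqI simp: G[OF that] g'[OF that] bij_is_surj surj_f_inv_f bij_is_inj)
  have "Ck_on k V g" for k
  proof (induction k)
    case 0
    show ?case using g by (auto intro!: continuous_at_imp_continuous_on has_derivative_continuous)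
  next
    case (Suc k)
    have "Ck_on k V (\<lambda>y. ?A (g y))" using Ck_on_compose[OF V(1) U gV CkA Suc] .
    then have "Ck_on k V G" using Ck_on_blinfun_inverse[OF V(1)] AG by blast
    then have "Ck_on k V (\<lambda>y. blinfun_apply (G y) v)" for v
      by (rule Ck_on_compose_bounded_linear[OF V(1) blinfun.bounded_linear_left])
    then have "Ck_on k V (\<lambda>y. g' y v)" for v
      using Ck_on_cong[OF V(1), of k "\<lambda>y. blinfun_apply (G y) v" "\<lambda>y. g' y v"] G by simp
    then show ?case using Ck_on_SucI[OF V(1) g] by blast
  qed
  then show thesis using that U' V hom by (simp add: smooth_on_def)
qed

section \<open>Symmetry of the second derivative\<close>

text \<open>The mean value theorem in the direction \<open>h\<close> reduces the second difference to an increment of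
  \<open>f' h\<close>, whose derivative at \<open>p\<close> is \<open>A\<close>.  Symmetry follows because the second difference is symmetric in
  \<open>h\<close> and \<open>k\<close>.\<close>

lemma second_difference_estimate:
  fixes f :: "'a::real_normed_vector \<Rightarrow> real"
  assumes U: "open U" "p \<in> U" and f: "\<And>x. x \<in> U \<Longrightarrow> (f has_derivative f' x) (at x)"
    and A: "((\<lambda>x. f' x h) has_derivative A) (at p)" and \<epsilon>: "\<epsilon> > 0"
  shows "\<exists>\<delta>>0. \<forall>s. 0 < s \<and> s < \<delta> \<longrightarrow>
    \<bar>f (p + s *\<^sub>R h + s *\<^sub>R k) - f (p + s *\<^sub>R h) - f (p + s *\<^sub>R k) + f p - s\<^sup>2 * A k\<bar> \<le> \<epsilon> * s\<^sup>2"
proof -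
  \<comment> \<open>The increments stay within \<open>s * N\<close>, and dividing \<open>\<epsilon>\<close> by \<open>N\<close> absorbs the two error terms.\<close>
  define N where "N = 2 * norm h + norm k + 1"
  have N: "N > 0" by (simp add: N_def add_nonneg_pos)
  define \<epsilon>' where "\<epsilon>' = \<epsilon> / N"
  have \<epsilon>': "\<epsilon>' > 0" using \<epsilon> N by (simp add: \<epsilon>'_def)
  obtain d1 where d1: "d1 > 0" "ball p d1 \<subseteq> U" using U open_contains_ball by blast
  obtain d2 where d2: "d2 > 0" "\<And>x. norm (x - p) < d2 \<Longrightarrow> norm (f' x h - f' p h - A (x - p)) \<le> \<epsilon>' * norm (x - p)"
    using A[unfolded has_derivative_at_alt] \<epsilon>' by blast
  have lin: "linear A" using A by (rule has_derivative_linear)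
  show ?thesis
  proof (intro exI[where x="min d1 d2 / N"] conjI allI impI)
    show "0 < min d1 d2 / N" using d1 d2 N by simp
    fix s :: real assume s: "0 < s \<and> s < min d1 d2 / N"
    then have sN: "s * N < d1" "s * N < d2" using N by (simp_all add: pos_less_divide_eq)
    have nrm: "norm (\<tau> *\<^sub>R h + \<sigma> *\<^sub>R k) \<le> \<tau> * norm h + \<sigma> * norm k" if "0 \<le> \<tau>" "0 \<le> \<sigma>" for \<tau> \<sigma>
      using norm_triangle_ineq[of "\<tau> *\<^sub>R h" "\<sigma> *\<^sub>R k"] that by simp
    have bd: "\<tau> * norm h + \<sigma> * norm k < s * N" if "\<tau> \<le> s" "\<sigma> \<le> s" for \<tau> \<sigma>
    proof -
      have "\<tau> * norm h + \<sigma> * norm k \<le> s * norm h + s * norm k"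
        using that by (intro add_mono mult_right_mono) auto
      also have "\<dots> < s * N" using s mult_nonneg_nonneg[of s "norm h"] by (simp add: N_def algebra_simps add_pos_nonneg)
      finally show ?thesis .
    qed
    have small: "norm (\<tau> *\<^sub>R h + \<sigma> *\<^sub>R k) < s * N" if "0 \<le> \<tau>" "0 \<le> \<sigma>" "\<tau> \<le> s" "\<sigma> \<le> s" for \<tau> \<sigma>
      using nrm[OF that(1,2)] bd[OF that(3,4)] by simp
    have inU: "p + \<tau> *\<^sub>R h + \<sigma> *\<^sub>R k \<in> U" if "0 \<le> \<tau>" "0 \<le> \<sigma>" "\<tau> \<le> s" "\<sigma> \<le> s" for \<tau> \<sigma>
    proof -
      have "dist p (p + (\<tau> *\<^sub>R h + \<sigma> *\<^sub>R k)) = norm (\<tau> *\<^sub>R h + \<sigma> *\<^sub>R k)"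
        by (metis add_diff_cancel_left' dist_commute dist_norm)
      then have "dist p (p + (\<tau> *\<^sub>R h + \<sigma> *\<^sub>R k)) < d1" using small[OF that] sN(1) by linarith
      then show ?thesis using d1(2) by (auto simp: add.assoc)
    qed
    define g where "g = (\<lambda>\<tau>. f (p + \<tau> *\<^sub>R h + s *\<^sub>R k) - f (p + \<tau> *\<^sub>R h))"
    have d: "((\<lambda>\<tau>. f (p + \<tau> *\<^sub>R h + \<sigma> *\<^sub>R k)) has_derivative (\<lambda>t. t * f' (p + \<tau> *\<^sub>R h + \<sigma> *\<^sub>R k) h)) (at \<tau>)"
      if "0 \<le> \<tau>" "0 \<le> \<sigma>" "\<tau> \<le> s" "\<sigma> \<le> s" for \<tau> \<sigma>
    proof -
      have "((\<lambda>\<tau>. p + \<tau> *\<^sub>R h + \<sigma> *\<^sub>R k) has_derivative (\<lambda>t. t *\<^sub>R h)) (at \<tau>)"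
        by (auto intro!: derivative_eq_intros)
      from has_derivative_compose[OF this f[OF inU[OF that]]]
      show ?thesis using linear_cmul[OF has_derivative_linear[OF f[OF inU[OF that]]]] by simp
    qed
    have dg: "(g has_derivative (\<lambda>t. t * (f' (p + \<tau> *\<^sub>R h + s *\<^sub>R k) h - f' (p + \<tau> *\<^sub>R h) h))) (at \<tau>)"
      if "0 \<le> \<tau>" "\<tau> \<le> s" for \<tau>
      using has_derivative_diff[OF d[of \<tau> s] d[of \<tau> 0]] that s unfolding g_def by (simp add: algebra_simps)
    obtain \<theta> where \<theta>: "0 < \<theta>" "\<theta> < s"
      and mv: "g s - g 0 = (s - 0) * (f' (p + \<theta> *\<^sub>R h + s *\<^sub>R k) h - f' (p + \<theta> *\<^sub>R h) h)"
    proof (rule mvt[where f'="\<lambda>\<tau> t. t * (f' (p + \<tau> *\<^sub>R h + s *\<^sub>R k) h - f' (p + \<tau> *\<^sub>R h) h)"])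
      show "0 < s" using s by simp
      show "continuous_on {0..s} g"
        using has_derivative_continuous[OF dg] by (intro continuous_at_imp_continuous_on) auto
    qed (use dg in auto)
    have e1: "norm (f' (p + (\<theta> *\<^sub>R h + s *\<^sub>R k)) h - f' p h - A (\<theta> *\<^sub>R h + s *\<^sub>R k)) \<le> \<epsilon>' * norm (\<theta> *\<^sub>R h + s *\<^sub>R k)"
      using d2(2)[of "p + (\<theta> *\<^sub>R h + s *\<^sub>R k)"] small[of \<theta> s] sN \<theta> s by simp
    have e2: "norm (f' (p + \<theta> *\<^sub>R h) h - f' p h - A (\<theta> *\<^sub>R h)) \<le> \<epsilon>' * norm (\<theta> *\<^sub>R h)"
      using d2(2)[of "p + \<theta> *\<^sub>R h"] small[of \<theta> 0] sN \<theta> s by simp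
    have "A (\<theta> *\<^sub>R h + s *\<^sub>R k) = A (\<theta> *\<^sub>R h) + s * A k"
      by (simp add: linear_add[OF lin] linear_cmul[OF lin])
    then have "\<bar>f' (p + \<theta> *\<^sub>R h + s *\<^sub>R k) h - f' (p + \<theta> *\<^sub>R h) h - s * A k\<bar>
        \<le> \<epsilon>' * norm (\<theta> *\<^sub>R h + s *\<^sub>R k) + \<epsilon>' * norm (\<theta> *\<^sub>R h)"
      using e1 e2 by (simp add: add.assoc)
    also have "\<dots> = \<epsilon>' * (norm (\<theta> *\<^sub>R h + s *\<^sub>R k) + norm (\<theta> *\<^sub>R h))" by (simp add: algebra_simps)
    also have "\<dots> \<le> \<epsilon>' * (s * N)"
    proof (rule mult_left_mono)
      have "\<theta> * norm h \<le> s * norm h" using \<theta> by (intro mult_right_mono) auto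
      then show "norm (\<theta> *\<^sub>R h + s *\<^sub>R k) + norm (\<theta> *\<^sub>R h) \<le> s * N"
        using nrm[of \<theta> s] \<theta> s by (simp add: N_def algebra_simps)
    qed (use \<epsilon>' in simp)
    also have "\<dots> = \<epsilon> * s" using N by (simp add: \<epsilon>'_def)
    finally have fin: "\<bar>f' (p + \<theta> *\<^sub>R h + s *\<^sub>R k) h - f' (p + \<theta> *\<^sub>R h) h - s * A k\<bar> \<le> \<epsilon> * s" .
    have "f (p + s *\<^sub>R h + s *\<^sub>R k) - f (p + s *\<^sub>R h) - f (p + s *\<^sub>R k) + f p - s\<^sup>2 * A k = g s - g 0 - s\<^sup>2 * A k"
      by (simp add: g_def)
    also have "\<dots> = s * (f' (p + \<theta> *\<^sub>R h + s *\<^sub>R k) h - f' (p + \<theta> *\<^sub>R h) h - s * A k)"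
      unfolding mv by (simp add: power2_eq_square algebra_simps)
    also have "\<bar>\<dots>\<bar> \<le> s * (\<epsilon> * s)"
      unfolding abs_mult using fin s by (intro mult_mono) auto
    finally show "\<bar>f (p + s *\<^sub>R h + s *\<^sub>R k) - f (p + s *\<^sub>R h) - f (p + s *\<^sub>R k) + f p - s\<^sup>2 * A k\<bar> \<le> \<epsilon> * s\<^sup>2"
      by (simp add: power2_eq_square mult_ac)
  qed
qed

lemma second_derivative_symmetric_real:
  fixes f :: "'a::real_normed_vector \<Rightarrow> real"
  assumes U: "open U" "p \<in> U" and f: "\<And>x. x \<in> U \<Longrightarrow> (f has_derivative f' x) (at x)"
    and A: "((\<lambda>x. f' x h) has_derivative A) (at p)" and B: "((\<lambda>x. f' x k) has_derivative B) (at p)"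
  shows "A k = B h"
proof (rule ccontr)
  assume "A k \<noteq> B h"
  define \<epsilon> where "\<epsilon> = \<bar>A k - B h\<bar> / 3"
  have \<epsilon>: "\<epsilon> > 0" using \<open>A k \<noteq> B h\<close> by (simp add: \<epsilon>_def)
  obtain d1 where d1: "d1 > 0" "\<And>s. 0 < s \<Longrightarrow> s < d1 \<Longrightarrow>
    \<bar>f (p + s *\<^sub>R h + s *\<^sub>R k) - f (p + s *\<^sub>R h) - f (p + s *\<^sub>R k) + f p - s\<^sup>2 * A k\<bar> \<le> \<epsilon> * s\<^sup>2"
    using second_difference_estimate[OF U f A \<epsilon>, of k] by blast
  obtain d2 where d2: "d2 > 0" "\<And>s. 0 < s \<Longrightarrow> s < d2 \<Longrightarrow>
    \<bar>f (p + s *\<^sub>R k + s *\<^sub>R h) - f (p + s *\<^sub>R k) - f (p + s *\<^sub>R h) + f p - s\<^sup>2 * B h\<bar> \<le> \<epsilon> * s\<^sup>2"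
    using second_difference_estimate[OF U f B \<epsilon>, of h] by blast
  define s where "s = min d1 d2 / 2"
  have s: "0 < s" "s < d1" "s < d2" using d1 d2 by (auto simp: s_def)
  have c: "p + s *\<^sub>R k + s *\<^sub>R h = p + s *\<^sub>R h + s *\<^sub>R k" by simp
  have "\<bar>s\<^sup>2 * A k - s\<^sup>2 * B h\<bar> \<le> \<epsilon> * s\<^sup>2 + \<epsilon> * s\<^sup>2"
    using d1(2)[OF s(1,2)] d2(2)[OF s(1,3)] unfolding c by linarith
  also have "s\<^sup>2 * A k - s\<^sup>2 * B h = s\<^sup>2 * (A k - B h)" by (simp add: algebra_simps)
  finally have "s\<^sup>2 * \<bar>A k - B h\<bar> \<le> s\<^sup>2 * (2 * \<epsilon>)" by (simp add: abs_mult mult_ac)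
  then have "\<bar>A k - B h\<bar> \<le> 2 * \<epsilon>" using s by simp
  then show False using \<epsilon> by (simp add: \<epsilon>_def)
qed

lemma second_derivative_symmetric:
  fixes f :: "'a::real_normed_vector \<Rightarrow> 'b::real_inner"
  assumes U: "open U" "p \<in> U" and f: "\<And>x. x \<in> U \<Longrightarrow> (f has_derivative f' x) (at x)"
    and A: "((\<lambda>x. f' x h) has_derivative A) (at p)" and B: "((\<lambda>x. f' x k) has_derivative B) (at p)"
  shows "A k = B h"
proof -
  have "A k \<bullet> z = B h \<bullet> z" for z
    using second_derivative_symmetric_real[OF U, of "\<lambda>x. f x \<bullet> z" "\<lambda>x v. f' x v \<bullet> z" h "\<lambda>v. A v \<bullet> z" k "\<lambda>v. B v \<bullet> z"]
      f A B by (simp add: has_derivative_inner_left)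
  then show ?thesis by (meson vector_eq_rdot)
qed

section \<open>Tangent spaces of embedded submanifolds\<close>

definition defining_map ::
  "nat \<Rightarrow> 'a::euclidean_space set \<Rightarrow> 'a set \<Rightarrow> 'a set \<Rightarrow> ('a \<Rightarrow> 'a) \<Rightarrow> bool" where
  "defining_map k S U W F \<longleftrightarrow>
     subspace W \<and> dim W + k = DIM('a) \<and> smooth_on U F \<and> F ` U \<subseteq> W \<and> S \<inter> U = {x\<in>U. F x = 0} \<and>
     (\<forall>x\<in>S \<inter> U. range (frechet_derivative F (at x)) = W)"

lemma embedded_submanifold_iff_defining_map:
  "embedded_submanifold k S \<longleftrightarrow> (\<forall>p\<in>S. \<exists>U W F. p \<in> U \<and> defining_map k S U W F)"
  unfolding embedded_submanifold_def defining_map_def by blast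

lemma dim_range_plus_dim_kernel:
  fixes D :: "'a::euclidean_space \<Rightarrow> 'b::euclidean_space"
  assumes D: "linear D" shows "dim (range D) + dim {v. D v = 0} = DIM('a)"
proof -
  define K where "K = {v. D v = 0}"
  define L where "L = {y. \<forall>x\<in>K. orthogonal x y}"
  have K: "subspace K" unfolding K_def by (rule linear_subspace_kernel[OF D])
  have L: "subspace L" unfolding L_def by (rule subspace_orthogonal_to_vectors)
  have dim: "dim L + dim K = DIM('a)"
    unfolding L_def using dim_subspace_orthogonal_to_vectors[OF K subspace_UNIV] by simp
  have "x = y" if "x \<in> L" "y \<in> L" "D x = D y" for x y
  proof -
    have "x - y \<in> L" "x - y \<in> K" using that L linear_diff[OF D] by (auto simp: K_def intro: subspace_diff)
    then have "orthogonal (x - y) (x - y)" by (simp add: L_def)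
    then show ?thesis by (simp add: orthogonal_def)
  qed
  then have "inj_on D (span L)" unfolding span_eq_iff[THEN iffD2, OF L] inj_on_def by blast
  then have "dim (D ` L) = dim L" using dim_image_eq[OF D] by blast
  moreover have "D ` L = range D"
  proof safe
    fix x
    obtain y z where yz: "y \<in> span K" "\<And>w. w \<in> span K \<Longrightarrow> orthogonal z w" "x = y + z"
      using orthogonal_subspace_decomp_exists by metis
    then have "D x = D z" "z \<in> L" using K linear_add[OF D]
      by (auto simp: K_def L_def span_eq_iff[THEN iffD2, OF K, unfolded K_def] orthogonal_commute)
    then show "D x \<in> D ` L" by blast
  qed auto
  ultimately show ?thesis using dim by (simp add: K_def)
qed

text \<open>Orthogonal projection onto \<open>T0\<close>, followed by an isomorphism onto \<open>T\<close>.\<close>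

lemma linear_map_injective_on_subspace:
  fixes T0 T :: "'a::euclidean_space set"
  assumes "subspace T0" "subspace T" "dim T0 = dim T"
  obtains J :: "'a \<Rightarrow> 'a" where "linear J" "range J \<subseteq> T" "\<And>x. x \<in> T0 \<Longrightarrow> J x = 0 \<Longrightarrow> x = 0"
proof -
  obtain f where f: "linear f" "f ` T0 = T" "inj_on f T0"
    using subspace_isomorphism[OF assms] by blast
  obtain B where B: "B \<subseteq> T0" "pairwise orthogonal B" "\<And>x. x \<in> B \<Longrightarrow> norm x = 1" "span B = T0" "independent B"
    using orthonormal_basis_subspace[OF assms(1)] by metis
  have fin: "finite B" using B(5) independent_imp_finite by blast
  define \<pi> where "\<pi> = (\<lambda>x::'a. \<Sum>b\<in>B. (x \<bullet> b) *\<^sub>R b)"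
  have lin: "linear \<pi>" unfolding \<pi>_def
    by (intro linear_compose_sum ballI linearI) (auto simp: inner_add_left scaleR_add_left)
  have rng: "\<pi> x \<in> T0" for x unfolding \<pi>_def
    using B(4) by (auto intro: span_sum span_scale span_base)
  have id: "\<pi> x = x" if "x \<in> T0" for x
  proof -
    have "\<pi> b = b" if "b \<in> B" for b
    proof -
      have "\<pi> b = (\<Sum>c\<in>B. if c = b then b else 0)" unfolding \<pi>_def
        using B(2) that B(3)[OF that] by (intro sum.cong) (auto simp: pairwise_def orthogonal_def dot_square_norm)
      then show ?thesis using fin that by simp
    qed
    then have "\<pi> x = id x" if "x \<in> span B" for x
      using linear_eq_on_span[OF lin linear_id _ that] by simp
    then show ?thesis using that B(4) by simp
  qed
  show thesis
  proof (rule that[of "f \<circ> \<pi>"])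
    show "linear (f \<circ> \<pi>)" using f(1) lin linear_compose by blast
    show "range (f \<circ> \<pi>) \<subseteq> T" using f(2) rng by auto
    show "x = 0" if "x \<in> T0" "(f \<circ> \<pi>) x = 0" for x
      using that id f(1,3) linear_0[OF f(1)] subspace_0[OF assms(1)] by (auto simp: inj_on_def)
  qed
qed

text \<open>If \<open>T\<close> is the orthogonal complement of \<open>W\<close> and \<open>J\<close> maps the kernel of \<open>dF\<close> isomorphically
  onto \<open>T\<close>, then \<open>x \<mapsto> F x + J (x - p)\<close> is a local diffeomorphism that maps \<open>S\<close> to \<open>T\<close>.  Its inverse
  restricted to \<open>T\<close> parametrises \<open>S\<close>.\<close>

lemma local_parametrization:
  fixes F :: "'a::euclidean_space \<Rightarrow> 'a"
  assumes "defining_map k S U W F" and p: "p \<in> S \<inter> U"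
  obtains T e and \<psi> :: "'a \<Rightarrow> 'a" and O' where "subspace T" "e > 0" "smooth_on (ball 0 e) \<psi>" "\<psi> 0 = p"
    "\<psi> ` (ball 0 e \<inter> T) \<subseteq> S" "open O'" "p \<in> O'" "S \<inter> O' \<subseteq> \<psi> ` (ball 0 e \<inter> T)"
    "\<And>v. frechet_derivative F (at p) v = 0 \<Longrightarrow> \<exists>h\<in>T. frechet_derivative \<psi> (at 0) h = v"
proof -
  have W: "subspace W" and F: "smooth_on U F" "F ` U \<subseteq> W" and SU: "S \<inter> U = {x\<in>U. F x = 0}"
    and rngF: "range (frechet_derivative F (at p)) = W"
    using assms unfolding defining_map_def by auto
  have U: "open U" and pU: "p \<in> U" "F p = 0" using F p SU by (auto simp: smooth_on_def)
  let ?D = "frechet_derivative F (at p)"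
  have D: "(F has_derivative ?D) (at p)" using smooth_on_has_derivative[OF F(1) pU(1)] .
  have linD: "linear ?D" using D has_derivative_linear by blast
  define T0 where "T0 = {v. ?D v = 0}"
  have T0: "subspace T0" unfolding T0_def by (rule linear_subspace_kernel[OF linD])
  define T where "T = {y. \<forall>x\<in>W. orthogonal x y}"
  have T: "subspace T" unfolding T_def by (rule subspace_orthogonal_to_vectors)
  have "dim T + dim W = dim (UNIV :: 'a set)"
    unfolding T_def using dim_subspace_orthogonal_to_vectors[OF W subspace_UNIV] by (simp add: add.commute)
  moreover have "dim (range ?D) + dim T0 = dim (UNIV :: 'a set)"
    unfolding T0_def using dim_range_plus_dim_kernel[OF linD] by simp
  ultimately have "dim T0 = dim T" using rngF by simp
  then obtain J where J: "linear J" "range J \<subseteq> T" "\<And>x. x \<in> T0 \<Longrightarrow> J x = 0 \<Longrightarrow> x = 0"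
    using linear_map_injective_on_subspace[OF T0 T] by metis
  have blJ: "bounded_linear J" using J(1) linear_conv_bounded_linear by blast
  have TW: "z = 0" if "z \<in> T" "z \<in> W" for z
    using that unfolding T_def orthogonal_def by force
  define \<Phi> where "\<Phi> = (\<lambda>x. F x + (J x + - J p))"
  have sm: "smooth_on U \<Phi>" unfolding \<Phi>_def
    by (intro smooth_on_add F(1) smooth_on_const U smooth_on_bounded_linear blJ)
  have d\<Phi>: "(\<Phi> has_derivative (\<lambda>v. ?D v + J v)) (at p)" unfolding \<Phi>_def
    using has_derivative_add[OF D has_derivative_add[OF bounded_linear_imp_has_derivative[OF blJ] has_derivative_const[where c="- J p"]]]
    by simp
  then have d\<Phi>': "frechet_derivative \<Phi> (at p) = (\<lambda>v. ?D v + J v)"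
    using frechet_derivative_at by metis
  have "inj (frechet_derivative \<Phi> (at p))"
  proof (subst linear_injective_0)
    show "linear (frechet_derivative \<Phi> (at p))" unfolding d\<Phi>' by (intro linear_compose_add linD J(1))
    show "\<forall>x. frechet_derivative \<Phi> (at p) x = 0 \<longrightarrow> x = 0"
    proof (intro allI impI)
      fix v assume "frechet_derivative \<Phi> (at p) v = 0"
      then have eq: "?D v = - J v" unfolding d\<Phi>' by (simp add: add_eq_0_iff2)
      have "?D v \<in> W" using rngF by blast
      moreover have "?D v \<in> T" unfolding eq using J(2) T by (auto intro: subspace_neg)
      ultimately have "?D v = 0" using TW by blast
      then show "v = 0" using J(3)[of v] eq by (simp add: T0_def)
    qed
  qed
  then obtain U' V g where U': "open U'" "U' \<subseteq> U" "p \<in> U'" and V: "open V" "\<Phi> p \<in> V"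
    and hom: "homeomorphism U' V \<Phi> g" and g: "smooth_on V g"
    using smooth_inverse_function[OF sm pU(1)] by metis
  have \<Phi>p: "\<Phi> p = 0" by (simp add: \<Phi>_def pU)
  obtain e where e: "e > 0" "ball 0 e \<subseteq> V" using V \<Phi>p open_contains_ball by metis
  show thesis
  proof (rule that[of T e g "U' \<inter> \<Phi> -` ball 0 e"])
    show "subspace T" "e > 0" by fact+
    show "smooth_on (ball 0 e) g" using g e(2) smooth_on_subset by blast
    show g0: "g 0 = p" using hom U'(3) \<Phi>p by (metis homeomorphism_apply1)
    show "g ` (ball 0 e \<inter> T) \<subseteq> S"
    proof safe
      fix y :: 'a assume y: "y \<in> ball 0 e" "y \<in> T"
      then have yV: "y \<in> V" using e by blast
      then have gy: "g y \<in> U'" and \<Phi>g: "\<Phi> (g y) = y" using hom by (auto simp: homeomorphism_def)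
      have "F (g y) = y - (J (g y) - J p)" using \<Phi>g by (simp add: \<Phi>_def algebra_simps)
      also have "\<dots> \<in> T" using y(2) J(2) T by (auto intro!: subspace_diff)
      finally have "F (g y) = 0" using TW F(2) gy U'(2) by blast
      then show "g y \<in> S" using SU gy U'(2) by blast
    qed
    show "open (U' \<inter> \<Phi> -` ball 0 e)"
      using hom U'(1) by (intro continuous_open_preimage) (auto simp: homeomorphism_def)
    show "p \<in> U' \<inter> \<Phi> -` ball 0 e" using U'(3) \<Phi>p e by simp
    show "S \<inter> (U' \<inter> \<Phi> -` ball 0 e) \<subseteq> g ` (ball 0 e \<inter> T)"
    proof safe
      fix x assume x: "x \<in> S" "x \<in> U'" "\<Phi> x \<in> ball 0 e"
      then have "F x = 0" using SU U'(2) by blast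
      then have "\<Phi> x = J x - J p" by (simp add: \<Phi>_def)
      then have "\<Phi> x \<in> T" using J(2) T by (auto intro!: subspace_diff)
      moreover have "g (\<Phi> x) = x" using hom x(2) by (metis homeomorphism_apply1)
      ultimately show "x \<in> g ` (ball 0 e \<inter> T)" using x(3) by (metis IntI imageI)
    qed
    show "\<exists>h\<in>T. frechet_derivative g (at 0) h = v" if v: "?D v = 0" for v
    proof
      show "J v \<in> T" using J(2) by blast
      have dg: "(g has_derivative frechet_derivative g (at 0)) (at (\<Phi> p))"
        using smooth_on_has_derivative[OF g V(2)] \<Phi>p by simp
      have "((\<lambda>x. g (\<Phi> x)) has_derivative (\<lambda>v. frechet_derivative g (at 0) (?D v + J v))) (at p)"
        using has_derivative_compose[OF d\<Phi> dg] .
      moreover have "((\<lambda>x. g (\<Phi> x)) has_derivative (\<lambda>v. v)) (at p)"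
        using hom by (intro has_derivative_transform_within_open[OF has_derivative_ident U'(1,3)]) (metis homeomorphism_apply1)
      ultimately have "(\<lambda>v. frechet_derivative g (at 0) (?D v + J v)) = (\<lambda>v. v)"
        by (rule has_derivative_unique)
      then have "frechet_derivative g (at 0) (?D v + J v) = v" by metis
      then show "frechet_derivative g (at 0) (J v) = v" using v by simp
    qed
  qed
qed

lemma has_vector_derivative_along_line:
  assumes "(f has_derivative f') (at (y + t *\<^sub>R h))"
  shows "((\<lambda>t. f (y + t *\<^sub>R h)) has_vector_derivative f' h) (at t)"
proof -
  have "((\<lambda>t. y + t *\<^sub>R h) has_derivative (\<lambda>s. s *\<^sub>R h)) (at t)"
    by (auto intro!: derivative_eq_intros)
  from has_derivative_compose[OF this assms] show ?thesis
    by (simp add: has_vector_derivative_def linear_cmul[OF has_derivative_linear[OF assms]])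
qed

lemma tangent_space_parametrization:
  assumes T: "subspace T" and \<psi>: "smooth_on (ball 0 e) \<psi>" "\<psi> ` (ball 0 e \<inter> T) \<subseteq> S"
    and y: "y \<in> ball 0 e \<inter> T" and h: "h \<in> T"
  shows "frechet_derivative \<psi> (at y) h \<in> tangent_space S (\<psi> y)"
proof -
  define d where "d = (e - norm y) / (norm h + 1)"
  have d: "d > 0" using y by (auto simp: d_def intro!: divide_pos_pos add_nonneg_pos)
  have inb: "y + t *\<^sub>R h \<in> ball 0 e \<inter> T" if "t \<in> {-d<..<d}" for t
  proof -
    have "\<bar>t\<bar> * norm h \<le> \<bar>t\<bar> * (norm h + 1)" by (intro mult_left_mono) auto
    also have "\<dots> < d * (norm h + 1)" using that by (intro mult_strict_right_mono) (auto intro: add_nonneg_pos)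
    also have "\<dots> = e - norm y" by (simp add: d_def add_nonneg_eq_0_iff)
    finally have "norm y + norm (t *\<^sub>R h) < e" by simp
    then have "norm (y + t *\<^sub>R h) < e" using norm_triangle_ineq le_less_trans by blast
    then show ?thesis using T y h by (auto intro: subspace_add subspace_scale)
  qed
  have lin: "smooth_on {-d<..<d} (\<lambda>t. y + t *\<^sub>R h)"
    by (intro smooth_on_add smooth_on_const smooth_on_bounded_linear bounded_linear_scaleR_left) auto
  show ?thesis
    unfolding tangent_space_def
  proof (intro CollectI exI[of _ d] conjI exI[of _ "\<lambda>t. \<psi> (y + t *\<^sub>R h)"])
    show "smooth_on {-d<..<d} (\<lambda>t. \<psi> (y + t *\<^sub>R h))"
      using smooth_on_compose[OF \<psi>(1) lin] inb by blast
    show "(\<lambda>t. \<psi> (y + t *\<^sub>R h)) ` {-d<..<d} \<subseteq> S" using inb \<psi>(2) by blast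
    show "((\<lambda>t. \<psi> (y + t *\<^sub>R h)) has_vector_derivative frechet_derivative \<psi> (at y) h) (at 0)"
      using has_vector_derivative_along_line[of \<psi> _ y 0 h] smooth_on_has_derivative[OF \<psi>(1)] y by simp
  qed (use d in auto)
qed

lemma tangent_space_eq_kernel:
  assumes F: "defining_map k S U W F" and p: "p \<in> S \<inter> U"
  shows "tangent_space S p = {v. frechet_derivative F (at p) v = 0}"
proof (intro subset_antisym subsetI CollectI)
  fix v assume "v \<in> {v. frechet_derivative F (at p) v = 0}"
  then have v: "frechet_derivative F (at p) v = 0" by simp
  obtain T e and \<psi> :: "'a \<Rightarrow> 'a" and O' where T: "subspace T" "e > 0" "smooth_on (ball 0 e) \<psi>" "\<psi> 0 = p"
    "\<psi> ` (ball 0 e \<inter> T) \<subseteq> S" "open O'" "p \<in> O'" "S \<inter> O' \<subseteq> \<psi> ` (ball 0 e \<inter> T)"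
    "\<And>v. frechet_derivative F (at p) v = 0 \<Longrightarrow> \<exists>h\<in>T. frechet_derivative \<psi> (at 0) h = v"
    using local_parametrization[OF F p] by metis
  obtain h where h: "h \<in> T" "frechet_derivative \<psi> (at 0) h = v" using T(9)[OF v] by blast
  have "0 \<in> ball 0 e \<inter> T" using T subspace_0 by auto
  from tangent_space_parametrization[OF T(1,3,5) this h(1)] show "v \<in> tangent_space S p"
    using h(2) T(4) by simp
next
  fix v assume "v \<in> tangent_space S p"
  then obtain e \<gamma> where e: "e > 0" and \<gamma>: "smooth_on {-e<..<e} \<gamma>" "\<gamma> ` {-e<..<e} \<subseteq> S" "\<gamma> 0 = p"
    "(\<gamma> has_vector_derivative v) (at 0)" unfolding tangent_space_def by blast
  have sm: "smooth_on U F" and SU: "S \<inter> U = {x\<in>U. F x = 0}" using F by (auto simp: defining_map_def)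
  then have U: "open U" by (simp add: smooth_on_def)
  have D: "(F has_derivative frechet_derivative F (at p)) (at (\<gamma> 0))"
    using smooth_on_has_derivative[OF sm] p \<gamma>(3) by blast
  have "((\<lambda>t. F (\<gamma> t)) has_derivative (\<lambda>t. frechet_derivative F (at p) (t *\<^sub>R v))) (at 0)"
    using has_derivative_compose[OF \<gamma>(4)[unfolded has_vector_derivative_def] D] .
  moreover have "((\<lambda>t. F (\<gamma> t)) has_derivative (\<lambda>t. 0)) (at 0)"
  proof (rule has_derivative_transform_within_open[OF has_derivative_const])
    have "continuous_on {-e<..<e} \<gamma>" using \<gamma>(1) smooth_on_imp_continuous_on by blast
    then show "open ({-e<..<e} \<inter> \<gamma> -` U)" using U by (intro continuous_open_preimage) auto
    show "0 \<in> {-e<..<e} \<inter> \<gamma> -` U" using e \<gamma>(3) p by simp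
    show "0 = F (\<gamma> t)" if "t \<in> {-e<..<e} \<inter> \<gamma> -` U" for t
      using that \<gamma>(2) SU by force
  qed
  ultimately have "(\<lambda>t. frechet_derivative F (at p) (t *\<^sub>R v)) = (\<lambda>t. 0)" by (rule has_derivative_unique)
  then have "frechet_derivative F (at p) (1 *\<^sub>R v) = 0" by meson
  then show "frechet_derivative F (at p) v = 0" by simp
qed

text \<open>Near \<open>p\<close>, every point is joined to \<open>p\<close> by the image of a straight segment, a curve in \<open>S\<close>
  with velocities in the tangent spaces.\<close>

lemma submanifold_locally_constant:
  fixes q :: "'a::euclidean_space \<Rightarrow> real"
  assumes S: "embedded_submanifold k S" and p: "p \<in> S"
    and q: "\<And>e \<gamma> v. e > 0 \<Longrightarrow> \<gamma> ` {-e<..<e} \<subseteq> S \<Longrightarrow> (\<gamma> has_vector_derivative v) (at 0) \<Longrightarrow>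
      v \<in> tangent_space S (\<gamma> 0) \<Longrightarrow> ((\<lambda>t. q (\<gamma> t)) has_vector_derivative 0) (at 0)"
  shows "\<exists>O'. open O' \<and> p \<in> O' \<and> (\<forall>x\<in>S \<inter> O'. q x = q p)"
proof -
  obtain U W F where F: "defining_map k S U W F" "p \<in> S \<inter> U"
    using S p unfolding embedded_submanifold_iff_defining_map by blast
  obtain T e and \<psi> :: "'a \<Rightarrow> 'a" and O' where T: "subspace T" "e > 0" "smooth_on (ball 0 e) \<psi>" "\<psi> 0 = p"
    "\<psi> ` (ball 0 e \<inter> T) \<subseteq> S" "open O'" "p \<in> O'" "S \<inter> O' \<subseteq> \<psi> ` (ball 0 e \<inter> T)"
    "\<And>v. frechet_derivative F (at p) v = 0 \<Longrightarrow> \<exists>h\<in>T. frechet_derivative \<psi> (at 0) h = v"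
    using local_parametrization[OF F] by metis
  have "q x = q p" if x: "x \<in> S \<inter> O'" for x
  proof -
    obtain y where y: "y \<in> ball 0 e" "y \<in> T" "x = \<psi> y" using x T(8) by blast
    have der: "((\<lambda>t. q (\<psi> (t *\<^sub>R y))) has_vector_derivative 0) (at t)" if t: "t \<in> {0..1}" for t
    proof -
      have nt: "norm (t *\<^sub>R y) < e"
        using t y(1) mult_left_le_one_le[of "norm y" t] by simp
      then have z: "t *\<^sub>R y \<in> ball 0 e \<inter> T" using T(1) y(2) by (auto intro: subspace_scale)
      have "continuous_on UNIV (\<lambda>s. t *\<^sub>R y + s *\<^sub>R y)" by (intro continuous_intros)
      then have "open ((\<lambda>s. t *\<^sub>R y + s *\<^sub>R y) -` ball 0 e)" using open_vimage open_ball by blast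
      moreover have "0 \<in> (\<lambda>s. t *\<^sub>R y + s *\<^sub>R y) -` ball 0 e" using z by simp
      ultimately obtain d where d: "d > 0" "ball 0 d \<subseteq> (\<lambda>s. t *\<^sub>R y + s *\<^sub>R y) -` ball 0 e"
        using open_contains_ball by meson
      let ?\<gamma> = "\<lambda>s. \<psi> (t *\<^sub>R y + s *\<^sub>R y)"
      have "((\<lambda>s. q (?\<gamma> s)) has_vector_derivative 0) (at 0)"
      proof (rule q[OF d(1)])
        have "t *\<^sub>R y + s *\<^sub>R y \<in> ball 0 e \<inter> T" if "s \<in> {-d<..<d}" for s
        proof -
          have "s \<in> ball 0 d" using that by (auto simp: dist_real_def abs_less_iff)
          then have "t *\<^sub>R y + s *\<^sub>R y \<in> ball 0 e" using d(2) by blast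
          then show ?thesis using T(1) y(2) by (auto intro: subspace_add subspace_scale)
        qed
        then show "?\<gamma> ` {-d<..<d} \<subseteq> S" using T(5) by blast
        show "(?\<gamma> has_vector_derivative frechet_derivative \<psi> (at (t *\<^sub>R y)) y) (at 0)"
          using has_vector_derivative_along_line[of \<psi> _ "t *\<^sub>R y" 0 y] smooth_on_has_derivative[OF T(3)] z by simp
        show "frechet_derivative \<psi> (at (t *\<^sub>R y)) y \<in> tangent_space S (?\<gamma> 0)"
          using tangent_space_parametrization[OF T(1,3,5) z y(2)] by simp
      qed
      then have "(((\<lambda>s. q (?\<gamma> s)) \<circ> (\<lambda>r. r - t)) has_vector_derivative 1 *\<^sub>R 0) (at t)"
        by (intro vector_diff_chain_at) (auto intro!: derivative_eq_intros)
      then show ?thesis by (simp add: o_def scaleR_add_left[symmetric])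
    qed
    have "q (\<psi> (1 *\<^sub>R y)) = q (\<psi> (0 *\<^sub>R y))"
      by (rule has_derivative_zero_unique[of "{0..1}" "\<lambda>t. q (\<psi> (t *\<^sub>R y))" 1 0])
         (use der in \<open>auto simp: has_vector_derivative_def intro: has_derivative_at_withinI\<close>)
    then show ?thesis using y(3) T(4) by simp
  qed
  then show ?thesis using T(6,7) by blast
qed

lemma submanifold_constant:
  fixes q :: "'a::euclidean_space \<Rightarrow> real"
  assumes S: "embedded_submanifold k S" "connected S"
    and q: "\<And>e \<gamma> v. e > 0 \<Longrightarrow> \<gamma> ` {-e<..<e} \<subseteq> S \<Longrightarrow> (\<gamma> has_vector_derivative v) (at 0) \<Longrightarrow>
      v \<in> tangent_space S (\<gamma> 0) \<Longrightarrow> ((\<lambda>t. q (\<gamma> t)) has_vector_derivative 0) (at 0)"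
  shows "q constant_on S"
proof (rule locally_constant_imp_constant[OF S(2)])
  show "\<exists>T. openin (top_of_set S) T \<and> a \<in> T \<and> (\<forall>x\<in>T. q x = q a)" if a: "a \<in> S" for a
  proof -
    have "\<exists>O'. open O' \<and> a \<in> O' \<and> (\<forall>x\<in>S \<inter> O'. q x = q a)"
      by (rule submanifold_locally_constant[OF S(1) a q])
    then obtain O' where O': "open O'" "a \<in> O'" "\<forall>x\<in>S \<inter> O'. q x = q a" by blast
    have "openin (top_of_set S) (S \<inter> O')" using O'(1) by (rule openin_open_Int)
    then show ?thesis using O' a by blast
  qed
qed

text \<open>The coordinate fields \<open>X\<close> and \<open>Y\<close> of a local parametrisation, each restricted to a coordinate curve
  of the other.  They have the same derivative \<open>w\<close> at \<open>p\<close> since second derivatives are symmetric, which expresses that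
  their bracket vanishes.\<close>

lemma submanifold_commuting_fields:
  fixes S :: "'a::euclidean_space set"
  assumes S: "embedded_submanifold k S" and p: "p \<in> S"
    and u: "u \<in> tangent_space S p" and v: "v \<in> tangent_space S p"
  obtains e \<alpha> \<beta> X Y w where "e > 0" "\<alpha> ` {-e<..<e} \<subseteq> S" "\<beta> ` {-e<..<e} \<subseteq> S" "\<alpha> 0 = p" "\<beta> 0 = p"
    "(\<alpha> has_vector_derivative u) (at 0)" "(\<beta> has_vector_derivative v) (at 0)"
    "\<And>t. t \<in> {-e<..<e} \<Longrightarrow> X t \<in> tangent_space S (\<beta> t)" "X 0 = u" "(X has_vector_derivative w) (at 0)"
    "\<And>t. t \<in> {-e<..<e} \<Longrightarrow> Y t \<in> tangent_space S (\<alpha> t)" "Y 0 = v" "(Y has_vector_derivative w) (at 0)"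
proof -
  obtain U W F where F: "defining_map k S U W F" "p \<in> S \<inter> U"
    using S p unfolding embedded_submanifold_iff_defining_map by blast
  obtain T e and \<psi> :: "'a \<Rightarrow> 'a" and O' where T: "subspace T" "e > 0" "smooth_on (ball 0 e) \<psi>" "\<psi> 0 = p"
    "\<psi> ` (ball 0 e \<inter> T) \<subseteq> S" "open O'" "p \<in> O'" "S \<inter> O' \<subseteq> \<psi> ` (ball 0 e \<inter> T)"
    "\<And>v. frechet_derivative F (at p) v = 0 \<Longrightarrow> \<exists>h\<in>T. frechet_derivative \<psi> (at 0) h = v"
    using local_parametrization[OF F] by metis
  let ?\<psi> = "\<lambda>y. frechet_derivative \<psi> (at y)"
  obtain h k where h: "h \<in> T" "?\<psi> 0 h = u" and k: "k \<in> T" "?\<psi> 0 k = v"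
    using u v T(9) unfolding tangent_space_eq_kernel[OF F] by blast
  have sm2: "smooth_on (ball 0 e) (\<lambda>y. ?\<psi> y l)" for l using smooth_on_frechet_derivative[OF T(3)] .
  have d1: "(\<psi> has_derivative ?\<psi> y) (at y)" if "y \<in> ball 0 e" for y
    using smooth_on_has_derivative[OF T(3) that] .
  have d2: "((\<lambda>y. ?\<psi> y l) has_derivative frechet_derivative (\<lambda>y. ?\<psi> y l) (at y)) (at y)" if "y \<in> ball 0 e" for y l
    using smooth_on_has_derivative[OF sm2 that] .
  have 0: "(0::'a) \<in> ball 0 e" using T(2) by simp
  have sym: "frechet_derivative (\<lambda>y. ?\<psi> y h) (at 0) k = frechet_derivative (\<lambda>y. ?\<psi> y k) (at 0) h"
    by (rule second_derivative_symmetric[OF open_ball 0 d1 d2[OF 0] d2[OF 0]])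
  define d where "d = e / (norm h + norm k + 1)"
  have pos: "norm h + norm k + 1 > 0" by (simp add: add_nonneg_pos)
  have d: "d > 0" using T(2) pos by (simp add: d_def)
  have inb: "t *\<^sub>R l \<in> ball 0 e \<inter> T" if "t \<in> {-d<..<d}" "l \<in> {h, k}" for t l
  proof -
    have "norm (t *\<^sub>R l) = \<bar>t\<bar> * norm l" by simp
    also have "\<dots> \<le> \<bar>t\<bar> * (norm h + norm k + 1)" using that(2) by (intro mult_left_mono) auto
    also have "\<dots> < d * (norm h + norm k + 1)" using that(1) pos by (intro mult_strict_right_mono) auto
    also have "\<dots> = e" using pos by (simp add: d_def)
    finally show ?thesis using T(1) that(2) h k by (auto intro: subspace_scale)
  qed
  have line: "((\<lambda>t. f (t *\<^sub>R l)) has_vector_derivative f' l) (at 0)" if "(f has_derivative f') (at 0)"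
    for f :: "'a \<Rightarrow> 'a" and f' l
    using has_vector_derivative_along_line[of f f' 0 0 l] that by simp
  show thesis
  proof (rule that[OF d, of "\<lambda>t. \<psi> (t *\<^sub>R h)" "\<lambda>t. \<psi> (t *\<^sub>R k)" "\<lambda>t. ?\<psi> (t *\<^sub>R k) h" _ "\<lambda>t. ?\<psi> (t *\<^sub>R h) k"])
    show "(\<lambda>t. \<psi> (t *\<^sub>R h)) ` {-d<..<d} \<subseteq> S" "(\<lambda>t. \<psi> (t *\<^sub>R k)) ` {-d<..<d} \<subseteq> S" using inb T(5) by blast+
    show "((\<lambda>t. \<psi> (t *\<^sub>R h)) has_vector_derivative u) (at 0)" using line[OF d1[OF 0], of h] h by simp
    show "((\<lambda>t. \<psi> (t *\<^sub>R k)) has_vector_derivative v) (at 0)" using line[OF d1[OF 0], of k] k by simp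
    show "?\<psi> (t *\<^sub>R k) h \<in> tangent_space S (\<psi> (t *\<^sub>R k))" if "t \<in> {-d<..<d}" for t
      using tangent_space_parametrization[OF T(1,3,5)] inb[OF that] h by blast
    show "?\<psi> (t *\<^sub>R h) k \<in> tangent_space S (\<psi> (t *\<^sub>R h))" if "t \<in> {-d<..<d}" for t
      using tangent_space_parametrization[OF T(1,3,5)] inb[OF that] k by blast
    show "((\<lambda>t. ?\<psi> (t *\<^sub>R k) h) has_vector_derivative frechet_derivative (\<lambda>y. ?\<psi> y h) (at 0) k) (at 0)"
      by (rule line[OF d2[OF 0]])
    show "((\<lambda>t. ?\<psi> (t *\<^sub>R h) k) has_vector_derivative frechet_derivative (\<lambda>y. ?\<psi> y h) (at 0) k) (at 0)"
      unfolding sym by (rule line[OF d2[OF 0]])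
  qed (use T(4) h k in auto)
qed

section \<open>Functions along curves\<close>

lemma smooth_along_differentiable:
  assumes "smooth_along M f" "x \<in> M" shows "f differentiable (at x within M)"
proof -
  obtain U g where g: "x \<in> U" "smooth_on U g" "\<forall>y\<in>M \<inter> U. f y = g y"
    using assms unfolding smooth_along_def by blast
  have "open U" using g(2) by (simp add: smooth_on_def)
  then obtain d where d: "d > 0" "ball x d \<subseteq> U" using g(1) open_contains_ball by blast
  have "(g has_derivative frechet_derivative g (at x)) (at x within M)"
    using smooth_on_has_derivative[OF g(2,1)] by (rule has_derivative_at_withinI)
  then have "(f has_derivative frechet_derivative g (at x)) (at x within M)"
    by (rule has_derivative_transform_within[OF _ d(1) assms(2)])
       (use g(3) d(2) in \<open>auto simp: dist_commute subset_iff\<close>)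
  then show ?thesis by (auto simp: differentiable_def)
qed

lemma vector_derivative_eq_of_eq_near:
  fixes f g :: "real \<Rightarrow> 'a::real_normed_vector"
  assumes "(f has_vector_derivative a) (at 0)" "(g has_vector_derivative b) (at 0)"
    and "e > 0" "\<And>t. t \<in> {-e<..<e} \<Longrightarrow> f t = g t"
  shows "a = b"
proof -
  have "(g has_vector_derivative a) (at 0)"
    by (rule has_vector_derivative_transform_within_open[OF assms(1), of "{-e<..<e}"]) (use assms in auto)
  then show ?thesis using assms(2) vector_derivative_unique_at by blast
qed

lemma curvature_along_curve_tendsto:
  assumes \<kappa>: "continuous_on M \<kappa>"
    and \<gamma>: "e > 0" "\<gamma> ` {-e<..<e} \<subseteq> M" "(\<gamma> has_vector_derivative v) (at (0::real))"
  shows "((\<lambda>t. \<kappa> (\<gamma> t)) \<longlongrightarrow> \<kappa> (\<gamma> 0)) (at 0)"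
proof (rule continuous_on_tendsto_compose[OF \<kappa>])
  show "(\<gamma> \<longlongrightarrow> \<gamma> 0) (at 0)"
    using has_vector_derivative_continuous[OF \<gamma>(3)] by (simp add: isCont_def)
  show "\<gamma> 0 \<in> M" using \<gamma> by auto
  have "eventually (\<lambda>t. t \<in> {-e<..<e}) (at 0)"
    using \<gamma>(1) by (intro eventually_at_in_open') auto
  then show "\<forall>\<^sub>F t in at 0. \<gamma> t \<in> M" by eventually_elim (use \<gamma>(2) in blast)
qed

lemma eventually_at_0_interval:
  fixes P :: "real \<Rightarrow> bool"
  assumes "eventually P (at 0)" "P 0"
  obtains d where "d > 0" "\<And>t. t \<in> {-d<..<d} \<Longrightarrow> P t"
proof -
  obtain d where d: "d > 0" "\<And>t. t \<noteq> 0 \<and> dist t 0 < d \<Longrightarrow> P t"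
    using assms(1) unfolding eventually_at by auto
  show thesis
  proof (rule that[OF d(1)])
    show "P t" if "t \<in> {-d<..<d}" for t
      using that d(2)[of t] assms(2) by (cases "t = 0") (auto simp: dist_real_def abs_less_iff)
  qed
qed

lemma signed_root_along_curve:
  fixes m :: "real \<Rightarrow> real"
  assumes "(m has_vector_derivative m') (at 0)" "0 < c + s * m 0"
  obtains r where "((\<lambda>t. \<sigma> * sqrt (c + s * m t)) has_vector_derivative r) (at 0)"
proof -
  have "(m has_real_derivative m') (at 0)"
    using assms(1) by (simp add: has_real_derivative_iff_has_vector_derivative)
  then have "((\<lambda>t. \<sigma> * sqrt (c + s * m t)) has_real_derivative
      \<sigma> * ((s * m') * (inverse (sqrt (c + s * m 0)) / 2))) (at 0)"
    using assms(2) by (auto intro!: derivative_eq_intros)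
  then show thesis using that by (simp add: has_real_derivative_iff_has_vector_derivative)
qed

section \<open>Symmetric matrices in an orthonormal frame\<close>

lemma bounded_bilinear_matrix_mult:
  "bounded_bilinear ((**) :: real^'n^'m \<Rightarrow> real^'k^'n \<Rightarrow> real^'k^'m)"
proof -
  have "bilinear ((**) :: real^'n^'m \<Rightarrow> real^'k^'n \<Rightarrow> real^'k^'m)"
    unfolding bilinear_def
    by (intro allI conjI linearI)
       (simp_all add: vec_eq_iff matrix_matrix_mult_def sum.distrib sum_distrib_left algebra_simps)
  then show ?thesis by (simp add: bilinear_conv_bounded_bilinear)
qed

lemmas matrix_mult_add_left = bounded_bilinear.add_left[OF bounded_bilinear_matrix_mult]
  and matrix_mult_add_right = bounded_bilinear.add_right[OF bounded_bilinear_matrix_mult]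
  and matrix_mult_diff_left = bounded_bilinear.diff_left[OF bounded_bilinear_matrix_mult]
  and matrix_mult_diff_right = bounded_bilinear.diff_right[OF bounded_bilinear_matrix_mult]
  and matrix_mult_scaleR_left = bounded_bilinear.scaleR_left[OF bounded_bilinear_matrix_mult]
  and matrix_mult_scaleR_right = bounded_bilinear.scaleR_right[OF bounded_bilinear_matrix_mult]
  and matrix_mult_minus_left = bounded_bilinear.minus_left[OF bounded_bilinear_matrix_mult]
  and matrix_mult_minus_right = bounded_bilinear.minus_right[OF bounded_bilinear_matrix_mult]

lemma bounded_linear_trace: "bounded_linear (trace :: real^'n^'n \<Rightarrow> real)"
  unfolding linear_conv_bounded_linear[symmetric]
  by (rule linearI) (simp_all add: trace_def sum.distrib sum_distrib_left)

lemma bounded_linear_transpose: "bounded_linear (transpose :: real^'n^'n \<Rightarrow> real^'n^'n)"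
  unfolding linear_conv_bounded_linear[symmetric]
  by (rule linearI) (simp_all add: transpose_def vec_eq_iff)

lemma trace_scaleR: "trace (c *\<^sub>R A) = c * trace (A :: real^'n^'n)"
  by (simp add: trace_def sum_distrib_left)

lemma trace_zero: "trace (0 :: real^'n^'n) = 0" and trace_minus: "trace (- A) = - trace (A :: real^'n^'n)"
  by (simp_all add: trace_def sum_negf)

lemma transpose_add: "transpose (A + B) = transpose A + transpose (B :: real^'n^'n)"
  and transpose_diff: "transpose (A - B) = transpose A - transpose (B :: real^'n^'n)"
  by (simp_all add: transpose_def vec_eq_iff)

lemma symmetric_inner:
  fixes A :: "real^'n^'n"
  assumes "transpose A = A" shows "(A *v u) \<bullet> w = u \<bullet> (A *v w)"
  by (metis assms dot_lmul_matrix transpose_matrix_vector)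

lemma inner_eq_trace_symmetric:
  fixes A B :: "real^'n^'n"
  assumes "transpose B = B" shows "A \<bullet> B = trace (A ** B)"
  by (simp add: inner_matrix_eq_trace assms)

lemma vector_4:
  "(vector [x,y,z,w] ::('a::zero)^4)$1 = x"
  "(vector [x,y,z,w] ::('a::zero)^4)$2 = y"
  "(vector [x,y,z,w] ::('a::zero)^4)$3 = z"
  "(vector [x,y,z,w] ::('a::zero)^4)$4 = w"
  unfolding vector_def by simp_all

definition orthonormal4 :: "real^4 \<Rightarrow> real^4 \<Rightarrow> real^4 \<Rightarrow> real^4 \<Rightarrow> bool" where
  "orthonormal4 e1 e2 e3 e4 \<longleftrightarrow>
     e1 \<bullet> e1 = 1 \<and> e2 \<bullet> e2 = 1 \<and> e3 \<bullet> e3 = 1 \<and> e4 \<bullet> e4 = 1 \<and> e1 \<bullet> e2 = 0 \<and> e1 \<bullet> e3 = 0 \<and> e1 \<bullet> e4 = 0 \<and>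
     e2 \<bullet> e3 = 0 \<and> e2 \<bullet> e4 = 0 \<and> e3 \<bullet> e4 = 0"

lemma orthonormal4_inner:
  assumes "orthonormal4 e1 e2 e3 e4"
  shows "e1 \<bullet> e1 = 1" "e2 \<bullet> e2 = 1" "e3 \<bullet> e3 = 1" "e4 \<bullet> e4 = 1"
     "e1 \<bullet> e2 = 0" "e1 \<bullet> e3 = 0" "e1 \<bullet> e4 = 0" "e2 \<bullet> e3 = 0" "e2 \<bullet> e4 = 0" "e3 \<bullet> e4 = 0"
     "e2 \<bullet> e1 = 0" "e3 \<bullet> e1 = 0" "e4 \<bullet> e1 = 0" "e3 \<bullet> e2 = 0" "e4 \<bullet> e2 = 0" "e4 \<bullet> e3 = 0"
  using assms by (auto simp: orthonormal4_def inner_commute)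

lemma orthogonal_matrix_iff_orthonormal4:
  fixes P :: "real^4^4"
  shows "orthogonal_matrix P \<longleftrightarrow> orthonormal4 (P$1) (P$2) (P$3) (P$4)"
proof -
  have "orthogonal_matrix P \<longleftrightarrow> P ** transpose P = mat 1"
    unfolding orthogonal_matrix_def using matrix_left_right_inverse by blast
  also have "\<dots> \<longleftrightarrow> (\<forall>i j. P$i \<bullet> P$j = (if i = j then 1 else 0))"
    by (simp add: matrix_mult_transpose_dot_row vec_eq_iff mat_def row_def vec_nth_inverse)
  also have "\<dots> \<longleftrightarrow> orthonormal4 (P$1) (P$2) (P$3) (P$4)"
    by (auto simp: forall_4 orthonormal4_def inner_commute)
  finally show ?thesis .
qed

lemma orthonormal4_expand:
  assumes "orthonormal4 e1 e2 e3 e4"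
  shows "z = (e1 \<bullet> z) *\<^sub>R e1 + (e2 \<bullet> z) *\<^sub>R e2 + (e3 \<bullet> z) *\<^sub>R e3 + (e4 \<bullet> z) *\<^sub>R e4"
proof -
  let ?P = "vector [e1, e2, e3, e4] :: real^4^4"
  have "orthogonal_matrix ?P"
    using assms by (simp add: orthogonal_matrix_iff_orthonormal4 vector_4)
  then have "transpose ?P *v (?P *v z) = z"
    by (simp add: matrix_vector_mul_assoc orthogonal_matrix del: transpose_matrix_vector)
  moreover have "(transpose ?P *v y)$i = (\<Sum>k\<in>UNIV. ?P$k$i * y$k)" for y i
    by (simp add: matrix_vector_mult_def transpose_def del: transpose_matrix_vector)
  ultimately have "z$i = (\<Sum>k\<in>UNIV. ?P$k$i * (?P$k \<bullet> z))" for i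
    by (metis (no_types, lifting) matrix_vector_mul_component sum.cong)
  then show ?thesis by (simp add: vec_eq_iff sum_4 vector_4 mult.commute)
qed

lemma orthonormal4_vector_eqI:
  assumes "orthonormal4 e1 e2 e3 e4"
    and "e1 \<bullet> y = e1 \<bullet> z" "e2 \<bullet> y = e2 \<bullet> z" "e3 \<bullet> y = e3 \<bullet> z" "e4 \<bullet> y = e4 \<bullet> z"
  shows "y = z"
  using orthonormal4_expand[OF assms(1), of y] orthonormal4_expand[OF assms(1), of z] assms(2-) by simp

lemma orthonormal4_matrix_eqI:
  fixes A B :: "real^4^4"
  assumes e: "orthonormal4 e1 e2 e3 e4"
    and "A *v e1 = B *v e1" "A *v e2 = B *v e2" "A *v e3 = B *v e3" "A *v e4 = B *v e4"
  shows "A = B"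
proof -
  have "A *v z = B *v z" for z
  proof -
    have "C *v z = (e1 \<bullet> z) *\<^sub>R (C *v e1) + (e2 \<bullet> z) *\<^sub>R (C *v e2) + (e3 \<bullet> z) *\<^sub>R (C *v e3) + (e4 \<bullet> z) *\<^sub>R (C *v e4)"
      for C :: "real^4^4"
      by (subst orthonormal4_expand[OF e, of z]) (simp add: matrix_vector_right_distrib matrix_vector_mult_scaleR)
    then show ?thesis using assms by simp
  qed
  then show ?thesis by (simp add: matrix_eq)
qed

lemma orthonormal4_symmetric_eqI:
  fixes A B :: "real^4^4"
  assumes e: "orthonormal4 e1 e2 e3 e4" and sym: "transpose A = A" "transpose B = B"
    and "e1 \<bullet> (A *v e1) = e1 \<bullet> (B *v e1)" "e1 \<bullet> (A *v e2) = e1 \<bullet> (B *v e2)"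
    "e1 \<bullet> (A *v e3) = e1 \<bullet> (B *v e3)" "e1 \<bullet> (A *v e4) = e1 \<bullet> (B *v e4)"
    "e2 \<bullet> (A *v e2) = e2 \<bullet> (B *v e2)" "e2 \<bullet> (A *v e3) = e2 \<bullet> (B *v e3)"
    "e2 \<bullet> (A *v e4) = e2 \<bullet> (B *v e4)" "e3 \<bullet> (A *v e3) = e3 \<bullet> (B *v e3)"
    "e3 \<bullet> (A *v e4) = e3 \<bullet> (B *v e4)" "e4 \<bullet> (A *v e4) = e4 \<bullet> (B *v e4)"
  shows "A = B"
proof -
  have flip: "p \<bullet> (A *v q) = p \<bullet> (B *v q)" if "q \<bullet> (A *v p) = q \<bullet> (B *v p)" for p q
    using that symmetric_inner[OF sym(1), of p q] symmetric_inner[OF sym(2), of p q] by (simp add: inner_commute)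
  show ?thesis
    by (intro orthonormal4_matrix_eqI[OF e] orthonormal4_vector_eqI[OF e]) (use assms(4-) flip in auto)
qed

lemma trace_orthonormal4:
  fixes A :: "real^4^4"
  assumes "orthonormal4 e1 e2 e3 e4"
  shows "trace A = e1 \<bullet> (A *v e1) + e2 \<bullet> (A *v e2) + e3 \<bullet> (A *v e3) + e4 \<bullet> (A *v e4)"
proof -
  let ?P = "vector [e1, e2, e3, e4] :: real^4^4"
  have P: "transpose ?P ** ?P = mat 1"
    using assms by (simp add: orthogonal_matrix_iff_orthonormal4 vector_4 flip: orthogonal_matrix)
  have "trace A = trace ((A ** transpose ?P) ** ?P)"
    using P by (simp add: matrix_mul_assoc[symmetric])
  also have "\<dots> = trace (?P ** (A ** transpose ?P))" by (rule trace_mul_sym)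
  also have "\<dots> = (\<Sum>i\<in>UNIV. ?P$i \<bullet> (A *v ?P$i))"
    by (simp add: trace_def matrix_matrix_mult_def transpose_def inner_vec_def matrix_vector_mult_def)
  finally show ?thesis by (simp add: sum_4 vector_4)
qed

definition sym_outer :: "real^'n \<Rightarrow> real^'n \<Rightarrow> real^'n^'n" where
  "sym_outer p q = (\<chi> i j. p$i * q$j + q$i * p$j)"

lemma transpose_sym_outer: "transpose (sym_outer p q) = sym_outer p q"
  by (simp add: sym_outer_def transpose_def vec_eq_iff mult.commute)

lemma sym_outer_mult_vector: "sym_outer p q *v z = (q \<bullet> z) *\<^sub>R p + (p \<bullet> z) *\<^sub>R q"
  by (simp add: sym_outer_def vec_eq_iff matrix_vector_mult_def inner_vec_def sum_distrib_left
      sum.distrib[symmetric] algebra_simps)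

lemma inner_sym_outer:
  assumes "transpose A = A" shows "A \<bullet> sym_outer p q = 2 * (p \<bullet> (A *v q))"
proof -
  have "A \<bullet> sym_outer p q = p \<bullet> (A *v q) + q \<bullet> (A *v p)"
    by (simp add: sym_outer_def inner_vec_def matrix_vector_mult_def sum_distrib_left sum.distrib algebra_simps)
  then show ?thesis using symmetric_inner[OF assms, of p q] by (simp add: inner_commute)
qed

lemma sym_outer_nonzero:
  assumes "p \<bullet> p = 1" "q \<bullet> q = 1" "p \<bullet> q = 0" shows "sym_outer p q \<noteq> 0"
proof
  assume "sym_outer p q = 0"
  then have "sym_outer p q *v q = 0" by simp
  then have "p = 0" using assms by (simp add: sym_outer_mult_vector)
  then show False using assms by simp
qed

lemma smooth_on_matrix_mult:
  fixes f g :: "'a::euclidean_space \<Rightarrow> real^'n^'n"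
  shows "smooth_on U f \<Longrightarrow> smooth_on U g \<Longrightarrow> smooth_on U (\<lambda>x. f x ** g x)"
  by (rule smooth_on_bilinear[OF bounded_bilinear_matrix_mult])

lemma smooth_on_trace:
  fixes f :: "'a::euclidean_space \<Rightarrow> real^'n^'n"
  shows "smooth_on U f \<Longrightarrow> smooth_on U (\<lambda>x. trace (f x))"
  by (rule smooth_on_compose_bounded_linear[OF bounded_linear_trace])

lemmas has_vector_derivative_matrix_mult =
  bounded_bilinear.has_vector_derivative[OF bounded_bilinear_matrix_mult]

section \<open>Diagonalisation of symmetric matrices\<close>

text \<open>A maximum \<open>v\<close> of the quadratic form on the unit sphere of \<open>V\<close> is an eigenvector: otherwise the
  form, compared with \<open>c\<close> times the squared norm, would increase to first order in the direction \<open>f v - c v\<close>.\<close>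

lemma self_adjoint_eigenvector:
  fixes f :: "'a::euclidean_space \<Rightarrow> 'a"
  assumes f: "linear f" "\<And>x y. f x \<bullet> y = x \<bullet> f y"
    and V: "subspace V" "f ` V \<subseteq> V" "V \<noteq> {0}"
  obtains v c where "v \<in> V" "norm v = 1" "f v = c *\<^sub>R v"
proof -
  obtain z where z: "z \<in> V" "z \<noteq> 0" using V subspace_0 by blast
  let ?K = "V \<inter> sphere 0 1"
  have "compact ?K" using closed_subspace[OF V(1)] by (simp add: closed_Int_compact)
  moreover have "z /\<^sub>R norm z \<in> ?K" using z V(1) by (auto intro: subspace_scale)
  moreover have "continuous_on ?K (\<lambda>x. x \<bullet> f x)"
    using f(1) by (intro continuous_intros linear_continuous_on) (simp add: linear_conv_bounded_linear)
  ultimately obtain v where v: "v \<in> ?K" "\<And>x. x \<in> ?K \<Longrightarrow> x \<bullet> f x \<le> v \<bullet> f v"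
    using continuous_attains_sup[of ?K] by blast
  define c where "c = v \<bullet> f v"
  have vv: "v \<bullet> v = 1" using v(1) by (simp add: dot_square_norm)
  have max: "x \<bullet> f x \<le> c * (x \<bullet> x)" if "x \<in> V" for x
  proof (cases "x = 0")
    case False
    then have "x /\<^sub>R norm x \<in> ?K" using that V(1) by (auto intro: subspace_scale)
    then have "(x /\<^sub>R norm x) \<bullet> f (x /\<^sub>R norm x) \<le> c" unfolding c_def by (rule v(2))
    then have "(x \<bullet> f x) / (norm x)\<^sup>2 \<le> c"
      using linear_cmul[OF f(1)] by (simp add: power2_eq_square divide_inverse mult_ac)
    then show ?thesis using False by (simp add: divide_le_eq power2_norm_eq_inner)
  qed (simp add: linear_0[OF f(1)])
  define w where "w = f v - c *\<^sub>R v"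
  have w: "w \<in> V" using v(1) V(1,2) by (auto simp: w_def intro!: subspace_diff subspace_scale)
  have vw: "v \<bullet> w = 0" by (simp add: w_def inner_diff_right vv c_def)
  have ww: "w \<bullet> f v = w \<bullet> w"
    using vw by (simp add: w_def inner_diff_right inner_diff_left inner_commute)
  have ineq: "2 * (w \<bullet> w) \<le> t * (c * (w \<bullet> w) - w \<bullet> f w)" if t: "t > 0" for t
  proof -
    have "v + t *\<^sub>R w \<in> V" using v(1) w V(1) by (auto intro: subspace_add subspace_scale)
    from max[OF this] have "c + 2 * t * (w \<bullet> w) + t\<^sup>2 * (w \<bullet> f w) \<le> c * (1 + t\<^sup>2 * (w \<bullet> w))"
      using vw ww vv f(2)[of v w] unfolding c_def
      by (simp add: linear_add[OF f(1)] linear_cmul[OF f(1)] inner_add_left inner_add_right inner_commute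
          power2_eq_square algebra_simps)
    then have "t * (2 * (w \<bullet> w)) \<le> t * (t * (c * (w \<bullet> w) - w \<bullet> f w))"
      by (simp add: power2_eq_square algebra_simps)
    then show ?thesis using t by simp
  qed
  have "2 * (w \<bullet> w) \<le> 0"
  proof (rule field_le_epsilon)
    fix \<epsilon> :: real assume \<epsilon>: "\<epsilon> > 0"
    define K where "K = \<bar>c * (w \<bullet> w) - w \<bullet> f w\<bar> + 1"
    have K: "K > 0" by (simp add: K_def add_nonneg_pos)
    have "2 * (w \<bullet> w) \<le> \<epsilon> / K * (c * (w \<bullet> w) - w \<bullet> f w)" using \<epsilon> K by (intro ineq) simp
    also have "\<dots> \<le> \<epsilon> / K * K" using \<epsilon> K by (intro mult_left_mono) (auto simp: K_def)
    finally show "2 * (w \<bullet> w) \<le> 0 + \<epsilon>" using K by simp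
  qed
  then have "w = 0" using inner_ge_zero[of w] inner_eq_zero_iff[of w] by linarith
  then show thesis using that[of v c] v(1) by (simp add: w_def)
qed

lemma self_adjoint_orthonormal_eigenbasis:
  fixes f :: "'a::euclidean_space \<Rightarrow> 'a"
  assumes f: "linear f" "\<And>x y. f x \<bullet> y = x \<bullet> f y"
    and V: "subspace V" "f ` V \<subseteq> V"
  shows "\<exists>B. finite B \<and> card B = dim V \<and> B \<subseteq> V \<and> pairwise orthogonal B \<and>
    (\<forall>b\<in>B. norm b = 1 \<and> (\<exists>c. f b = c *\<^sub>R b))"
  using V
proof (induction "dim V" arbitrary: V)
  case 0
  show ?case by (rule exI[of _ "{}"]) (use 0 in simp)
next
  case (Suc n)
  have "V \<noteq> {0}" using Suc.hyps(2) by auto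
  then obtain v c where v: "v \<in> V" "norm v = 1" "f v = c *\<^sub>R v"
    using self_adjoint_eigenvector[OF f Suc.prems] by blast
  define V' where "V' = {y \<in> V. \<forall>x\<in>span {v}. orthogonal x y}"
  have V'_iff: "y \<in> V' \<longleftrightarrow> y \<in> V \<and> v \<bullet> y = 0" for y
    by (auto simp: V'_def orthogonal_def span_singleton)
  have sub: "subspace V'" using Suc.prems(1) by (auto simp: subspace_def V'_iff inner_add_right)
  have "dim V' + dim (span {v}) = dim V"
    unfolding V'_def using v(1) Suc.prems(1) span_minimal[of "{v}" V]
    by (intro dim_subspace_orthogonal_to_vectors) auto
  moreover have "dim (span {v}) = 1"
  proof -
    have "v \<noteq> 0" using v(2) by force
    then show ?thesis by (simp add: dim_insert)
  qed
  ultimately have dim: "n = dim V'" using Suc.hyps(2) by simp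
  have inv: "f ` V' \<subseteq> V'"
    using Suc.prems(2) v(3) f(2)[of v, symmetric] by (auto simp: V'_iff image_subset_iff)
  obtain B where B: "finite B" "card B = dim V'" "B \<subseteq> V'" "pairwise orthogonal B"
    "\<forall>b\<in>B. norm b = 1 \<and> (\<exists>c. f b = c *\<^sub>R b)"
    using Suc.hyps(1)[OF dim sub inv] by blast
  have "v \<notin> B" using B(3) v(2) by (auto simp: V'_iff subset_iff dot_square_norm)
  then show ?case
    using B v Suc.hyps(2) dim
    by (intro exI[of _ "insert v B"])
       (auto simp: pairwise_insert orthogonal_def V'_iff subset_iff inner_commute)
qed

lemma symmetric_matrix_diagonalisable:
  fixes x :: "real^4^4"
  assumes "transpose x = x"
  obtains e1 e2 e3 e4 l1 l2 l3 l4 where "orthonormal4 e1 e2 e3 e4"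
    "x *v e1 = l1 *\<^sub>R e1" "x *v e2 = l2 *\<^sub>R e2" "x *v e3 = l3 *\<^sub>R e3" "x *v e4 = l4 *\<^sub>R e4"
proof -
  obtain B where B: "finite B" "card B = dim (UNIV :: (real^4) set)" "pairwise orthogonal B"
    "\<forall>b\<in>B. norm b = 1 \<and> (\<exists>c. x *v b = c *\<^sub>R b)"
    using self_adjoint_orthonormal_eigenbasis[OF matrix_vector_mul_linear symmetric_inner[OF assms], of UNIV]
    by auto
  have "card B = card (UNIV :: 4 set)" using B(2) by simp
  then obtain e :: "4 \<Rightarrow> real^4" where e: "bij_betw e UNIV B"
    using finite_same_card_bij[of "UNIV :: 4 set" B] B(1) by auto
  have inB: "e i \<in> B" for i using e by (auto simp: bij_betw_def)
  have one: "e i \<bullet> e i = 1" for i using B(4) inB[of i] by (simp add: dot_square_norm)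
  have orth: "e i \<bullet> e j = 0" if "i \<noteq> j" for i j
  proof -
    have "e i \<noteq> e j" using e that by (auto simp: bij_betw_def inj_on_def)
    then show ?thesis using B(3) inB by (auto simp: pairwise_def orthogonal_def)
  qed
  have "\<exists>l. x *v e i = l *\<^sub>R e i" for i using B(4) inB by blast
  then obtain l where l: "\<And>i. x *v e i = l i *\<^sub>R e i" by metis
  have "orthonormal4 (e 1) (e 2) (e 3) (e 4)"
    unfolding orthonormal4_def by (simp add: one orth)
  then show thesis using that l by blast
qed

section \<open>The hypersurface in terms of traces\<close>

definition eigenframe :: "real^4^4 \<Rightarrow> real^4 \<Rightarrow> real^4 \<Rightarrow> real^4 \<Rightarrow> real^4 \<Rightarrow> real \<Rightarrow> real \<Rightarrow> bool" where
  "eigenframe x e1 e2 e3 e4 \<mu> \<nu> \<longleftrightarrow> orthonormal4 e1 e2 e3 e4 \<and>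
     x *v e1 = \<mu> *\<^sub>R e1 \<and> x *v e2 = - \<mu> *\<^sub>R e2 \<and> x *v e3 = \<nu> *\<^sub>R e3 \<and> x *v e4 = - \<nu> *\<^sub>R e4"

text \<open>The sign of each eigenvalue and the order of the two pairs can be chosen freely.\<close>

lemma eigenframe_swap12: "eigenframe x e1 e2 e3 e4 \<mu> \<nu> \<Longrightarrow> eigenframe x e2 e1 e3 e4 (- \<mu>) \<nu>"
  and eigenframe_swap34: "eigenframe x e1 e2 e3 e4 \<mu> \<nu> \<Longrightarrow> eigenframe x e1 e2 e4 e3 \<mu> (- \<nu>)"
  and eigenframe_swap_pairs: "eigenframe x e1 e2 e3 e4 \<mu> \<nu> \<Longrightarrow> eigenframe x e3 e4 e1 e2 \<nu> \<mu>"
  and eigenframe_minus: "eigenframe x e1 e2 e3 e4 \<mu> \<nu> \<Longrightarrow> eigenframe x (- e1) e2 e3 e4 \<mu> \<nu>"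
  by (auto simp: eigenframe_def orthonormal4_def inner_commute linear_neg[OF matrix_vector_mul_linear])

lemma symmetric_eigenframe:
  assumes "eigenframe x e1 e2 e3 e4 \<mu> \<nu>" shows "transpose x = x"
proof -
  have e: "orthonormal4 e1 e2 e3 e4" using assms by (simp add: eigenframe_def)
  have p: "p \<bullet> (transpose x *v q) = q \<bullet> (x *v p)" for p q
    by (metis dot_lmul_matrix inner_commute transpose_matrix_vector)
  have o: "e1 \<bullet> e1 = 1" "e2 \<bullet> e2 = 1" "e3 \<bullet> e3 = 1" "e4 \<bullet> e4 = 1" 
     "e1 \<bullet> e2 = 0" "e1 \<bullet> e3 = 0" "e1 \<bullet> e4 = 0" "e2 \<bullet> e3 = 0" "e2 \<bullet> e4 = 0" "e3 \<bullet> e4 = 0"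
     "e2 \<bullet> e1 = 0" "e3 \<bullet> e1 = 0" "e4 \<bullet> e1 = 0" "e3 \<bullet> e2 = 0" "e4 \<bullet> e2 = 0" "e4 \<bullet> e3 = 0"
    using e by (auto simp: orthonormal4_def inner_commute)
  show ?thesis
    by (intro orthonormal4_matrix_eqI[OF e] orthonormal4_vector_eqI[OF e])
       (use assms in \<open>simp_all add: p eigenframe_def o del: transpose_matrix_vector\<close>)
qed

lemma trace_power_eigenframe:
  assumes "eigenframe x e1 e2 e3 e4 \<mu> \<nu>"
  shows "trace x = 0" "trace (x ** x) = 2 * (\<mu>\<^sup>2 + \<nu>\<^sup>2)" "trace (x ** x ** x) = 0"
    "trace ((x ** x) ** (x ** x)) = 2 * (\<mu>^4 + \<nu>^4)"
proof -
  have e: "orthonormal4 e1 e2 e3 e4" using assms by (simp add: eigenframe_def)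
  note s = matrix_vector_mul_assoc[symmetric] matrix_vector_mult_scaleR
  show "trace x = 0" "trace (x ** x) = 2 * (\<mu>\<^sup>2 + \<nu>\<^sup>2)" "trace (x ** x ** x) = 0"
    "trace ((x ** x) ** (x ** x)) = 2 * (\<mu>^4 + \<nu>^4)"
    using assms unfolding trace_orthonormal4[OF e] eigenframe_def orthonormal4_def
    by (auto simp: s linear_neg[OF matrix_vector_mul_linear] power2_eq_square power4_eq_xxxx)
qed

lemma eigenframe_conjugate_diag4:
  fixes P :: "real^4^4"
  assumes "orthogonal_matrix P"
  shows "eigenframe (transpose P ** diag4 a (- a) b (- b) ** P) (P$1) (P$2) (P$3) (P$4) a b"
proof -
  let ?D = "diag4 a (- a) b (- b)"
  have PP: "P ** transpose P = mat 1" using assms by (simp add: orthogonal_matrix_def)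
  have cT: "transpose P *v axis i 1 = P$i" for i
    by (simp add: matrix_vector_mult_basis column_transpose row_def vec_eq_iff del: transpose_matrix_vector)
  have r: "P *v (P$i) = axis i 1" for i
  proof -
    have "P *v (transpose P *v axis i 1) = axis i 1"
      by (simp add: matrix_vector_mul_assoc PP del: transpose_matrix_vector)
    then show ?thesis by (simp only: cT)
  qed
  have D: "?D *v axis i 1 = (?D$i$i) *\<^sub>R axis i 1" for i
  proof -
    have entry: "(?D *v axis i 1)$k = ?D$k$i" for k
      by (simp add: matrix_vector_mul_component inner_axis)
    show ?thesis unfolding vec_eq_iff entry by (simp add: diag4_def axis_def)
  qed
  have c: "transpose P *v (c *\<^sub>R axis i 1) = c *\<^sub>R P$i" for c i
    by (simp only: matrix_vector_mult_scaleR cT)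
  have "(transpose P ** ?D ** P) *v (P$i) = (?D$i$i) *\<^sub>R P$i" for i
    unfolding matrix_vector_mul_assoc[symmetric] r D c ..
  from this[of 1] this[of 2] this[of 3] this[of 4] show ?thesis
    using assms by (simp add: eigenframe_def orthogonal_matrix_iff_orthonormal4 diag4_def vector_4)
qed

lemma diag4_in_S4_iff: "diag4 a (- a) b (- b) \<in> S4 \<longleftrightarrow> a\<^sup>2 + b\<^sup>2 = 1/2"
proof -
  let ?D = "diag4 a (- a) b (- b)"
  have "?D \<bullet> ?D = 2 * (a\<^sup>2 + b\<^sup>2)"
    by (simp add: inner_vec_def sum_4 diag4_def vector_4 power2_eq_square)
  then have "norm ?D = 1 \<longleftrightarrow> a\<^sup>2 + b\<^sup>2 = 1/2" by (auto simp: norm_eq_1)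
  moreover have "?D \<in> E4"
    by (auto simp: E4_def transpose_def trace_def diag4_def vec_eq_iff sum_4 vector_4)
  ultimately show ?thesis by (auto simp: S4_def unit_sphere_def)
qed

lemma B4_tilde_eigenframe:
  assumes "x \<in> B4_tilde"
  obtains e1 e2 e3 e4 a b where "eigenframe x e1 e2 e3 e4 a b" "a > b" "b > 0" "a\<^sup>2 + b\<^sup>2 = 1/2"
proof -
  obtain P a b where "rotation_matrix P" "a > b" "b > 0" "diag4 a (- a) b (- b) \<in> S4"
    "x = transpose P ** diag4 a (- a) b (- b) ** P"
    using assms unfolding B4_tilde_def D4_tilde_def by blast
  then show thesis
    using that eigenframe_conjugate_diag4[of P a b] diag4_in_S4_iff by (auto simp: rotation_matrix_def)
qed

text \<open>If the orthogonal matrix with rows \<open>e1, e2, e3, e4\<close> has determinant \<open>-1\<close>, then replacing \<open>e1\<close> by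
  \<open>- e1\<close> makes it a rotation.\<close>

lemma ordered_eigenframe_in_B4_tilde:
  assumes x: "eigenframe x e1 e2 e3 e4 a b" and ab: "a > b" "b > 0" "a\<^sup>2 + b\<^sup>2 = 1/2"
  shows "x \<in> B4_tilde"
proof -
  define P where "P = (vector [e1, e2, e3, e4] :: real^4^4)"
  define Q where "Q = (vector [- e1, e2, e3, e4] :: real^4^4)"
  have conj: "x = transpose R ** diag4 a (- a) b (- b) ** R"
    if "R \<in> {P, Q}" for R
  proof -
    have R: "eigenframe x (R$1) (R$2) (R$3) (R$4) a b"
      using that x eigenframe_minus[OF x] by (auto simp: P_def Q_def vector_4)
    then have "orthogonal_matrix R" by (simp add: eigenframe_def orthogonal_matrix_iff_orthonormal4)
    from eigenframe_conjugate_diag4[OF this, of a b] R show ?thesis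
      unfolding eigenframe_def by (intro orthonormal4_matrix_eqI[of "R$1" "R$2" "R$3" "R$4"]) auto
  qed
  have orth: "orthogonal_matrix P" "orthogonal_matrix Q"
    using x eigenframe_minus[OF x] by (auto simp: P_def Q_def eigenframe_def orthogonal_matrix_iff_orthonormal4 vector_4)
  have "Q = diag4 (- 1) 1 1 1 ** P"
    by (simp add: P_def Q_def vec_eq_iff forall_4 matrix_matrix_mult_def sum_4 diag4_def vector_4)
  moreover have "det (diag4 (- 1) 1 1 1) = - 1"
  proof -
    have "det (diag4 (- 1) 1 1 1) = (\<Prod>i\<in>UNIV. diag4 (- 1) 1 1 1 $ i $ i)"
      by (rule det_diagonal) (simp add: diag4_def)
    then show ?thesis unfolding UNIV_4 by (simp add: diag4_def vector_4)
  qed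
  ultimately have "det Q = - det P" by (simp add: det_mul)
  then have "rotation_matrix P \<or> rotation_matrix Q"
    using det_orthogonal_matrix[OF orth(1)] orth unfolding rotation_matrix_def by force
  moreover have "diag4 a (- a) b (- b) \<in> D4_tilde"
    using ab diag4_in_S4_iff[of a b] unfolding D4_tilde_def by blast
  ultimately show ?thesis using conj unfolding B4_tilde_def by blast
qed

lemma eigenframe_in_B4_tilde:
  assumes x: "eigenframe x e1 e2 e3 e4 \<mu> \<nu>" and mn: "\<mu> \<noteq> 0" "\<nu> \<noteq> 0" "\<mu>\<^sup>2 \<noteq> \<nu>\<^sup>2" "\<mu>\<^sup>2 + \<nu>\<^sup>2 = 1/2"
  shows "x \<in> B4_tilde"
proof -
  obtain f1 f2 where f: "eigenframe x f1 f2 e3 e4 \<bar>\<mu>\<bar> \<nu>"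
    using x eigenframe_swap12[OF x] by (cases "\<mu> \<ge> 0") auto
  obtain f3 f4 where g: "eigenframe x f1 f2 f3 f4 \<bar>\<mu>\<bar> \<bar>\<nu>\<bar>"
    using f eigenframe_swap34[OF f] by (cases "\<nu> \<ge> 0") auto
  have "\<bar>\<mu>\<bar> \<noteq> \<bar>\<nu>\<bar>" using mn(3) by (metis power2_abs)
  then consider "\<bar>\<mu>\<bar> > \<bar>\<nu>\<bar>" | "\<bar>\<nu>\<bar> > \<bar>\<mu>\<bar>" by linarith
  then show ?thesis
  proof cases
    case 1
    then show ?thesis using ordered_eigenframe_in_B4_tilde[OF g] mn by simp
  next
    case 2
    then show ?thesis using ordered_eigenframe_in_B4_tilde[OF eigenframe_swap_pairs[OF g]] mn by simp
  qed
qed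

text \<open>If \<open>l1 + l2 + l3 + l4 = 0\<close>, then the sum of cubes is \<open>-3 (l1 + l2) (l1 + l3) (l2 + l3)\<close>; when it
  vanishes, the eigenvalues are \<open>\<mu>, -\<mu>, \<nu>, -\<nu>\<close>.  Given \<open>\<mu>\<^sup>2 + \<nu>\<^sup>2 = 1/2\<close>, the fourth power sum
  is \<open>1/4 + (\<mu>\<^sup>2 - \<nu>\<^sup>2)\<^sup>2 = 1/2 - 4 \<mu>\<^sup>2 \<nu>\<^sup>2\<close>, so the two strict bounds say that \<open>\<mu>\<^sup>2 \<noteq> \<nu>\<^sup>2\<close>
  and that \<open>\<mu>\<close> and \<open>\<nu>\<close> are nonzero.\<close>

lemma B4_tilde_iff:
  "x \<in> B4_tilde \<longleftrightarrow> transpose x = x \<and> trace x = 0 \<and> trace (x ** x) = 1 \<and> trace (x ** x ** x) = 0 \<and>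
     1/4 < trace ((x ** x) ** (x ** x)) \<and> trace ((x ** x) ** (x ** x)) < 1/2"
proof
  assume "x \<in> B4_tilde"
  then obtain e1 e2 e3 e4 a b where x: "eigenframe x e1 e2 e3 e4 a b" and ab: "a > b" "b > 0" "a\<^sup>2 + b\<^sup>2 = 1/2"
    by (rule B4_tilde_eigenframe)
  have a2: "a\<^sup>2 = 1/2 - b\<^sup>2" using ab(3) by simp
  have lt: "b\<^sup>2 < a\<^sup>2" using ab by (intro power_strict_mono) auto
  then have pos: "0 < (a\<^sup>2 - b\<^sup>2)\<^sup>2" by simp
  have pos2: "0 < a\<^sup>2 * b\<^sup>2" using ab by simp
  have sq: "(a\<^sup>2 + b\<^sup>2)\<^sup>2 = 1/4" unfolding ab(3) by (simp add: power2_eq_square)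
  have "2 * (a^4 + b^4) = (a\<^sup>2 + b\<^sup>2)\<^sup>2 + (a\<^sup>2 - b\<^sup>2)\<^sup>2" "2 * (a^4 + b^4) = 2 * (a\<^sup>2 + b\<^sup>2)\<^sup>2 - 4 * (a\<^sup>2 * b\<^sup>2)"
    by (simp_all add: power2_eq_square power4_eq_xxxx algebra_simps)
  then have "1/4 < 2 * (a^4 + b^4)" "2 * (a^4 + b^4) < 1/2" using pos pos2 sq by linarith+
  then show "transpose x = x \<and> trace x = 0 \<and> trace (x ** x) = 1 \<and> trace (x ** x ** x) = 0 \<and>
     1/4 < trace ((x ** x) ** (x ** x)) \<and> trace ((x ** x) ** (x ** x)) < 1/2"
    unfolding trace_power_eigenframe[OF x] using symmetric_eigenframe[OF x] ab(3) by simp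
next
  assume x: "transpose x = x \<and> trace x = 0 \<and> trace (x ** x) = 1 \<and> trace (x ** x ** x) = 0 \<and>
     1/4 < trace ((x ** x) ** (x ** x)) \<and> trace ((x ** x) ** (x ** x)) < 1/2"
  then obtain e1 e2 e3 e4 l1 l2 l3 l4 where e: "orthonormal4 e1 e2 e3 e4"
    and l: "x *v e1 = l1 *\<^sub>R e1" "x *v e2 = l2 *\<^sub>R e2" "x *v e3 = l3 *\<^sub>R e3" "x *v e4 = l4 *\<^sub>R e4"
    using symmetric_matrix_diagonalisable[of x] by metis
  have n: "e1 \<bullet> e1 = 1" "e2 \<bullet> e2 = 1" "e3 \<bullet> e3 = 1" "e4 \<bullet> e4 = 1" using e by (auto simp: orthonormal4_def)
  have p1: "l1 + l2 + l3 + l4 = 0" and p3: "l1 * (l1 * l1) + l2 * (l2 * l2) + l3 * (l3 * l3) + l4 * (l4 * l4) = 0"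
    using x unfolding trace_orthonormal4[OF e]
    by (simp_all add: matrix_vector_mul_assoc[symmetric] matrix_vector_mult_scaleR l n)
  have l4: "l4 = - (l1 + l2 + l3)" using p1 by simp
  have "3 * ((l1 + l2) * (l1 + l3) * (l2 + l3)) = 0"
    using p3 unfolding l4 by (simp add: algebra_simps)
  then consider "l2 = - l1" | "l3 = - l1" | "l3 = - l2" by (auto simp: add_eq_0_iff)
  then obtain f1 f2 f3 f4 \<mu> \<nu> where f: "eigenframe x f1 f2 f3 f4 \<mu> \<nu>"
  proof cases
    case 1
    then have "eigenframe x e1 e2 e3 e4 l1 l3" using l4 e l by (simp add: eigenframe_def)
    then show ?thesis using that by blast
  next
    case 2
    then have "eigenframe x e1 e3 e2 e4 l1 l2" using l4 e l by (simp add: eigenframe_def orthonormal4_def inner_commute)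
    then show ?thesis using that by blast
  next
    case 3
    then have "eigenframe x e2 e3 e1 e4 l2 l1" using l4 e l by (simp add: eigenframe_def orthonormal4_def inner_commute)
    then show ?thesis using that by blast
  qed
  have s: "\<mu>\<^sup>2 + \<nu>\<^sup>2 = 1/2" and q: "1/4 < 2 * (\<mu>^4 + \<nu>^4)" "2 * (\<mu>^4 + \<nu>^4) < 1/2"
    using x unfolding trace_power_eigenframe[OF f] by auto
  have sq: "(\<mu>\<^sup>2 + \<nu>\<^sup>2)\<^sup>2 = 1/4" unfolding s by (simp add: power2_eq_square)
  have "2 * (\<mu>^4 + \<nu>^4) = (\<mu>\<^sup>2 + \<nu>\<^sup>2)\<^sup>2 + (\<mu>\<^sup>2 - \<nu>\<^sup>2)\<^sup>2" "2 * (\<mu>^4 + \<nu>^4) = 2 * (\<mu>\<^sup>2 + \<nu>\<^sup>2)\<^sup>2 - 4 * (\<mu>\<^sup>2 * \<nu>\<^sup>2)"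
    by (simp_all add: power2_eq_square power4_eq_xxxx algebra_simps)
  then have "(\<mu>\<^sup>2 - \<nu>\<^sup>2)\<^sup>2 > 0" "\<mu>\<^sup>2 * \<nu>\<^sup>2 > 0" using q sq by linarith+
  then have "\<mu>\<^sup>2 \<noteq> \<nu>\<^sup>2" "\<mu> \<noteq> 0" "\<nu> \<noteq> 0" by (force, force, force)
  then show "x \<in> B4_tilde" using eigenframe_in_B4_tilde[OF f _ _ _ s] by auto
qed

lemma B4_tilde_nonempty: "B4_tilde \<noteq> {}"
proof -
  \<comment> \<open>A Pythagorean triple makes both eigenvalues explicit.\<close>
  define a b where "a = 4/5 * sqrt (1/2)" and "b = 3/5 * sqrt (1/2)"
  have "a > b" "b > 0" by (simp_all add: a_def b_def)
  moreover have "a\<^sup>2 + b\<^sup>2 = 1/2" by (simp add: a_def b_def power_mult_distrib power2_eq_square)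
  moreover have "orthogonal_matrix (mat 1 :: real^4^4)" by (simp add: orthogonal_matrix_def)
  ultimately show ?thesis
    using eigenframe_conjugate_diag4[of "mat 1"] ordered_eigenframe_in_B4_tilde by blast
qed

section \<open>The hypersurface as an embedded submanifold\<close>

lemma dim_coordinate_subspace:
  fixes J :: "('m::finite \<times> 'n::finite) set"
  shows "dim {y :: real^'n^'m. \<forall>i j. (i, j) \<notin> J \<longrightarrow> y$i$j = 0} = card J"
proof -
  let ?b = "\<lambda>(i, j). axis i (axis j 1) :: real^'n^'m"
  have inj: "inj_on ?b J" by (auto simp: inj_on_def axis_eq_axis)
  have mem: "axis i (axis j 1) \<in> ?b ` J \<longleftrightarrow> (i, j) \<in> J" for i j
    by (force simp: axis_eq_axis)
  have sub: "?b ` J \<subseteq> Basis" by (auto simp: Basis_vec_def)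
  have "{y :: real^'n^'m. \<forall>i j. (i, j) \<notin> J \<longrightarrow> y$i$j = 0}
      = {y. \<forall>b\<in>Basis. b \<notin> ?b ` J \<longrightarrow> y \<bullet> b = 0}"
    by (auto simp: Basis_vec_def inner_axis mem simp del: image_iff)
  then show ?thesis using dim_substandard[OF sub] card_image[OF inj] by simp
qed

definition lower_entries :: "(4 \<times> 4) set" where
  "lower_entries = {(2,1), (3,1), (4,1), (3,2), (4,2), (4,3)}"

text \<open>A single linear map with kernel \<open>E4\<close>.  Its components are placed in distinct matrix entries, so that
  its range is a coordinate subspace and has an evident dimension.\<close>

definition asymmetry_and_trace :: "real^4^4 \<Rightarrow> real^4^4" where
  "asymmetry_and_trace x =
     (\<chi> i j. if (i, j) \<in> lower_entries then x$i$j - x$j$i else if i = 1 \<and> j = 1 then trace x else 0)"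

lemma linear_asymmetry_and_trace: "linear asymmetry_and_trace"
  by (rule linearI) (simp_all add: asymmetry_and_trace_def vec_eq_iff trace_add trace_scaleR algebra_simps)

lemma asymmetry_and_trace_eq_0_iff: "asymmetry_and_trace x = 0 \<longleftrightarrow> transpose x = x \<and> trace x = 0"
  by (auto simp: asymmetry_and_trace_def lower_entries_def vec_eq_iff forall_4 transpose_def)

lemma E4_eq_kernel: "E4 = {x. asymmetry_and_trace x = 0}"
  by (simp add: E4_def asymmetry_and_trace_eq_0_iff)

lemma subspace_E4: "subspace E4"
  unfolding E4_eq_kernel by (rule linear_subspace_kernel[OF linear_asymmetry_and_trace])

lemma range_asymmetry_and_trace:
  "range asymmetry_and_trace = {y. \<forall>i j. (i, j) \<notin> insert (1,1) lower_entries \<longrightarrow> y$i$j = 0}"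
proof (intro subset_antisym subsetI)
  fix y :: "real^4^4" assume y: "y \<in> {y. \<forall>i j. (i, j) \<notin> insert (1,1) lower_entries \<longrightarrow> y$i$j = 0}"
  have "y = asymmetry_and_trace y"
    using y by (simp add: asymmetry_and_trace_def vec_eq_iff trace_def sum_4 forall_4 lower_entries_def)
  then show "y \<in> range asymmetry_and_trace" by blast
qed (auto simp: asymmetry_and_trace_def)

lemma dim_E4: "dim E4 = 9"
proof -
  have "dim (range asymmetry_and_trace) = 7"
    unfolding range_asymmetry_and_trace dim_coordinate_subspace by (simp add: lower_entries_def)
  then show ?thesis
    using dim_range_plus_dim_kernel[OF linear_asymmetry_and_trace] by (simp add: E4_eq_kernel)
qed

text \<open>The equations of the hypersurface: the two nonlinear ones occupy diagonal entries
  that are zero in \<open>asymmetry_and_trace\<close>.\<close>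

definition B4_equations :: "real^4^4 \<Rightarrow> real^4^4" where
  "B4_equations x = asymmetry_and_trace x + ((trace (x ** x) *\<^sub>R axis 2 (axis 2 1)
     + trace (x ** x ** x) *\<^sub>R axis 3 (axis 3 1)) + - axis 2 (axis 2 1))"

definition B4_equations_deriv :: "real^4^4 \<Rightarrow> real^4^4 \<Rightarrow> real^4^4" where
  "B4_equations_deriv x v = asymmetry_and_trace v + ((2 * trace (x ** v)) *\<^sub>R axis 2 (axis 2 1)
     + (3 * trace (x ** x ** v)) *\<^sub>R axis 3 (axis 3 1))"

definition B4_chart :: "(real^4^4) set" where
  "B4_chart = {x. 1/4 < trace ((x ** x) ** (x ** x)) \<and> trace ((x ** x) ** (x ** x)) < 1/2}"

definition B4_equation_space :: "(real^4^4) set" where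
  "B4_equation_space = {y. \<forall>i j. (i, j) \<notin> {(1,1), (2,2), (3,3)} \<union> lower_entries \<longrightarrow> y$i$j = 0}"

lemma has_derivative_B4_equations:
  "(B4_equations has_derivative B4_equations_deriv x) (at x)"
proof -
  note M = bounded_bilinear.FDERIV[OF bounded_bilinear_matrix_mult]
  note T = bounded_linear.has_derivative[OF bounded_linear_trace]
  have d: "((\<lambda>x. trace (x ** x)) has_derivative (\<lambda>v. trace (x ** v + v ** x))) (at x)"
    by (intro T M has_derivative_ident)
  have t: "((\<lambda>x. trace (x ** x ** x)) has_derivative (\<lambda>v. trace ((x ** x) ** v + (x ** v + v ** x) ** x))) (at x)"
    by (intro T M has_derivative_ident)
  have L: "(asymmetry_and_trace has_derivative asymmetry_and_trace) (at x)"
    using linear_asymmetry_and_trace by (intro bounded_linear_imp_has_derivative) (simp add: linear_conv_bounded_linear)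
  have e: "trace (x ** v + v ** x) = 2 * trace (x ** v)" for v
    using trace_mul_sym[of v x] by (simp add: trace_add)
  have e3: "trace ((x ** x) ** v + (x ** v + v ** x) ** x) = 3 * trace (x ** x ** v)" for v
    using trace_mul_sym[of "x ** v" x] trace_mul_sym[of v "x ** x"]
    by (simp add: trace_add matrix_mult_add_left matrix_mul_assoc)
  show ?thesis
    unfolding B4_equations_def[abs_def] B4_equations_deriv_def[abs_def]
    using has_derivative_add[OF L has_derivative_add[OF has_derivative_add[OF
        has_derivative_scaleR_left[OF d, of "axis 2 (axis 2 1)"] has_derivative_scaleR_left[OF t, of "axis 3 (axis 3 1)"]]
        has_derivative_const[of "- axis 2 (axis 2 1)"]]]
    by (simp add: e e3)
qed

lemma frechet_derivative_B4_equations: "frechet_derivative B4_equations (at x) = B4_equations_deriv x"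
  using has_derivative_B4_equations frechet_derivative_at by metis

lemma open_B4_chart: "open B4_chart"
proof -
  have c: "continuous_on UNIV (\<lambda>x::real^4^4. trace ((x ** x) ** (x ** x)))"
    by (intro bounded_linear.continuous_on[OF bounded_linear_trace]
        bounded_bilinear.continuous_on[OF bounded_bilinear_matrix_mult] continuous_on_id)
  have eq: "B4_chart = (\<lambda>x. trace ((x ** x) ** (x ** x))) -` {1/4<..<1/2}"
    by (auto simp: B4_chart_def)
  show ?thesis unfolding eq by (rule open_vimage[OF open_greaterThanLessThan c])
qed

lemma smooth_on_B4_equations: "smooth_on B4_chart B4_equations"
  unfolding B4_equations_def[abs_def]
  using linear_asymmetry_and_trace
  by (intro smooth_on_add smooth_on_bilinear[OF bounded_bilinear_scaleR] smooth_on_trace smooth_on_matrix_mult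
      smooth_on_ident smooth_on_const open_B4_chart smooth_on_bounded_linear)
     (simp add: linear_conv_bounded_linear)

lemma B4_equations_deriv_entry:
  "B4_equations_deriv x v $ i $ j = (if (i, j) \<in> lower_entries then v$i$j - v$j$i
     else if i = 1 \<and> j = 1 then trace v else if i = 2 \<and> j = 2 then 2 * trace (x ** v)
     else if i = 3 \<and> j = 3 then 3 * trace (x ** x ** v) else 0)"
proof -
  have "\<forall>i j. B4_equations_deriv x v $ i $ j = (if (i, j) \<in> lower_entries then v$i$j - v$j$i
     else if i = 1 \<and> j = 1 then trace v else if i = 2 \<and> j = 2 then 2 * trace (x ** v)
     else if i = 3 \<and> j = 3 then 3 * trace (x ** x ** v) else 0)"
    by (simp add: forall_4 B4_equations_deriv_def asymmetry_and_trace_def lower_entries_def axis_def)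
  then show ?thesis by blast
qed

lemma B4_equations_entry:
  "B4_equations x $ i $ j = (if (i, j) \<in> lower_entries then x$i$j - x$j$i
     else if i = 1 \<and> j = 1 then trace x else if i = 2 \<and> j = 2 then trace (x ** x) - 1
     else if i = 3 \<and> j = 3 then trace (x ** x ** x) else 0)"
proof -
  have "\<forall>i j. B4_equations x $ i $ j = (if (i, j) \<in> lower_entries then x$i$j - x$j$i
     else if i = 1 \<and> j = 1 then trace x else if i = 2 \<and> j = 2 then trace (x ** x) - 1
     else if i = 3 \<and> j = 3 then trace (x ** x ** x) else 0)"
    by (simp add: forall_4 B4_equations_def asymmetry_and_trace_def lower_entries_def axis_def)
  then show ?thesis by blast
qed

lemma B4_equations_eq_0_iff:
  "B4_equations x = 0 \<longleftrightarrow> transpose x = x \<and> trace x = 0 \<and> trace (x ** x) = 1 \<and> trace (x ** x ** x) = 0"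
  by (auto simp: B4_equations_entry lower_entries_def vec_eq_iff forall_4 transpose_def)

lemma B4_equations_deriv_eq_0_iff:
  "B4_equations_deriv x v = 0 \<longleftrightarrow>
     transpose v = v \<and> trace v = 0 \<and> trace (x ** v) = 0 \<and> trace (x ** x ** v) = 0"
  by (auto simp: B4_equations_deriv_entry lower_entries_def vec_eq_iff forall_4 transpose_def)

text \<open>The strictly lower triangular part \<open>v0\<close> of a preimage is prescribed by \<open>y\<close>.  The three remaining equations
  are solved by a combination \<open>s\<close> of the matrices \<open>1, x, N\<close>, which are pairwise orthogonal and nonzero.\<close>

lemma range_B4_equations_deriv:
  assumes "x \<in> B4_tilde" shows "range (B4_equations_deriv x) = B4_equation_space"
proof (intro subset_antisym subsetI)
  fix y assume y: "y \<in> B4_equation_space"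
  have x: "transpose x = x" "trace x = 0" "trace (x ** x) = 1" "trace (x ** x ** x) = 0"
    and q: "1/4 < trace ((x ** x) ** (x ** x))"
    using assms unfolding B4_tilde_iff by auto
  define N where "N = x ** x - (1/4) *\<^sub>R mat 1"
  have tN: "trace N = 0" "trace (x ** N) = 0" "trace (x ** x ** N) = trace ((x ** x) ** (x ** x)) - 1/4"
    by (simp_all add: N_def trace_sub trace_scaleR trace_I x matrix_mult_diff_right matrix_mult_scaleR_right matrix_mul_assoc)
  define v0 where "v0 = (\<chi> i j. if (i, j) \<in> lower_entries then y$i$j else 0)"
  have tv0: "trace v0 = 0" by (simp add: v0_def trace_def sum_4 lower_entries_def)
  \<comment> \<open>What \<open>s\<close> has to contribute to the traces against \<open>x\<close> and \<open>x ** x\<close>.\<close>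
  define r2 where "r2 = y$2$2 / 2 - trace (x ** v0)"
  define r3 where "r3 = y$3$3 / 3 - trace (x ** x ** v0)"
  define s where "s = (y$1$1 / 4) *\<^sub>R mat 1 + r2 *\<^sub>R x +
    ((r3 - y$1$1 / 4) / (trace ((x ** x) ** (x ** x)) - 1/4)) *\<^sub>R N"
  have "transpose N = N"
    by (simp add: N_def transpose_diff transpose_scalar matrix_transpose_mul x)
  then have "transpose s = s"
    by (simp add: s_def transpose_add transpose_scalar x)
  then have sym: "s$i$j = s$j$i" for i j
  proof -
    have "transpose s $ j $ i = s$i$j" by (simp add: transpose_def)
    then show ?thesis using \<open>transpose s = s\<close> by simp
  qed
  have ts: "trace s = y$1$1" "trace (x ** s) = r2" "trace (x ** x ** s) = r3"
    using q by (simp_all add: s_def trace_add trace_scaleR trace_I x tN matrix_mult_add_right matrix_mult_scaleR_right)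
  have "y$i$j = B4_equations_deriv x (v0 + s) $ i $ j" for i j
  proof (cases "(i, j) \<in> lower_entries")
    case True
    moreover have "\<forall>i j. (i, j) \<in> lower_entries \<longrightarrow> (j, i) \<notin> lower_entries"
      by (simp add: lower_entries_def forall_4)
    ultimately have "(j, i) \<notin> lower_entries" by blast
    then show ?thesis using True sym[of i j] by (simp add: B4_equations_deriv_entry v0_def)
  next
    case False
    then show ?thesis using y
      by (auto simp: B4_equations_deriv_entry B4_equation_space_def trace_add tv0 ts matrix_mult_add_right r2_def r3_def)
  qed
  then have "y = B4_equations_deriv x (v0 + s)" by (simp add: vec_eq_iff)
  then show "y \<in> range (B4_equations_deriv x)" by blast
qed (auto simp: B4_equation_space_def B4_equations_deriv_entry)

lemma defining_map_B4: "defining_map 7 B4_tilde B4_chart B4_equation_space B4_equations"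
  unfolding defining_map_def
proof (intro conjI ballI)
  show "subspace B4_equation_space"
    by (auto simp: B4_equation_space_def subspace_def)
  have "card ({(1,1), (2,2), (3,3)} \<union> lower_entries) = 9"
    by (simp add: lower_entries_def)
  then show "dim B4_equation_space + 7 = DIM(real^4^4)"
    unfolding B4_equation_space_def dim_coordinate_subspace by simp
  show "smooth_on B4_chart B4_equations" by (rule smooth_on_B4_equations)
  show "B4_equations ` B4_chart \<subseteq> B4_equation_space"
    by (auto simp: B4_equation_space_def B4_equations_entry)
  show "B4_tilde \<inter> B4_chart = {x \<in> B4_chart. B4_equations x = 0}"
    unfolding B4_equations_eq_0_iff by (auto simp: B4_tilde_iff B4_chart_def)
  show "range (frechet_derivative B4_equations (at x)) = B4_equation_space" if "x \<in> B4_tilde \<inter> B4_chart" for x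
    using that range_B4_equations_deriv by (simp add: frechet_derivative_B4_equations)
qed

lemma B4_tilde_subset_chart: "B4_tilde \<subseteq> B4_chart"
  by (auto simp: B4_tilde_iff B4_chart_def)

lemma tangent_space_B4:
  assumes "x \<in> B4_tilde"
  shows "tangent_space B4_tilde x =
    {v. transpose v = v \<and> trace v = 0 \<and> trace (x ** v) = 0 \<and> trace (x ** x ** v) = 0}"
  using tangent_space_eq_kernel[OF defining_map_B4] B4_tilde_subset_chart assms
  by (auto simp: frechet_derivative_B4_equations B4_equations_deriv_eq_0_iff)

lemma sphere_hypersurface_B4: "sphere_hypersurface E4 B4_tilde"
  unfolding sphere_hypersurface_def
proof (intro conjI exI[of _ 7])
  show "B4_tilde \<subseteq> unit_sphere E4"
    by (auto simp: B4_tilde_iff unit_sphere_def E4_def norm_eq_1 inner_eq_trace_symmetric)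
  show "embedded_submanifold 7 B4_tilde"
    unfolding embedded_submanifold_iff_defining_map using defining_map_B4 B4_tilde_subset_chart by blast
qed (simp_all add: subspace_E4 dim_E4)

section \<open>The unit normal\<close>

text \<open>The gradient of the cubic trace \<open>trace (x ** x ** x)\<close>, up to the factor \<open>3\<close>, projected to
  the traceless matrices; on the unit sphere the trace of \<open>x ** x\<close> is \<open>1\<close>.\<close>

definition B4_gradient :: "real^4^4 \<Rightarrow> real^4^4" where
  "B4_gradient x = x ** x - (1/4) *\<^sub>R mat 1"

lemma B4_gradient_normal:
  assumes "x \<in> B4_tilde"
  shows "B4_gradient x \<in> E4" "B4_gradient x \<bullet> x = 0"
    "B4_gradient x \<bullet> B4_gradient x = trace ((x ** x) ** (x ** x)) - 1/4"
    "\<And>v. v \<in> tangent_space B4_tilde x \<Longrightarrow> B4_gradient x \<bullet> v = 0"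
proof -
  have x: "transpose x = x" "trace x = 0" "trace (x ** x) = 1" "trace (x ** x ** x) = 0"
    using assms unfolding B4_tilde_iff by auto
  have sym: "transpose (B4_gradient x) = B4_gradient x"
    by (simp add: B4_gradient_def transpose_diff transpose_scalar matrix_transpose_mul x)
  show "B4_gradient x \<in> E4" using sym
    by (simp add: E4_def B4_gradient_def trace_sub trace_scaleR trace_I x)
  show "B4_gradient x \<bullet> x = 0"
    by (simp add: inner_eq_trace_symmetric x B4_gradient_def matrix_mult_diff_left matrix_mult_scaleR_left trace_sub trace_scaleR)
  have "B4_gradient x \<bullet> B4_gradient x = trace (B4_gradient x ** B4_gradient x)"
    using sym by (rule inner_eq_trace_symmetric)
  also have "\<dots> = trace ((x ** x) ** (x ** x)) - 1/4"
    by (simp add: B4_gradient_def matrix_mult_diff_left matrix_mult_diff_right matrix_mult_scaleR_left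
        matrix_mult_scaleR_right trace_sub trace_scaleR trace_I x)
  finally show "B4_gradient x \<bullet> B4_gradient x = trace ((x ** x) ** (x ** x)) - 1/4" .
  show "B4_gradient x \<bullet> v = 0" if "v \<in> tangent_space B4_tilde x" for v
    using that by (simp add: tangent_space_B4[OF assms] inner_eq_trace_symmetric B4_gradient_def
        matrix_mult_diff_left matrix_mult_scaleR_left trace_sub trace_scaleR)
qed

lemma unit_normal_field_B4:
  "unit_normal_field E4 B4_tilde
     (\<lambda>x. (trace ((x ** x) ** (x ** x)) - 1/4) powr (- 1/2) *\<^sub>R B4_gradient x)"
  (is "unit_normal_field _ _ ?\<xi>")
  unfolding unit_normal_field_def
proof (intro conjI ballI)
  have q: "smooth_on B4_chart (\<lambda>x::real^4^4. trace ((x ** x) ** (x ** x)) + - 1/4)"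
    by (intro smooth_on_add smooth_on_trace smooth_on_matrix_mult smooth_on_ident smooth_on_const open_B4_chart)
  have p: "smooth_on {0<..} (\<lambda>r::real. r powr (- 1/2))"
    by (intro smooth_onI Ck_on_powr) auto
  have "(\<lambda>x. trace ((x ** x) ** (x ** x)) + - 1/4) ` B4_chart \<subseteq> {0<..}"
    by (auto simp: B4_chart_def)
  from smooth_on_compose[OF p q this]
  have c: "smooth_on B4_chart (\<lambda>x. (trace ((x ** x) ** (x ** x)) - 1/4) powr (- 1/2))" by simp
  have "smooth_on B4_chart (\<lambda>x. x ** x + - ((1/4) *\<^sub>R mat 1 :: real^4^4))"
    by (intro smooth_on_add smooth_on_matrix_mult smooth_on_ident smooth_on_const open_B4_chart)
  then have "smooth_on B4_chart B4_gradient" by (simp add: B4_gradient_def[abs_def])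
  from smooth_on_bilinear[OF bounded_bilinear_scaleR c this]
  show "smooth_along B4_tilde ?\<xi>"
    unfolding smooth_along_def using B4_tilde_subset_chart by blast
next
  fix x assume x: "x \<in> B4_tilde"
  note g = B4_gradient_normal[OF x]
  show "?\<xi> x \<in> E4" using g(1) subspace_E4 by (simp add: subspace_scale)
  show "?\<xi> x \<bullet> x = 0" using g(2) by simp
  show "?\<xi> x \<bullet> v = 0" if "v \<in> tangent_space B4_tilde x" for v using g(4)[OF that] by simp
  define r where "r = trace ((x ** x) ** (x ** x)) - 1/4"
  have r: "r > 0" using x by (simp add: B4_tilde_iff r_def)
  have "?\<xi> x \<bullet> ?\<xi> x = (r powr (- 1/2) * r powr (- 1/2)) * r"
    using g(3) by (simp add: r_def)
  also have "r powr (- 1/2) * r powr (- 1/2) = r powr (- 1/2 + - 1/2)" by (rule powr_add[symmetric])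
  also have "r powr (- 1/2 + - 1/2) * r = 1" using r by (simp add: powr_minus)
  finally show "norm (?\<xi> x) = 1" unfolding norm_eq_1 .
qed

text \<open>Only the planes of the pairs \<open>e1, e2\<close> and \<open>e3, e4\<close> are distinguished by the normal \<open>n\<close>; which of the two
  carries the eigenvalues of larger modulus depends on the orientation.\<close>

definition normal_frame ::
  "real^4^4 \<Rightarrow> real^4^4 \<Rightarrow> real^4 \<Rightarrow> real^4 \<Rightarrow> real^4 \<Rightarrow> real^4 \<Rightarrow> real \<Rightarrow> real \<Rightarrow> bool" where
  "normal_frame x n e1 e2 e3 e4 \<mu> \<nu> \<longleftrightarrow> eigenframe x e1 e2 e3 e4 \<mu> \<nu> \<and>
     n *v e1 = (1/2) *\<^sub>R e1 \<and> n *v e2 = (1/2) *\<^sub>R e2 \<and> n *v e3 = - (1/2) *\<^sub>R e3 \<and> n *v e4 = - (1/2) *\<^sub>R e4"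

lemma normal_frameD:
  assumes "normal_frame x n e1 e2 e3 e4 \<mu> \<nu>"
  shows "orthonormal4 e1 e2 e3 e4"
    "x *v e1 = \<mu> *\<^sub>R e1" "x *v e2 = (- \<mu>) *\<^sub>R e2" "x *v e3 = \<nu> *\<^sub>R e3" "x *v e4 = (- \<nu>) *\<^sub>R e4"
    "n *v e1 = (1/2) *\<^sub>R e1" "n *v e2 = (1/2) *\<^sub>R e2" "n *v e3 = (- 1/2) *\<^sub>R e3" "n *v e4 = (- 1/2) *\<^sub>R e4"
  using assms by (auto simp: normal_frame_def eigenframe_def)

lemma normal_frame_values:
  assumes x: "x \<in> B4_tilde" and f: "normal_frame x n e1 e2 e3 e4 \<mu> \<nu>"
  shows "\<mu> \<noteq> 0" "\<nu> \<noteq> 0" "\<mu> - \<nu> \<noteq> 0" "\<mu> + \<nu> \<noteq> 0" "\<mu>\<^sup>2 + \<nu>\<^sup>2 = 1/2"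
proof -
  have e: "eigenframe x e1 e2 e3 e4 \<mu> \<nu>" using f by (simp add: normal_frame_def)
  have s: "\<mu>\<^sup>2 + \<nu>\<^sup>2 = 1/2" and q: "1/4 < 2 * (\<mu>^4 + \<nu>^4)" "2 * (\<mu>^4 + \<nu>^4) < 1/2"
    using x unfolding B4_tilde_iff trace_power_eigenframe[OF e] by auto
  have sq: "(\<mu>\<^sup>2 + \<nu>\<^sup>2)\<^sup>2 = 1/4" unfolding s by (simp add: power2_eq_square)
  have i: "2 * (\<mu>^4 + \<nu>^4) = (\<mu>\<^sup>2 + \<nu>\<^sup>2)\<^sup>2 + ((\<mu> - \<nu>) * (\<mu> + \<nu>))\<^sup>2"
    "2 * (\<mu>^4 + \<nu>^4) = 2 * (\<mu>\<^sup>2 + \<nu>\<^sup>2)\<^sup>2 - 4 * (\<mu>\<^sup>2 * \<nu>\<^sup>2)"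
    by (simp_all add: power2_eq_square power4_eq_xxxx algebra_simps)
  have "((\<mu> - \<nu>) * (\<mu> + \<nu>))\<^sup>2 > 0" "\<mu>\<^sup>2 * \<nu>\<^sup>2 > 0" using q sq i by linarith+
  then show "\<mu> \<noteq> 0" "\<nu> \<noteq> 0" "\<mu> - \<nu> \<noteq> 0" "\<mu> + \<nu> \<noteq> 0" by force+
  show "\<mu>\<^sup>2 + \<nu>\<^sup>2 = 1/2" by (rule s)
qed

lemma normal_frame_swap12: "normal_frame x n e1 e2 e3 e4 \<mu> \<nu> \<Longrightarrow> normal_frame x n e2 e1 e3 e4 (- \<mu>) \<nu>"
  and normal_frame_swap34: "normal_frame x n e1 e2 e3 e4 \<mu> \<nu> \<Longrightarrow> normal_frame x n e1 e2 e4 e3 \<mu> (- \<nu>)"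
  using eigenframe_swap12 eigenframe_swap34 by (auto simp: normal_frame_def)

lemma tangent_space_normal_frame:
  assumes x: "x \<in> B4_tilde" and f: "normal_frame x n e1 e2 e3 e4 \<mu> \<nu>"
  shows "v \<in> tangent_space B4_tilde x \<longleftrightarrow> transpose v = v \<and>
    e1 \<bullet> (v *v e1) + e2 \<bullet> (v *v e2) + e3 \<bullet> (v *v e3) + e4 \<bullet> (v *v e4) = 0 \<and>
    \<mu> * (e1 \<bullet> (v *v e1) - e2 \<bullet> (v *v e2)) + \<nu> * (e3 \<bullet> (v *v e3) - e4 \<bullet> (v *v e4)) = 0 \<and>
    \<mu>\<^sup>2 * (e1 \<bullet> (v *v e1) + e2 \<bullet> (v *v e2)) + \<nu>\<^sup>2 * (e3 \<bullet> (v *v e3) + e4 \<bullet> (v *v e4)) = 0"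
proof -
  note fr = normal_frameD[OF f]
  have sx: "transpose x = x" using x by (simp add: B4_tilde_iff)
  have flip: "p \<bullet> (x *v w) = (x *v p) \<bullet> w" for p w using symmetric_inner[OF sx] by simp
  show ?thesis
    unfolding tangent_space_B4[OF x] mem_Collect_eq trace_orthonormal4[OF fr(1)] matrix_vector_mul_assoc[symmetric] flip fr
    by (simp add: fr matrix_vector_mult_scaleR linear_neg[OF matrix_vector_mul_linear] power2_eq_square algebra_simps)
qed

text \<open>At a point of the hypersurface this is the difference \<open>\<mu>\<^sup>2 - \<nu>\<^sup>2\<close>.  Together with
  \<open>\<mu>\<^sup>2 + \<nu>\<^sup>2 = 1/2\<close> it determines \<open>\<mu>\<close> and \<open>\<nu>\<close> up to signs.\<close>

definition block_gap :: "(real^4^4 \<Rightarrow> real^4^4) \<Rightarrow> real^4^4 \<Rightarrow> real" where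
  "block_gap \<xi> x = trace ((x ** x) ** \<xi> x)"

text \<open>The curvature \<open>-1 / (\<mu> - \<nu>)\<close> for the signs \<open>\<sigma>\<close> of \<open>\<mu>\<close> and \<open>\<tau>\<close> of \<open>\<nu>\<close>, as a function of
  \<open>m = \<mu>\<^sup>2 - \<nu>\<^sup>2\<close>.\<close>

definition curvature_branch :: "real \<Rightarrow> real \<Rightarrow> real \<Rightarrow> real" where
  "curvature_branch \<sigma> \<tau> m = - 1 / (\<sigma> * sqrt (1/4 + m/2) - \<tau> * sqrt (1/4 - m/2))"

lemma signed_root_squares:
  assumes "\<bar>m\<bar> < 1/2" "\<sigma> \<in> {1, - 1}" "\<tau> \<in> {1, - 1 :: real}"
  shows "(\<sigma> * sqrt (1/4 + m/2))\<^sup>2 = 1/4 + m/2" "(\<tau> * sqrt (1/4 - m/2))\<^sup>2 = 1/4 - m/2"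
  using assms by (auto simp: power_mult_distrib)

text \<open>In a normal frame this is \<open>2 \<mu>\<close> times the projection onto \<open>e1\<close>, because \<open>x + \<mu>\<close> annihilates
  \<open>e2\<close> and \<open>1/2 + n\<close> annihilates \<open>e3\<close> and \<open>e4\<close>.\<close>

definition left_factor :: "real^4^4 \<Rightarrow> real^4^4 \<Rightarrow> real \<Rightarrow> real^4^4" where
  "left_factor x n \<mu> = ((1/2) *\<^sub>R mat 1 + n) ** (x + \<mu> *\<^sub>R mat 1)"

text \<open>In a normal frame, \<open>2 \<nu>\<close> times the projection onto \<open>e3\<close>.\<close>

definition right_factor :: "real^4^4 \<Rightarrow> real^4^4 \<Rightarrow> real \<Rightarrow> real^4^4" where
  "right_factor x n \<nu> = ((1/2) *\<^sub>R mat 1 - n) ** (x + \<nu> *\<^sub>R mat 1)"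

context
  fixes \<xi> :: "real^4^4 \<Rightarrow> real^4^4"
  assumes nf: "unit_normal_field E4 B4_tilde \<xi>"
begin

text \<open>The component \<open>r\<close> of the normal orthogonal to the gradient satisfies all tangency conditions, so the
  normal is orthogonal to it.\<close>

lemma unit_normal_parallel_gradient:
  assumes x: "x \<in> B4_tilde"
  obtains c where "\<xi> x = c *\<^sub>R B4_gradient x"
proof -
  have \<xi>: "\<xi> x \<in> E4" "\<xi> x \<bullet> x = 0" "\<And>v. v \<in> tangent_space B4_tilde x \<Longrightarrow> \<xi> x \<bullet> v = 0"
    using nf x unfolding unit_normal_field_def by auto
  have xs: "transpose x = x" and q: "1/4 < trace ((x ** x) ** (x ** x))" using x by (auto simp: B4_tilde_iff)
  let ?N = "B4_gradient x"
  note N = B4_gradient_normal[OF x]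
  have NN: "?N \<bullet> ?N > 0" using N(3) q by simp
  define c where "c = (\<xi> x \<bullet> ?N) / (?N \<bullet> ?N)"
  define r where "r = \<xi> x - c *\<^sub>R ?N"
  have rE: "r \<in> E4" unfolding r_def using \<xi>(1) N(1) subspace_E4 by (intro subspace_diff subspace_scale)
  then have r: "transpose r = r" "trace r = 0" by (auto simp: E4_def)
  have "trace (x ** r) = x \<bullet> r" using r by (simp add: inner_eq_trace_symmetric)
  also have "\<dots> = 0" using \<xi>(2) N(2) by (simp add: r_def inner_diff_right inner_commute)
  finally have xr: "trace (x ** r) = 0" .
  have Nr: "?N \<bullet> r = 0" using NN by (simp add: r_def inner_diff_right c_def inner_commute)
  have "?N \<bullet> r = trace (x ** x ** r) - (1/4) * trace r"
    using r by (simp add: inner_eq_trace_symmetric B4_gradient_def matrix_mult_diff_left matrix_mult_scaleR_left trace_sub trace_scaleR)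
  then have "r \<in> tangent_space B4_tilde x" using r xr Nr by (simp add: tangent_space_B4[OF x])
  then have "\<xi> x \<bullet> r = 0" using \<xi>(3) by blast
  then have "r \<bullet> r = 0" using Nr by (subst (1) r_def) (simp add: inner_diff_left)
  then show thesis using that[of c] by (simp add: r_def)
qed

lemma normal_frame_exists_unsigned:
  assumes x: "x \<in> B4_tilde"
  obtains e1 e2 e3 e4 \<mu> \<nu> where "normal_frame x (\<xi> x) e1 e2 e3 e4 \<mu> \<nu>"
    "\<mu>\<^sup>2 = 1/4 + block_gap \<xi> x / 2" "\<nu>\<^sup>2 = 1/4 - block_gap \<xi> x / 2"
proof -
  obtain e1 e2 e3 e4 a b where e: "eigenframe x e1 e2 e3 e4 a b" and ab: "a > b" "b > 0" "a\<^sup>2 + b\<^sup>2 = 1/2"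
    using x by (rule B4_tilde_eigenframe)
  obtain c where c: "\<xi> x = c *\<^sub>R B4_gradient x" using unit_normal_parallel_gradient[OF x] .
  have o: "orthonormal4 e1 e2 e3 e4" using e by (simp add: eigenframe_def)
  define d where "d = c * (a\<^sup>2 - 1/4)"
  have b2: "b\<^sup>2 - 1/4 = - (a\<^sup>2 - 1/4)" using ab(3) by simp
  have xe: "x *v e1 = a *\<^sub>R e1" "x *v e2 = - a *\<^sub>R e2" "x *v e3 = b *\<^sub>R e3" "x *v e4 = - b *\<^sub>R e4"
    using e by (auto simp: eigenframe_def)
  have eig: "\<xi> x *v p = (c * (l\<^sup>2 - 1/4)) *\<^sub>R p" if "x *v p = l *\<^sub>R p" for p l
    using that unfolding c B4_gradient_def
    by (simp add: scaleR_matrix_vector_assoc[symmetric] matrix_vector_mult_diff_rdistrib matrix_vector_mul_assoc[symmetric]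
        matrix_vector_mult_scaleR power2_eq_square algebra_simps)
  have cb: "c * (b\<^sup>2 - 1/4) = - d" unfolding b2 by (simp add: d_def algebra_simps)
  have n: "\<xi> x *v e1 = d *\<^sub>R e1" "\<xi> x *v e2 = d *\<^sub>R e2" "\<xi> x *v e3 = - d *\<^sub>R e3" "\<xi> x *v e4 = - d *\<^sub>R e4"
    using eig[OF xe(1)] eig[OF xe(2)] eig[OF xe(3)] eig[OF xe(4)] cb by (simp_all add: d_def[symmetric])
  have ee: "e1 \<bullet> e1 = 1" "e2 \<bullet> e2 = 1" "e3 \<bullet> e3 = 1" "e4 \<bullet> e4 = 1" using o by (auto simp: orthonormal4_def)
  have "\<xi> x \<in> E4" "norm (\<xi> x) = 1" using nf x by (auto simp: unit_normal_field_def)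
  then have "trace (\<xi> x ** \<xi> x) = 1" by (simp add: E4_def norm_eq_1 inner_eq_trace_symmetric)
  then have "4 * (d * d) = 1"
    unfolding trace_orthonormal4[OF o]
    by (simp add: matrix_vector_mul_assoc[symmetric] matrix_vector_mult_scaleR n ee linear_neg[OF matrix_vector_mul_linear])
  then have "(d - 1/2) * (d + 1/2) = 0" by (simp add: algebra_simps)
  then have d: "d = 1/2 \<or> d = - 1/2" by auto
  have "block_gap \<xi> x = 2 * d * (a\<^sup>2 - b\<^sup>2)"
    unfolding block_gap_def trace_orthonormal4[OF o]
    by (simp add: matrix_vector_mul_assoc[symmetric] matrix_vector_mult_scaleR n xe ee linear_neg[OF matrix_vector_mul_linear]
        power2_eq_square algebra_simps)
  then have g: "block_gap \<xi> x = 4 * d * (a\<^sup>2 - 1/4)" using b2 by algebra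
  \<comment> \<open>The sign of \<open>d\<close> is the orientation of the normal; it decides which pair of eigenvectors comes first.\<close>
  show thesis
  proof (cases "d = 1/2")
    case True
    have "block_gap \<xi> x = 2 * (a\<^sup>2 - 1/4)" unfolding g True by simp
    then show thesis
      using e n b2 by (intro that[of e1 e2 e3 e4 a b]) (simp_all add: normal_frame_def True diff_divide_distrib)
  next
    case False
    then have d': "d = - 1/2" using d by simp
    have "block_gap \<xi> x = - 2 * (a\<^sup>2 - 1/4)" unfolding g d' by simp
    then show thesis
      using eigenframe_swap_pairs[OF e] n b2
      by (intro that[of e3 e4 e1 e2 b a]) (simp_all add: normal_frame_def d' diff_divide_distrib)
  qed
qed

lemma block_gap_bound:
  assumes x: "x \<in> B4_tilde"
  shows "\<bar>block_gap \<xi> x\<bar> < 1/2"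
proof -
  obtain e1 e2 e3 e4 \<mu> \<nu> where f: "normal_frame x (\<xi> x) e1 e2 e3 e4 \<mu> \<nu>"
    "\<mu>\<^sup>2 = 1/4 + block_gap \<xi> x / 2" "\<nu>\<^sup>2 = 1/4 - block_gap \<xi> x / 2"
    using x by (rule normal_frame_exists_unsigned)
  have "\<mu>\<^sup>2 > 0" "\<nu>\<^sup>2 > 0" using normal_frame_values[OF x f(1)] by auto
  then show ?thesis using f by simp
qed

text \<open>The signs of \<open>\<mu>\<close> and \<open>\<nu>\<close> are free, so every simple curvature can be brought to the
  form \<open>-1 / (\<mu> - \<nu>)\<close>, with principal direction between \<open>e1\<close> and \<open>e3\<close>.\<close>

lemma normal_frame_exists:
  assumes x: "x \<in> B4_tilde"
    and \<mu>: "\<mu>\<^sup>2 = 1/4 + block_gap \<xi> x / 2" and \<nu>: "\<nu>\<^sup>2 = 1/4 - block_gap \<xi> x / 2"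
  obtains e1 e2 e3 e4 where "normal_frame x (\<xi> x) e1 e2 e3 e4 \<mu> \<nu>"
proof -
  obtain e1 e2 e3 e4 \<mu>' \<nu>' where f: "normal_frame x (\<xi> x) e1 e2 e3 e4 \<mu>' \<nu>'"
    "\<mu>'\<^sup>2 = 1/4 + block_gap \<xi> x / 2" "\<nu>'\<^sup>2 = 1/4 - block_gap \<xi> x / 2"
    using x by (rule normal_frame_exists_unsigned)
  then have "\<mu> = \<mu>' \<or> \<mu> = - \<mu>'" "\<nu> = \<nu>' \<or> \<nu> = - \<nu>'" using \<mu> \<nu> by (metis power2_eq_iff)+
  then show thesis
    using that f(1) normal_frame_swap12[OF f(1)] normal_frame_swap34[OF f(1)]
      normal_frame_swap34[OF normal_frame_swap12[OF f(1)]] by blast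
qed

lemma normal_frame_signed:
  assumes x: "x \<in> B4_tilde"
    and st: "\<sigma> \<in> {1, - 1}" "\<tau> \<in> {1, - 1}"
  obtains e1 e2 e3 e4 where "normal_frame x (\<xi> x) e1 e2 e3 e4
    (\<sigma> * sqrt (1/4 + block_gap \<xi> x / 2)) (\<tau> * sqrt (1/4 - block_gap \<xi> x / 2))"
  using normal_frame_exists[OF x signed_root_squares[OF block_gap_bound[OF x] st]] by blast

lemma normal_identities:
  assumes x: "x \<in> B4_tilde"
  shows "transpose (\<xi> x) = \<xi> x" "trace (\<xi> x) = 0" "\<xi> x ** \<xi> x = (1/4) *\<^sub>R mat 1" "x ** \<xi> x = \<xi> x ** x"
    "x ** x = (1/4) *\<^sub>R mat 1 + block_gap \<xi> x *\<^sub>R \<xi> x"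
proof -
  obtain e1 e2 e3 e4 \<mu> \<nu> where f: "normal_frame x (\<xi> x) e1 e2 e3 e4 \<mu> \<nu>"
    and mn: "\<mu>\<^sup>2 = 1/4 + block_gap \<xi> x / 2" "\<nu>\<^sup>2 = 1/4 - block_gap \<xi> x / 2"
    using x by (rule normal_frame_exists_unsigned)
  have o: "orthonormal4 e1 e2 e3 e4" using f by (simp add: normal_frame_def eigenframe_def)
  have xe: "x *v e1 = \<mu> *\<^sub>R e1" "x *v e2 = - \<mu> *\<^sub>R e2" "x *v e3 = \<nu> *\<^sub>R e3" "x *v e4 = - \<nu> *\<^sub>R e4"
    and ne: "\<xi> x *v e1 = (1/2) *\<^sub>R e1" "\<xi> x *v e2 = (1/2) *\<^sub>R e2"
     "\<xi> x *v e3 = - (1/2) *\<^sub>R e3" "\<xi> x *v e4 = - (1/2) *\<^sub>R e4"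
    using f by (auto simp: normal_frame_def eigenframe_def)
  have "\<xi> x \<in> E4" using nf x by (auto simp: unit_normal_field_def)
  then show "transpose (\<xi> x) = \<xi> x" "trace (\<xi> x) = 0" by (auto simp: E4_def)
  note s = matrix_vector_mul_assoc[symmetric] matrix_vector_mult_scaleR xe ne matrix_vector_mult_add_rdistrib
    scaleR_matrix_vector_assoc[symmetric] linear_neg[OF matrix_vector_mul_linear]
  show "\<xi> x ** \<xi> x = (1/4) *\<^sub>R mat 1" by (rule orthonormal4_matrix_eqI[OF o]) (simp_all add: s)
  show "x ** \<xi> x = \<xi> x ** x" by (rule orthonormal4_matrix_eqI[OF o]) (simp_all add: s)
  have m: "\<mu> * \<mu> = 1/4 + block_gap \<xi> x / 2" "\<nu> * \<nu> = 1/4 - block_gap \<xi> x / 2"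
    using mn by (simp_all add: power2_eq_square)
  show "x ** x = (1/4) *\<^sub>R mat 1 + block_gap \<xi> x *\<^sub>R \<xi> x"
    by (rule orthonormal4_matrix_eqI[OF o]) (simp_all add: s m scaleR_add_left[symmetric] scaleR_diff_left[symmetric])
qed

section \<open>Principal curvatures and principal spaces\<close>

lemma normal_along_curve:
  assumes \<gamma>: "e > 0" "\<gamma> ` {-e<..<e} \<subseteq> B4_tilde" "(\<gamma> has_vector_derivative v) (at 0)"
  shows "((\<lambda>t. \<xi> (\<gamma> t)) has_vector_derivative - shape_operator B4_tilde \<xi> (\<gamma> 0) v) (at 0)"
proof -
  have "\<gamma> 0 \<in> B4_tilde" using \<gamma> by auto
  then have "\<xi> differentiable (at (\<gamma> 0) within B4_tilde)"
    using nf smooth_along_differentiable by (auto simp: unit_normal_field_def)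
  then show ?thesis by (rule shape_operator_along_curve[OF _ \<gamma>(1,2) refl \<gamma>(3)])
qed

text \<open>Each identity is the derivative, along a curve with velocity \<open>v\<close>, of one of the
  \<open>normal_identities\<close>.\<close>

lemma normal_derivative_identities:
  assumes x: "x \<in> B4_tilde" and v: "v \<in> tangent_space B4_tilde x"
  defines "Z \<equiv> - shape_operator B4_tilde \<xi> x v"
  shows "transpose Z = Z" "trace Z = 0" "\<xi> x ** Z + Z ** \<xi> x = 0" "x ** Z + v ** \<xi> x = \<xi> x ** v + Z ** x"
proof -
  obtain e \<gamma> where \<gamma>: "e > 0" "\<gamma> ` {-e<..<e} \<subseteq> B4_tilde" "\<gamma> 0 = x" "(\<gamma> has_vector_derivative v) (at 0)"
    using v unfolding tangent_space_def by blast
  have d: "((\<lambda>t. \<xi> (\<gamma> t)) has_vector_derivative Z) (at 0)"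
    using normal_along_curve[OF \<gamma>(1,2,4)] by (simp add: Z_def \<gamma>(3))
  have i: "transpose (\<xi> (\<gamma> t)) = \<xi> (\<gamma> t)" "trace (\<xi> (\<gamma> t)) = 0" "\<xi> (\<gamma> t) ** \<xi> (\<gamma> t) = (1/4) *\<^sub>R mat 1"
    "\<gamma> t ** \<xi> (\<gamma> t) = \<xi> (\<gamma> t) ** \<gamma> t" if "t \<in> {-e<..<e}" for t
    using normal_identities[of "\<gamma> t"] that \<gamma>(2) by blast+
  show "transpose Z = Z"
    by (rule vector_derivative_eq_of_eq_near[OF bounded_linear.has_vector_derivative[OF bounded_linear_transpose d] d \<gamma>(1) i(1)])
  show "trace Z = 0"
    by (rule vector_derivative_eq_of_eq_near[OF bounded_linear.has_vector_derivative[OF bounded_linear_trace d]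
          has_vector_derivative_const \<gamma>(1) i(2)])
  show "\<xi> x ** Z + Z ** \<xi> x = 0"
    using vector_derivative_eq_of_eq_near[OF has_vector_derivative_matrix_mult[OF d d] has_vector_derivative_const \<gamma>(1) i(3)]
    by (simp add: \<gamma>(3))
  show "x ** Z + v ** \<xi> x = \<xi> x ** v + Z ** x"
    using vector_derivative_eq_of_eq_near[OF has_vector_derivative_matrix_mult[OF \<gamma>(4) d]
          has_vector_derivative_matrix_mult[OF d \<gamma>(4)] \<gamma>(1) i(4)]
    by (simp add: \<gamma>(3))
qed

lemma block_gap_along_curve:
  assumes \<gamma>: "e > 0" "\<gamma> ` {-e<..<e} \<subseteq> B4_tilde" "(\<gamma> has_vector_derivative v) (at 0)"
    and v: "v \<in> tangent_space B4_tilde (\<gamma> 0)"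
  shows "((\<lambda>t. block_gap \<xi> (\<gamma> t)) has_vector_derivative 2 * trace (v ** (\<gamma> 0 ** \<xi> (\<gamma> 0)))) (at 0)"
proof -
  define x where "x = \<gamma> 0"
  define Z where "Z = - shape_operator B4_tilde \<xi> x v"
  have x: "x \<in> B4_tilde" using \<gamma>(1,2) by (auto simp: x_def)
  note z = normal_derivative_identities[OF x v[folded x_def], folded Z_def]
  note n = normal_identities[OF x]
  have d: "((\<lambda>t. \<xi> (\<gamma> t)) has_vector_derivative Z) (at 0)"
    using normal_along_curve[OF \<gamma>] by (simp add: Z_def x_def)
  have der: "((\<lambda>t. block_gap \<xi> (\<gamma> t)) has_vector_derivative
      trace ((x ** x) ** Z + (x ** v + v ** x) ** \<xi> x)) (at 0)"
    unfolding block_gap_def x_def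
    by (rule bounded_linear.has_vector_derivative[OF bounded_linear_trace
          has_vector_derivative_matrix_mult[OF has_vector_derivative_matrix_mult[OF \<gamma>(3) \<gamma>(3)] d]])
  have "trace (\<xi> x ** Z) = - trace (Z ** \<xi> x)"
    using arg_cong[OF z(3), of trace] by (simp add: trace_add trace_zero)
  then have "trace (\<xi> x ** Z) = 0" using trace_mul_sym[of "\<xi> x" Z] by simp
  then have a: "trace ((x ** x) ** Z) = 0"
    unfolding n(5) by (simp add: matrix_mult_add_left matrix_mult_scaleR_left trace_add trace_scaleR z(2))
  have "trace (x ** v ** \<xi> x) = trace (\<xi> x ** (x ** v))" by (rule trace_mul_sym)
  also have "\<dots> = trace ((x ** \<xi> x) ** v)" by (simp add: matrix_mul_assoc n(4))
  also have "\<dots> = trace (v ** (x ** \<xi> x))" by (rule trace_mul_sym)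
  finally have b: "trace (x ** v ** \<xi> x) = trace (v ** (x ** \<xi> x))" .
  have "trace ((x ** x) ** Z + (x ** v + v ** x) ** \<xi> x) = 2 * trace (v ** (x ** \<xi> x))"
    using a b by (simp add: trace_add matrix_mult_add_left matrix_mul_assoc)
  then show ?thesis using der by (simp add: x_def)
qed

text \<open>For \<open>c \<noteq> 0\<close> the derivative \<open>- c v\<close> of the normal anticommutes with the normal, hence so does \<open>v\<close>,
  while \<open>x\<close> commutes with it.  Cycling the factors in \<open>trace (v x \<xi>)\<close> then shows that it equals its negative.\<close>

lemma block_gap_stationary:
  assumes \<gamma>: "e > 0" "\<gamma> ` {-e<..<e} \<subseteq> B4_tilde" "(\<gamma> has_vector_derivative v) (at 0)"
    and v: "v \<in> principal_space B4_tilde \<xi> c (\<gamma> 0)" and c: "c \<noteq> 0"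
  shows "((\<lambda>t. block_gap \<xi> (\<gamma> t)) has_vector_derivative 0) (at 0)"
proof -
  define x where "x = \<gamma> 0"
  have x: "x \<in> B4_tilde" using \<gamma>(1,2) by (auto simp: x_def)
  have vT: "v \<in> tangent_space B4_tilde x" and Z: "- shape_operator B4_tilde \<xi> x v = - c *\<^sub>R v"
    using v by (auto simp: principal_space_def x_def)
  have "- c *\<^sub>R (\<xi> x ** v + v ** \<xi> x) = 0"
    using normal_derivative_identities(3)[OF x vT] unfolding Z
    by (simp add: matrix_mult_scaleR_left matrix_mult_scaleR_right matrix_mult_minus_left matrix_mult_minus_right algebra_simps)
  then have anti: "v ** \<xi> x = - (\<xi> x ** v)" using c by (simp add: add_eq_0_iff)
  have "trace (v ** (x ** \<xi> x)) = trace (v ** \<xi> x ** x)"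
    by (simp add: normal_identities[OF x] matrix_mul_assoc)
  also have "\<dots> = - trace (\<xi> x ** (v ** x))"
    by (simp add: anti matrix_mult_minus_left matrix_mul_assoc trace_minus)
  also have "\<dots> = - trace ((v ** x) ** \<xi> x)" using trace_mul_sym[of "\<xi> x" "v ** x"] by simp
  also have "\<dots> = - trace (v ** (x ** \<xi> x))" by (simp add: matrix_mul_assoc)
  finally have "trace (v ** (x ** \<xi> x)) = 0" by simp
  then show ?thesis
    using block_gap_along_curve[OF \<gamma> vT[unfolded x_def]] by (simp add: x_def)
qed

text \<open>The anticommutation with the normal kills the entries within each plane; the linearised relation
  \<open>x \<xi> = \<xi> x\<close> gives those between the planes.\<close>

lemma normal_derivative_entries:
  assumes x: "x \<in> B4_tilde"
    and f: "normal_frame x (\<xi> x) e1 e2 e3 e4 \<mu> \<nu>" and v: "v \<in> tangent_space B4_tilde x"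
  defines "Z \<equiv> - shape_operator B4_tilde \<xi> x v"
  shows "e1 \<bullet> (Z *v e1) = 0" "e1 \<bullet> (Z *v e2) = 0" "e2 \<bullet> (Z *v e2) = 0"
    "e3 \<bullet> (Z *v e3) = 0" "e3 \<bullet> (Z *v e4) = 0" "e4 \<bullet> (Z *v e4) = 0"
    "(\<mu> - \<nu>) * (e1 \<bullet> (Z *v e3)) = e1 \<bullet> (v *v e3)" "(\<mu> + \<nu>) * (e1 \<bullet> (Z *v e4)) = e1 \<bullet> (v *v e4)"
    "(- \<mu> - \<nu>) * (e2 \<bullet> (Z *v e3)) = e2 \<bullet> (v *v e3)" "(- \<mu> + \<nu>) * (e2 \<bullet> (Z *v e4)) = e2 \<bullet> (v *v e4)"
proof -
  note fr = normal_frameD[OF f]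
  note z = normal_derivative_identities[OF x v, folded Z_def]
  have sx: "transpose x = x" using x by (simp add: B4_tilde_iff)
  note sn = normal_identities(1)[OF x]
  have same: "(s + t) * (p \<bullet> (Z *v q)) = 0" if "\<xi> x *v p = s *\<^sub>R p" "\<xi> x *v q = t *\<^sub>R q" for p q s t
  proof -
    have "0 = p \<bullet> ((\<xi> x ** Z + Z ** \<xi> x) *v q)" by (simp add: z(3))
    also have "\<dots> = (\<xi> x *v p) \<bullet> (Z *v q) + p \<bullet> (Z *v (\<xi> x *v q))"
      by (simp add: matrix_vector_mult_add_rdistrib matrix_vector_mul_assoc[symmetric] inner_add_right symmetric_inner[OF sn])
    finally show ?thesis by (simp add: that matrix_vector_mult_scaleR algebra_simps)
  qed
  have cross: "(l - m) * (p \<bullet> (Z *v q)) = (s - t) * (p \<bullet> (v *v q))"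
    if "\<xi> x *v p = s *\<^sub>R p" "\<xi> x *v q = t *\<^sub>R q" "x *v p = l *\<^sub>R p" "x *v q = m *\<^sub>R q" for p q s t l m
  proof -
    have "p \<bullet> ((x ** Z + v ** \<xi> x) *v q) = p \<bullet> ((\<xi> x ** v + Z ** x) *v q)" by (simp add: z(4))
    then have "(x *v p) \<bullet> (Z *v q) + p \<bullet> (v *v (\<xi> x *v q)) = (\<xi> x *v p) \<bullet> (v *v q) + p \<bullet> (Z *v (x *v q))"
      by (simp add: matrix_vector_mult_add_rdistrib matrix_vector_mul_assoc[symmetric] inner_add_right
          symmetric_inner[OF sn] symmetric_inner[OF sx])
    then show ?thesis by (simp add: that matrix_vector_mult_scaleR algebra_simps)
  qed
  show "e1 \<bullet> (Z *v e1) = 0" "e1 \<bullet> (Z *v e2) = 0" "e2 \<bullet> (Z *v e2) = 0"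
    "e3 \<bullet> (Z *v e3) = 0" "e3 \<bullet> (Z *v e4) = 0" "e4 \<bullet> (Z *v e4) = 0"
    using same[OF fr(6,6)] same[OF fr(6,7)] same[OF fr(7,7)] same[OF fr(8,8)] same[OF fr(8,9)] same[OF fr(9,9)]
    by simp_all
  show "(\<mu> - \<nu>) * (e1 \<bullet> (Z *v e3)) = e1 \<bullet> (v *v e3)" "(\<mu> + \<nu>) * (e1 \<bullet> (Z *v e4)) = e1 \<bullet> (v *v e4)"
    "(- \<mu> - \<nu>) * (e2 \<bullet> (Z *v e3)) = e2 \<bullet> (v *v e3)" "(- \<mu> + \<nu>) * (e2 \<bullet> (Z *v e4)) = e2 \<bullet> (v *v e4)"
    using cross[OF fr(6,8,2,4)] cross[OF fr(6,9,2,5)] cross[OF fr(7,8,3,4)] cross[OF fr(7,9,3,5)]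
    by simp_all
qed

lemma principal_space_normal_frame:
  assumes x: "x \<in> B4_tilde"
    and f: "normal_frame x (\<xi> x) e1 e2 e3 e4 \<mu> \<nu>" and v: "v \<in> tangent_space B4_tilde x"
  shows "v \<in> principal_space B4_tilde \<xi> c x \<longleftrightarrow>
    c * (e1 \<bullet> (v *v e1)) = 0 \<and> c * (e1 \<bullet> (v *v e2)) = 0 \<and> c * (e2 \<bullet> (v *v e2)) = 0 \<and>
    c * (e3 \<bullet> (v *v e3)) = 0 \<and> c * (e3 \<bullet> (v *v e4)) = 0 \<and> c * (e4 \<bullet> (v *v e4)) = 0 \<and>
    (c * (\<mu> - \<nu>) + 1) * (e1 \<bullet> (v *v e3)) = 0 \<and> (c * (\<mu> + \<nu>) + 1) * (e1 \<bullet> (v *v e4)) = 0 \<and>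
    (c * (- \<mu> - \<nu>) + 1) * (e2 \<bullet> (v *v e3)) = 0 \<and> (c * (- \<mu> + \<nu>) + 1) * (e2 \<bullet> (v *v e4)) = 0"
    (is "_ \<longleftrightarrow> ?R")
proof -
  define Z where "Z = - shape_operator B4_tilde \<xi> x v"
  note fr = normal_frameD[OF f]
  note z = normal_derivative_entries[OF x f v, folded Z_def]
  have sZ: "transpose Z = Z" using normal_derivative_identities(1)[OF x v] by (simp add: Z_def)
  have sv: "transpose v = v" using v by (simp add: tangent_space_B4[OF x])
  note nz = normal_frame_values[OF x f]
  have cv: "p \<bullet> ((- c *\<^sub>R v) *v q) = - c * (p \<bullet> (v *v q))" for p q
    by (simp only: scaleR_matrix_vector_assoc[symmetric] inner_scaleR_right)
  have "v \<in> principal_space B4_tilde \<xi> c x \<longleftrightarrow> Z = - c *\<^sub>R v"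
    using v by (auto simp: principal_space_def Z_def minus_equation_iff)
  also have "\<dots> \<longleftrightarrow> ?R"
  proof
    assume Zc: "Z = - c *\<^sub>R v"
    show ?R using z unfolding Zc cv by (simp add: algebra_simps)
  next
    assume R: ?R
    have cancel: "s = - c * r" if "a * s = r" "(c * a + 1) * r = 0" "a \<noteq> 0" for a r s :: real
    proof -
      have "a * (s + c * r) = 0" using that(1,2) by (simp add: algebra_simps)
      then show ?thesis using that(3) by simp
    qed
    have scv: "transpose (- c *\<^sub>R v) = - c *\<^sub>R v" by (simp only: transpose_scalar sv)
    show "Z = - c *\<^sub>R v"
      by (rule orthonormal4_symmetric_eqI[OF fr(1) sZ scv]; unfold cv) (use R z cancel[OF z(7)] cancel[OF z(8)] cancel[OF z(9)] cancel[OF z(10)] nz in auto)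
  qed
  finally show ?thesis .
qed

lemma sym_outer_13_principal:
  assumes x: "x \<in> B4_tilde"
    and f: "normal_frame x (\<xi> x) e1 e2 e3 e4 \<mu> \<nu>" and c: "c * (\<mu> - \<nu>) = - 1"
  shows "sym_outer e1 e3 \<in> principal_space B4_tilde \<xi> c x"
proof -
  note o = orthonormal4_inner[OF normal_frameD(1)[OF f]]
  have "sym_outer e1 e3 \<in> tangent_space B4_tilde x"
    unfolding tangent_space_normal_frame[OF x f] by (simp add: transpose_sym_outer sym_outer_mult_vector o)
  then show ?thesis
    unfolding principal_space_normal_frame[OF x f \<open>sym_outer e1 e3 \<in> tangent_space B4_tilde x\<close>]
    using c by (simp add: sym_outer_mult_vector o inner_add_right)
qed

text \<open>For \<open>c \<noteq> 0\<close> outside the list, all ten conditions of \<open>principal_space_normal_frame\<close> force the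
  entries of \<open>v\<close> to vanish.\<close>

lemma principal_curvatures_B4:
  assumes x: "x \<in> B4_tilde"
  shows "principal_curvatures B4_tilde \<xi> x =
    insert 0 {curvature_branch \<sigma> \<tau> (block_gap \<xi> x) | \<sigma> \<tau>. \<sigma> \<in> {1, - 1} \<and> \<tau> \<in> {1, - 1}}"
proof (intro subset_antisym subsetI)
  let ?\<mu> = "sqrt (1/4 + block_gap \<xi> x / 2)" and ?\<nu> = "sqrt (1/4 - block_gap \<xi> x / 2)"
  obtain e1 e2 e3 e4 where f: "normal_frame x (\<xi> x) e1 e2 e3 e4 ?\<mu> ?\<nu>"
    using normal_frame_signed[OF x, of 1 1, simplified] by metis
  note fr = normal_frameD[OF f] and nz = normal_frame_values[OF x f]
  fix c assume "c \<in> principal_curvatures B4_tilde \<xi> x"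
  then obtain v where v: "v \<in> principal_space B4_tilde \<xi> c x" "v \<noteq> 0" by (auto simp: principal_curvatures_def)
  then have vT: "v \<in> tangent_space B4_tilde x" by (simp add: principal_space_def)
  then have sv: "transpose v = v" by (simp add: tangent_space_B4[OF x])
  note R = v(1)[unfolded principal_space_normal_frame[OF x f vT]]
  show "c \<in> insert 0 {curvature_branch \<sigma> \<tau> (block_gap \<xi> x) | \<sigma> \<tau>. \<sigma> \<in> {1, - 1} \<and> \<tau> \<in> {1, - 1}}"
  proof (rule ccontr)
    assume not: "\<not> ?thesis"
    have ne: "c * (\<sigma> * ?\<mu> - \<tau> * ?\<nu>) + 1 \<noteq> 0" if "\<sigma> \<in> {1, - 1}" "\<tau> \<in> {1, - 1}" for \<sigma> \<tau>
    proof
      assume h: "c * (\<sigma> * ?\<mu> - \<tau> * ?\<nu>) + 1 = 0"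
      then have "\<sigma> * ?\<mu> - \<tau> * ?\<nu> \<noteq> 0" by auto
      then have "c = curvature_branch \<sigma> \<tau> (block_gap \<xi> x)"
        using h by (simp add: curvature_branch_def field_simps add_eq_0_iff)
      then show False using not that by blast
    qed
    have "c \<noteq> 0" using not by blast
    then have "v = 0"
      using R ne[of 1 1] ne[of 1 "- 1"] ne[of "- 1" 1] ne[of "- 1" "- 1"]
      by (intro orthonormal4_symmetric_eqI[OF fr(1) sv]) (auto simp: transpose_def vec_eq_iff)
    then show False using v(2) by blast
  qed
next
  fix c assume c: "c \<in> insert 0 {curvature_branch \<sigma> \<tau> (block_gap \<xi> x) | \<sigma> \<tau>. \<sigma> \<in> {1, - 1} \<and> \<tau> \<in> {1, - 1}}"
  show "c \<in> principal_curvatures B4_tilde \<xi> x"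
  proof (cases "c = 0")
    case True
    obtain e1 e2 e3 e4 \<mu> \<nu> where f: "normal_frame x (\<xi> x) e1 e2 e3 e4 \<mu> \<nu>"
      using x by (rule normal_frame_exists_unsigned)
    note o = orthonormal4_inner[OF normal_frameD(1)[OF f]]
    have T: "sym_outer e1 e2 \<in> tangent_space B4_tilde x"
      unfolding tangent_space_normal_frame[OF x f] by (simp add: transpose_sym_outer sym_outer_mult_vector o)
    have "sym_outer e1 e2 \<in> principal_space B4_tilde \<xi> c x"
      unfolding principal_space_normal_frame[OF x f T] True by (simp add: sym_outer_mult_vector o inner_add_right)
    then show ?thesis using sym_outer_nonzero[of e1 e2] o by (auto simp: principal_curvatures_def)
  next
    case False
    then obtain \<sigma> \<tau> where st: "\<sigma> \<in> {1, - 1}" "\<tau> \<in> {1, - 1}" "c = curvature_branch \<sigma> \<tau> (block_gap \<xi> x)" using c by blast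
    obtain e1 e2 e3 e4 where f: "normal_frame x (\<xi> x) e1 e2 e3 e4
        (\<sigma> * sqrt (1/4 + block_gap \<xi> x / 2)) (\<tau> * sqrt (1/4 - block_gap \<xi> x / 2))"
      using normal_frame_signed[OF x st(1,2)] .
    note o = orthonormal4_inner[OF normal_frameD(1)[OF f]]
    have "sym_outer e1 e3 \<in> principal_space B4_tilde \<xi> c x"
      using sym_outer_13_principal[OF x f] normal_frame_values(3)[OF x f] st(3) by (simp add: curvature_branch_def)
    then show ?thesis using sym_outer_nonzero[of e1 e3] o by (auto simp: principal_curvatures_def)
  qed
qed

lemma signed_roots_nonzero:
  assumes x: "x \<in> B4_tilde"
  shows "sqrt (1/4 + block_gap \<xi> x / 2) \<noteq> 0" "sqrt (1/4 - block_gap \<xi> x / 2) \<noteq> 0"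
    "sqrt (1/4 + block_gap \<xi> x / 2) - sqrt (1/4 - block_gap \<xi> x / 2) \<noteq> 0"
    "sqrt (1/4 + block_gap \<xi> x / 2) + sqrt (1/4 - block_gap \<xi> x / 2) \<noteq> 0"
proof -
  obtain e1 e2 e3 e4 where f: "normal_frame x (\<xi> x) e1 e2 e3 e4
      (sqrt (1/4 + block_gap \<xi> x / 2)) (sqrt (1/4 - block_gap \<xi> x / 2))"
    using normal_frame_signed[OF x, of 1 1, simplified] by metis
  show "sqrt (1/4 + block_gap \<xi> x / 2) \<noteq> 0" "sqrt (1/4 - block_gap \<xi> x / 2) \<noteq> 0"
    "sqrt (1/4 + block_gap \<xi> x / 2) - sqrt (1/4 - block_gap \<xi> x / 2) \<noteq> 0"
    "sqrt (1/4 + block_gap \<xi> x / 2) + sqrt (1/4 - block_gap \<xi> x / 2) \<noteq> 0"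
    using normal_frame_values[OF x f] by blast+
qed

lemma signed_sum_nonzero:
  assumes x: "x \<in> B4_tilde"
    and st: "\<sigma> \<in> {1, - 1}" "\<tau> \<in> {1, - 1}"
  shows "\<sigma> * sqrt (1/4 + block_gap \<xi> x / 2) - \<tau> * sqrt (1/4 - block_gap \<xi> x / 2) \<noteq> 0"
  using signed_roots_nonzero[OF x] st by auto

lemma curvature_branch_inj:
  assumes x: "x \<in> B4_tilde"
    and st: "\<sigma> \<in> {1, - 1}" "\<tau> \<in> {1, - 1}" "\<sigma>' \<in> {1, - 1}" "\<tau>' \<in> {1, - 1}"
    and eq: "curvature_branch \<sigma> \<tau> (block_gap \<xi> x) = curvature_branch \<sigma>' \<tau>' (block_gap \<xi> x)"
  shows "\<sigma> = \<sigma>' \<and> \<tau> = \<tau>'"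
proof -
  have "\<sigma> * sqrt (1/4 + block_gap \<xi> x / 2) - \<tau> * sqrt (1/4 - block_gap \<xi> x / 2) =
    \<sigma>' * sqrt (1/4 + block_gap \<xi> x / 2) - \<tau>' * sqrt (1/4 - block_gap \<xi> x / 2)"
    using eq signed_sum_nonzero[OF x st(1,2)] signed_sum_nonzero[OF x st(3,4)]
    by (simp add: curvature_branch_def)
  then show ?thesis using st signed_roots_nonzero[OF x] by auto
qed

text \<open>Since \<open>\<mu>\<^sup>2 + \<nu>\<^sup>2 = 1/2\<close>, the denominator is at most \<open>1\<close> in modulus.  The zero curvature is
  thereby isolated from all the others, uniformly over the hypersurface.\<close>

lemma abs_curvature_branch_ge_1:
  assumes x: "x \<in> B4_tilde"
    and st: "\<sigma> \<in> {1, - 1}" "\<tau> \<in> {1, - 1}"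
  shows "\<bar>curvature_branch \<sigma> \<tau> (block_gap \<xi> x)\<bar> \<ge> 1"
proof -
  define a where "a = \<sigma> * sqrt (1/4 + block_gap \<xi> x / 2)"
  define b where "b = \<tau> * sqrt (1/4 - block_gap \<xi> x / 2)"
  have ab: "a - b \<noteq> 0" using signed_sum_nonzero[OF assms] by (simp add: a_def b_def)
  have "a\<^sup>2 + b\<^sup>2 = 1/2"
    using signed_root_squares[OF block_gap_bound[OF x] st] by (simp add: a_def b_def)
  moreover have "(a - b)\<^sup>2 + (a + b)\<^sup>2 = 2 * (a\<^sup>2 + b\<^sup>2)" by (simp add: power2_eq_square algebra_simps)
  ultimately have "(a - b)\<^sup>2 + (a + b)\<^sup>2 = 1" by (simp only:)
  moreover have "(a - b)\<^sup>2 \<le> (a - b)\<^sup>2 + (a + b)\<^sup>2" by simp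
  ultimately have "(a - b)\<^sup>2 \<le> 1" by (simp only:)
  then have "\<bar>a - b\<bar> \<le> 1" by (simp add: abs_square_le_1)
  then show ?thesis using ab by (simp add: curvature_branch_def a_def[symmetric] b_def[symmetric] abs_divide)
qed

lemma card_principal_curvatures_B4:
  assumes x: "x \<in> B4_tilde"
  shows "card (principal_curvatures B4_tilde \<xi> x) = 5"
proof -
  let ?I = "{1, - 1} \<times> {1, - 1 :: real}" and ?c = "\<lambda>(\<sigma>, \<tau>). curvature_branch \<sigma> \<tau> (block_gap \<xi> x)"
  have "principal_curvatures B4_tilde \<xi> x = insert 0 (?c ` ?I)"
    unfolding principal_curvatures_B4[OF assms] by auto
  moreover have "inj_on ?c ?I"
  proof (rule inj_onI)
    fix p q assume "p \<in> ?I" "q \<in> ?I" "?c p = ?c q"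
    then have "fst p \<in> {1, - 1}" "snd p \<in> {1, - 1}" "fst q \<in> {1, - 1}" "snd q \<in> {1, - 1}"
      "curvature_branch (fst p) (snd p) (block_gap \<xi> x) = curvature_branch (fst q) (snd q) (block_gap \<xi> x)"
      by (simp_all only: mem_Times_iff split_beta)
    from curvature_branch_inj[OF assms this] show "p = q" by (simp add: prod_eq_iff)
  qed
  then have "card (?c ` ?I) = 4" by (simp add: card_image card_cartesian_product)
  moreover have "0 \<notin> ?c ` ?I" using abs_curvature_branch_ge_1[OF assms] by force
  ultimately show ?thesis by simp
qed

lemma principal_curvature_gap:
  assumes x: "x \<in> B4_tilde" and c: "c \<in> principal_curvatures B4_tilde \<xi> x"
  shows "c = 0 \<or> \<bar>c\<bar> \<ge> 1"
  using c abs_curvature_branch_ge_1[OF x] unfolding principal_curvatures_B4[OF x] by auto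

text \<open>By the gap between \<open>0\<close> and the other values, \<open>\<kappa>\<close> vanishes everywhere on the connected set \<open>S\<close>
  or nowhere.  In the second case \<open>block_gap\<close> is constant on \<open>S\<close>, so that the continuous function \<open>\<kappa>\<close> has only five possible values.\<close>

lemma curvature_constant_on_curvature_surface:
  assumes \<kappa>: "principal_curvature_function B4_tilde \<xi> \<kappa>"
    and S: "curvature_surface B4_tilde \<xi> \<kappa> S"
  shows "\<kappa> constant_on S"
proof -
  have sub: "S \<subseteq> B4_tilde" and conn: "connected S"
    and im: "integral_manifold (principal_distribution B4_tilde \<xi> \<kappa>) S"
    using S by (auto simp: curvature_surface_def)
  have cont: "continuous_on S \<kappa>" and pc: "\<And>x. x \<in> S \<Longrightarrow> \<kappa> x \<in> principal_curvatures B4_tilde \<xi> x"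
    using \<kappa> sub by (auto simp: principal_curvature_function_def intro: continuous_on_subset)
  have gap: "\<kappa> x = 0 \<or> \<bar>\<kappa> x\<bar> \<ge> 1" if "x \<in> S" for x
    using principal_curvature_gap pc[OF that] sub that by blast
  have int: "is_interval (\<kappa> ` S)"
    using connected_continuous_image[OF cont conn] is_interval_connected_1 by blast
  show ?thesis
  proof (cases "\<exists>x\<in>S. \<kappa> x = 0")
    case True
    then have 0: "0 \<in> \<kappa> ` S" by force
    have "\<kappa> y = 0" if y: "y \<in> S" for y
    proof (rule ccontr)
      assume "\<kappa> y \<noteq> 0"
      then have "\<bar>\<kappa> y\<bar> \<ge> 1" using gap[OF y] by blast
      then consider "\<kappa> y \<ge> 1" | "\<kappa> y \<le> - 1" by linarith
      \<comment> \<open>Intermediate values inside the forbidden gap.\<close>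
      then have "1/2 \<in> \<kappa> ` S \<or> - 1/2 \<in> \<kappa> ` S"
        using 0 y int by cases (auto intro: mem_is_interval_1_I[of "\<kappa> ` S" 0 "\<kappa> y"] mem_is_interval_1_I[of "\<kappa> ` S" "\<kappa> y" 0])
      then show False using gap by force
    qed
    then show ?thesis unfolding constant_on_def by blast
  next
    case False
    obtain k where emb: "embedded_submanifold k S"
      and T: "\<And>x. x \<in> S \<Longrightarrow> tangent_space S x = principal_space B4_tilde \<xi> (\<kappa> x) x"
      using im unfolding integral_manifold_def principal_distribution_def by blast
    have "block_gap \<xi> constant_on S"
    proof (rule submanifold_constant[OF emb conn])
      fix e :: real and \<gamma> v assume e: "e > 0" "\<gamma> ` {-e<..<e} \<subseteq> S" "(\<gamma> has_vector_derivative v) (at 0)"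
        "v \<in> tangent_space S (\<gamma> 0)"
      have "\<gamma> 0 \<in> S" using e(1,2) by auto
      then show "((\<lambda>t. block_gap \<xi> (\<gamma> t)) has_vector_derivative 0) (at 0)"
        using block_gap_stationary[OF e(1) _ e(3)] e(2,4) T[of "\<gamma> 0"] False sub by blast
    qed
    then obtain m where m: "\<And>x. x \<in> S \<Longrightarrow> block_gap \<xi> x = m" unfolding constant_on_def by blast
    let ?c = "\<lambda>(\<sigma>, \<tau>). curvature_branch \<sigma> \<tau> m"
    have "\<kappa> ` S \<subseteq> insert 0 (?c ` ({1, - 1} \<times> {1, - 1}))"
      using pc m sub principal_curvatures_B4 by fastforce
    then have "finite (\<kappa> ` S)" by (rule finite_subset) simp
    then show ?thesis using continuous_finite_range_constant[OF conn cont] by blast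
  qed
qed

section \<open>The conullities are not integrable\<close>

text \<open>The null directions contain \<open>e1 e2\<close>, \<open>e3 e4\<close> and the diagonal matrix \<open>d\<close> tangent to the family of
  spectra.  A tangent vector orthogonal to them has no entries within the two planes.\<close>

lemma conullity_zero_anticommutes:
  assumes x: "x \<in> B4_tilde"
    and v: "v \<in> conullity B4_tilde \<xi> \<kappa> x" and \<kappa>: "\<kappa> x = 0"
  shows "\<xi> x ** v + v ** \<xi> x = 0"
proof -
  obtain e1 e2 e3 e4 \<mu> \<nu> where f: "normal_frame x (\<xi> x) e1 e2 e3 e4 \<mu> \<nu>"
    using x by (rule normal_frame_exists_unsigned)
  note fr = normal_frameD[OF f] and nz = normal_frame_values[OF x f]
  note o = orthonormal4_inner[OF fr(1)]
  have vT: "v \<in> tangent_space B4_tilde x"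
    and perp: "\<And>w. w \<in> principal_space B4_tilde \<xi> 0 x \<Longrightarrow> v \<bullet> w = 0"
    using v \<kappa> by (auto simp: conullity_def principal_distribution_def)
  have sv: "transpose v = v" using vT by (simp add: tangent_space_B4[OF x])
  let ?t = "\<lambda>p q. p \<bullet> (v *v q)"
  have T: "?t e1 e1 + ?t e2 e2 + ?t e3 e3 + ?t e4 e4 = 0"
    "\<mu> * (?t e1 e1 - ?t e2 e2) + \<nu> * (?t e3 e3 - ?t e4 e4) = 0"
    "\<mu>\<^sup>2 * (?t e1 e1 + ?t e2 e2) + \<nu>\<^sup>2 * (?t e3 e3 + ?t e4 e4) = 0"
    using vT unfolding tangent_space_normal_frame[OF x f] by auto
  have null: "w \<in> principal_space B4_tilde \<xi> 0 x"
    if "w \<in> tangent_space B4_tilde x" "e1 \<bullet> (w *v e3) = 0" "e1 \<bullet> (w *v e4) = 0" "e2 \<bullet> (w *v e3) = 0" "e2 \<bullet> (w *v e4) = 0" for w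
    unfolding principal_space_normal_frame[OF x f that(1)] using that by simp
  have "sym_outer e1 e2 \<in> principal_space B4_tilde \<xi> 0 x" "sym_outer e3 e4 \<in> principal_space B4_tilde \<xi> 0 x"
    by (rule null; simp add: tangent_space_normal_frame[OF x f] transpose_sym_outer sym_outer_mult_vector o inner_add_right)+
  then have off: "?t e1 e2 = 0" "?t e3 e4 = 0" using perp by (force simp: inner_sym_outer[OF sv])+
  \<comment> \<open>The velocity of a rotation of \<open>(\<mu>, \<nu>)\<close> in the circle \<open>\<mu>\<^sup>2 + \<nu>\<^sup>2 = 1/2\<close>, up to sign and scale.\<close>
  define d where "d = \<nu> *\<^sub>R (sym_outer e1 e1 - sym_outer e2 e2) - \<mu> *\<^sub>R (sym_outer e3 e3 - sym_outer e4 e4)"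
  have dv: "d *v z = (2 * \<nu>) *\<^sub>R ((e1 \<bullet> z) *\<^sub>R e1 - (e2 \<bullet> z) *\<^sub>R e2) - (2 * \<mu>) *\<^sub>R ((e3 \<bullet> z) *\<^sub>R e3 - (e4 \<bullet> z) *\<^sub>R e4)" for z
    unfolding d_def by (simp add: matrix_vector_mult_diff_rdistrib scaleR_matrix_vector_assoc[symmetric] sym_outer_mult_vector
        scaleR_2[symmetric] scaleR_diff_right mult.commute mult.left_commute)
  have sd: "transpose d = d" unfolding d_def by (simp add: transpose_diff transpose_scalar transpose_sym_outer)
  have "d \<in> principal_space B4_tilde \<xi> 0 x"
    by (rule null; simp add: tangent_space_normal_frame[OF x f] sd dv o inner_diff_right)
  then have "v \<bullet> d = 0" by (rule perp)
  then have D: "\<nu> * (?t e1 e1 - ?t e2 e2) - \<mu> * (?t e3 e3 - ?t e4 e4) = 0"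
    by (simp add: d_def inner_diff_right inner_sym_outer[OF sv] algebra_simps)
  define A B where "A = ?t e1 e1 - ?t e2 e2" and "B = ?t e3 e3 - ?t e4 e4"
  define C where "C = ?t e1 e1 + ?t e2 e2"
  have 34: "?t e3 e3 + ?t e4 e4 = - C" using T(1) by (simp add: C_def)
  have "(\<mu> - \<nu>) * (\<mu> + \<nu>) * C = 0"
    using T(3) unfolding 34 C_def[symmetric] by (simp add: power2_eq_square algebra_simps)
  then have C0: "C = 0" using nz by simp
  have "\<mu> * A + \<nu> * B = 0" "\<nu> * A - \<mu> * B = 0" using T(2) D by (simp_all add: A_def B_def)
  then have "(\<mu>\<^sup>2 + \<nu>\<^sup>2) * A = 0" "(\<mu>\<^sup>2 + \<nu>\<^sup>2) * B = 0" by algebra+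
  then have "A = 0" "B = 0" using nz(5) by simp_all
  then have diag: "?t e1 e1 = 0" "?t e2 e2 = 0" "?t e3 e3 = 0" "?t e4 e4 = 0"
    using C0 34 by (simp_all add: A_def B_def C_def)
  note sn = normal_identities(1)[OF x]
  have entry: "p \<bullet> ((\<xi> x ** v + v ** \<xi> x) *v q) = (\<xi> x *v p) \<bullet> (v *v q) + ?t p (\<xi> x *v q)" for p q
    by (simp add: matrix_vector_mult_add_rdistrib matrix_vector_mul_assoc[symmetric] inner_add_right symmetric_inner[OF sn])
  have s: "transpose (\<xi> x ** v + v ** \<xi> x) = \<xi> x ** v + v ** \<xi> x"
    by (simp add: transpose_add matrix_transpose_mul sn sv add.commute)
  show ?thesis
    by (rule orthonormal4_symmetric_eqI[OF fr(1) s])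
       (simp_all add: entry fr matrix_vector_mult_scaleR linear_neg[OF matrix_vector_mul_linear] diag off transpose_def vec_eq_iff)
qed

lemma factors_normal_frame:
  assumes x: "x \<in> B4_tilde"
    and f: "normal_frame x (\<xi> x) e1 e2 e3 e4 \<mu> \<nu>"
  shows "p \<bullet> (left_factor x (\<xi> x) \<mu> *v w) = (left_factor x (\<xi> x) \<mu> *v p) \<bullet> w"
    "left_factor x (\<xi> x) \<mu> *v e1 = (2 * \<mu>) *\<^sub>R e1" "left_factor x (\<xi> x) \<mu> *v e2 = 0"
    "left_factor x (\<xi> x) \<mu> *v e3 = 0" "left_factor x (\<xi> x) \<mu> *v e4 = 0"
    "right_factor x (\<xi> x) \<nu> *v e1 = 0" "right_factor x (\<xi> x) \<nu> *v e2 = 0"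
    "right_factor x (\<xi> x) \<nu> *v e3 = (2 * \<nu>) *\<^sub>R e3" "right_factor x (\<xi> x) \<nu> *v e4 = 0"
proof -
  note fr = normal_frameD[OF f]
  have sx: "transpose x = x" using x by (simp add: B4_tilde_iff)
  note n = normal_identities[OF x]
  have "transpose (left_factor x (\<xi> x) \<mu>) = (x + \<mu> *\<^sub>R mat 1) ** ((1/2) *\<^sub>R mat 1 + \<xi> x)"
    by (simp add: left_factor_def matrix_transpose_mul transpose_add transpose_scalar sx n)
  also have "\<dots> = left_factor x (\<xi> x) \<mu>"
    by (simp add: left_factor_def matrix_mult_add_left matrix_mult_add_right matrix_mult_scaleR_left
        matrix_mult_scaleR_right n(4) algebra_simps)
  finally show "p \<bullet> (left_factor x (\<xi> x) \<mu> *v w) = (left_factor x (\<xi> x) \<mu> *v p) \<bullet> w"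
    using symmetric_inner by metis
  note s = left_factor_def right_factor_def matrix_vector_mul_assoc[symmetric] matrix_vector_mult_add_rdistrib
    matrix_vector_mult_diff_rdistrib scaleR_matrix_vector_assoc[symmetric] fr matrix_vector_right_distrib
    matrix_vector_mult_scaleR scaleR_add_left[symmetric] scaleR_diff_left[symmetric]
    linear_neg[OF matrix_vector_mul_linear]
  show "left_factor x (\<xi> x) \<mu> *v e1 = (2 * \<mu>) *\<^sub>R e1" "left_factor x (\<xi> x) \<mu> *v e2 = 0"
    "left_factor x (\<xi> x) \<mu> *v e3 = 0" "left_factor x (\<xi> x) \<mu> *v e4 = 0"
    "right_factor x (\<xi> x) \<nu> *v e1 = 0" "right_factor x (\<xi> x) \<nu> *v e2 = 0"
    "right_factor x (\<xi> x) \<nu> *v e3 = (2 * \<nu>) *\<^sub>R e3" "right_factor x (\<xi> x) \<nu> *v e4 = 0"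
    by (simp_all add: s)
qed

text \<open>Orthogonality to the principal direction is the vanishing of the entry of \<open>v\<close> between
  \<open>e1\<close> and \<open>e3\<close>.  The factors select this entry by expressions that are differentiable in \<open>x\<close>, unlike an arbitrary
  choice of eigenvectors.\<close>

lemma conullity_simple_factors:
  assumes x: "x \<in> B4_tilde"
    and f: "normal_frame x (\<xi> x) e1 e2 e3 e4 \<mu> \<nu>"
    and v: "v \<in> conullity B4_tilde \<xi> \<kappa> x" and \<kappa>: "\<kappa> x * (\<mu> - \<nu>) = - 1"
  shows "left_factor x (\<xi> x) \<mu> ** v ** right_factor x (\<xi> x) \<nu> = 0"
proof -
  note fr = normal_frameD[OF f] and fac = factors_normal_frame[OF x f]
  have vT: "v \<in> tangent_space B4_tilde x" using v by (simp add: conullity_def)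
  then have sv: "transpose v = v" by (simp add: tangent_space_B4[OF x])
  have "v \<bullet> sym_outer e1 e3 = 0"
    using v sym_outer_13_principal[OF x f \<kappa>] by (simp add: conullity_def principal_distribution_def)
  then have 13: "e1 \<bullet> (v *v e3) = 0" by (simp add: inner_sym_outer[OF sv])
  have "left_factor x (\<xi> x) \<mu> *v (v *v e3) = 0"
    by (rule orthonormal4_vector_eqI[OF fr(1)]) (simp_all add: fac 13)
  then show ?thesis
    by (intro orthonormal4_matrix_eqI[OF fr(1)])
       (simp_all add: matrix_vector_mul_assoc[symmetric] fac matrix_vector_mult_scaleR)
qed

lemma curvature_zero_along_curve:
  assumes \<kappa>: "principal_curvature_function B4_tilde \<xi> \<kappa>"
    and \<gamma>: "e > 0" "\<gamma> ` {-e<..<e} \<subseteq> B4_tilde" "(\<gamma> has_vector_derivative v) (at 0)"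
    and 0: "\<kappa> (\<gamma> 0) = 0"
  obtains d where "d > 0" "d \<le> e" "\<And>t. t \<in> {-d<..<d} \<Longrightarrow> \<kappa> (\<gamma> t) = 0"
proof -
  have "((\<lambda>t. \<bar>\<kappa> (\<gamma> t)\<bar>) \<longlongrightarrow> \<bar>\<kappa> (\<gamma> 0)\<bar>) (at 0)"
    using curvature_along_curve_tendsto[OF _ \<gamma>] \<kappa>
    by (intro tendsto_intros) (auto simp: principal_curvature_function_def)
  then have "eventually (\<lambda>t. \<bar>\<kappa> (\<gamma> t)\<bar> < 1) (at 0)" by (rule order_tendstoD) (simp add: 0)
  then obtain d where d: "d > 0" "\<And>t. t \<in> {-d<..<d} \<Longrightarrow> \<bar>\<kappa> (\<gamma> t)\<bar> < 1"
    by (rule eventually_at_0_interval) (use 0 in auto)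
  show thesis
  proof (rule that[of "min d e"])
    show "\<kappa> (\<gamma> t) = 0" if "t \<in> {- min d e<..<min d e}" for t
    proof -
      have td: "t \<in> {-d<..<d}" "t \<in> {-e<..<e}" using that by (auto simp: min_def split: if_splits)
      then have "\<gamma> t \<in> B4_tilde" using \<gamma>(2) by blast
      then have "\<kappa> (\<gamma> t) = 0 \<or> \<bar>\<kappa> (\<gamma> t)\<bar> \<ge> 1"
        using principal_curvature_gap \<kappa> by (auto simp: principal_curvature_function_def)
      then show ?thesis using d(2)[OF td(1)] by auto
    qed
  qed (use d \<gamma> in auto)
qed

text \<open>The five possible values of \<open>\<kappa>\<close> depend continuously on the point and are distinct, so a continuous
  \<open>\<kappa>\<close> follows one of them.\<close>

lemma curvature_branch_along_curve:
  assumes \<kappa>: "principal_curvature_function B4_tilde \<xi> \<kappa>"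
    and \<gamma>: "e > 0" "\<gamma> ` {-e<..<e} \<subseteq> B4_tilde" "(\<gamma> has_vector_derivative v) (at 0)"
    and v: "v \<in> tangent_space B4_tilde (\<gamma> 0)"
    and st: "\<sigma> \<in> {1, - 1}" "\<tau> \<in> {1, - 1}" and 0: "\<kappa> (\<gamma> 0) = curvature_branch \<sigma> \<tau> (block_gap \<xi> (\<gamma> 0))"
  obtains d where "d > 0" "d \<le> e" "\<And>t. t \<in> {-d<..<d} \<Longrightarrow> \<kappa> (\<gamma> t) = curvature_branch \<sigma> \<tau> (block_gap \<xi> (\<gamma> t))"
proof -
  let ?I = "{1, - 1} \<times> {1, - 1 :: real}"
  let ?c = "\<lambda>q t. curvature_branch (fst q) (snd q) (block_gap \<xi> (\<gamma> t))"
  have x: "\<gamma> 0 \<in> B4_tilde" using \<gamma> by auto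
  have \<kappa>lim: "((\<lambda>t. \<kappa> (\<gamma> t)) \<longlongrightarrow> \<kappa> (\<gamma> 0)) (at 0)"
    using curvature_along_curve_tendsto[OF _ \<gamma>] \<kappa> by (auto simp: principal_curvature_function_def)
  have glim: "((\<lambda>t. block_gap \<xi> (\<gamma> t)) \<longlongrightarrow> block_gap \<xi> (\<gamma> 0)) (at 0)"
    using has_vector_derivative_continuous[OF block_gap_along_curve[OF \<gamma> v]] by (simp add: isCont_def)
  have ne: "eventually (\<lambda>t. \<kappa> (\<gamma> t) \<noteq> ?c q t) (at 0)" if q: "q \<in> ?I - {(\<sigma>, \<tau>)}" for q
  proof -
    have q': "fst q \<in> {1, - 1}" "snd q \<in> {1, - 1}" using q by auto
    have clim: "(?c q \<longlongrightarrow> ?c q 0) (at 0)"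
      unfolding curvature_branch_def
      by (intro tendsto_intros glim) (use signed_sum_nonzero[OF x q'] in auto)
    have "\<kappa> (\<gamma> 0) - ?c q 0 \<noteq> 0"
      using 0 curvature_branch_inj[OF x st q'] q by (auto simp: prod_eq_iff)
    then have "eventually (\<lambda>t. \<kappa> (\<gamma> t) - ?c q t \<noteq> 0) (at 0)"
      using tendsto_imp_eventually_ne[OF tendsto_diff[OF \<kappa>lim clim]] by blast
    then show ?thesis by simp
  qed
  have "eventually (\<lambda>t. \<forall>q\<in>?I - {(\<sigma>, \<tau>)}. \<kappa> (\<gamma> t) \<noteq> ?c q t) (at 0)"
    using ne by (intro eventually_ball_finite) auto
  moreover have "\<kappa> (\<gamma> 0) \<noteq> 0" using abs_curvature_branch_ge_1[OF x st] 0 by auto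
  then have "eventually (\<lambda>t. \<kappa> (\<gamma> t) \<noteq> 0) (at 0)" using tendsto_imp_eventually_ne[OF \<kappa>lim] by blast
  ultimately have "eventually (\<lambda>t. t \<in> {-e<..<e} \<longrightarrow> \<kappa> (\<gamma> t) = curvature_branch \<sigma> \<tau> (block_gap \<xi> (\<gamma> t))) (at 0)"
  proof eventually_elim
    case (elim t)
    show ?case
    proof
      assume "t \<in> {-e<..<e}"
      then have y: "\<gamma> t \<in> B4_tilde" using \<gamma>(2) by blast
      then have "\<kappa> (\<gamma> t) \<in> principal_curvatures B4_tilde \<xi> (\<gamma> t)"
        using \<kappa> by (simp add: principal_curvature_function_def)
      then obtain \<sigma>' \<tau>' where s: "\<sigma>' \<in> {1, - 1}" "\<tau>' \<in> {1, - 1}" "\<kappa> (\<gamma> t) = curvature_branch \<sigma>' \<tau>' (block_gap \<xi> (\<gamma> t))"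
        using elim(2) unfolding principal_curvatures_B4[OF y] by blast
      then have "(\<sigma>', \<tau>') = (\<sigma>, \<tau>)" using elim(1) by force
      then show "\<kappa> (\<gamma> t) = curvature_branch \<sigma> \<tau> (block_gap \<xi> (\<gamma> t))" using s(3) by simp
    qed
  qed
  then obtain d where d: "d > 0" "\<And>t. t \<in> {-d<..<d} \<Longrightarrow> t \<in> {-e<..<e} \<longrightarrow> \<kappa> (\<gamma> t) = curvature_branch \<sigma> \<tau> (block_gap \<xi> (\<gamma> t))"
    by (rule eventually_at_0_interval) (use 0 in auto)
  show thesis by (rule that[of "min d e"]) (use d \<gamma>(1) in auto)
qed

lemma anticommutation_derivative:
  assumes \<gamma>: "e > 0" "\<gamma> ` {-e<..<e} \<subseteq> B4_tilde" "(\<gamma> has_vector_derivative v) (at 0)"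
    and X: "(X has_vector_derivative w) (at 0)" "\<And>t. t \<in> {-e<..<e} \<Longrightarrow> \<xi> (\<gamma> t) ** X t + X t ** \<xi> (\<gamma> t) = 0"
  defines "Z \<equiv> - shape_operator B4_tilde \<xi> (\<gamma> 0) v"
  shows "(\<xi> (\<gamma> 0) ** w + Z ** X 0) + (X 0 ** Z + w ** \<xi> (\<gamma> 0)) = 0"
proof -
  have d: "((\<lambda>t. \<xi> (\<gamma> t)) has_vector_derivative Z) (at 0)"
    using normal_along_curve[OF \<gamma>] by (simp add: Z_def)
  show ?thesis
    by (rule vector_derivative_eq_of_eq_near[OF has_vector_derivative_add[OF
        has_vector_derivative_matrix_mult[OF d X(1)] has_vector_derivative_matrix_mult[OF X(1) d]]
        has_vector_derivative_const \<gamma>(1) X(2)])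
qed

lemma factor_derivative:
  assumes \<gamma>: "e > 0" "\<gamma> ` {-e<..<e} \<subseteq> B4_tilde" "(\<gamma> has_vector_derivative v) (at 0)"
    and X: "(X has_vector_derivative w) (at 0)"
    and mu: "(\<mu> has_vector_derivative \<mu>') (at 0)" and nu: "(\<nu> has_vector_derivative \<nu>') (at 0)"
    and eq: "\<And>t. t \<in> {-e<..<e} \<Longrightarrow>
      left_factor (\<gamma> t) (\<xi> (\<gamma> t)) (\<mu> t) ** X t ** right_factor (\<gamma> t) (\<xi> (\<gamma> t)) (\<nu> t) = 0"
  defines "x \<equiv> \<gamma> 0"
  defines "Z \<equiv> - shape_operator B4_tilde \<xi> x v"
  shows "(left_factor x (\<xi> x) (\<mu> 0) ** X 0) **
      (((1/2) *\<^sub>R mat 1 - \<xi> x) ** (v + \<nu>' *\<^sub>R mat 1) - Z ** (x + \<nu> 0 *\<^sub>R mat 1)) +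
    (left_factor x (\<xi> x) (\<mu> 0) ** w +
      (((1/2) *\<^sub>R mat 1 + \<xi> x) ** (v + \<mu>' *\<^sub>R mat 1) + Z ** (x + \<mu> 0 *\<^sub>R mat 1)) ** X 0) **
      right_factor x (\<xi> x) (\<nu> 0) = 0"
proof -
  have d: "((\<lambda>t. \<xi> (\<gamma> t)) has_vector_derivative Z) (at 0)"
    using normal_along_curve[OF \<gamma>] by (simp add: Z_def x_def)
  have sc: "((\<lambda>t. \<gamma> t + h t *\<^sub>R (mat 1 :: real^4^4)) has_vector_derivative v + h' *\<^sub>R mat 1) (at 0)"
    if "(h has_vector_derivative h') (at 0)" for h h'
    using has_vector_derivative_add[OF \<gamma>(3) has_vector_derivative_scaleR[OF that[folded has_real_derivative_iff_has_vector_derivative] has_vector_derivative_const[of "mat 1"]]]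
    by simp
  have L: "((\<lambda>t. left_factor (\<gamma> t) (\<xi> (\<gamma> t)) (\<mu> t)) has_vector_derivative
      ((1/2) *\<^sub>R mat 1 + \<xi> x) ** (v + \<mu>' *\<^sub>R mat 1) + Z ** (x + \<mu> 0 *\<^sub>R mat 1)) (at 0)"
    unfolding left_factor_def x_def
    using has_vector_derivative_matrix_mult[OF has_vector_derivative_add[OF has_vector_derivative_const[of "(1/2) *\<^sub>R mat 1"] d] sc[OF mu]]
    by simp
  have R: "((\<lambda>t. right_factor (\<gamma> t) (\<xi> (\<gamma> t)) (\<nu> t)) has_vector_derivative
      ((1/2) *\<^sub>R mat 1 - \<xi> x) ** (v + \<nu>' *\<^sub>R mat 1) - Z ** (x + \<nu> 0 *\<^sub>R mat 1)) (at 0)"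
    unfolding right_factor_def x_def
    using has_vector_derivative_matrix_mult[OF has_vector_derivative_diff[OF has_vector_derivative_const[of "(1/2) *\<^sub>R mat 1"] d] sc[OF nu]]
    by (simp add: matrix_mult_minus_left)
  show ?thesis
    using vector_derivative_eq_of_eq_near[OF has_vector_derivative_matrix_mult[OF has_vector_derivative_matrix_mult[OF L X] R]
        has_vector_derivative_const \<gamma>(1) eq]
    by (simp add: x_def)
qed

text \<open>With \<open>u = e1 e3\<close> and \<open>v = e2 e3\<close>, the \<open>(1, 2)\<close> entries of the two differentiated equations have the
  same contribution of \<open>w\<close>.  Comparing them gives \<open>1 / (\<mu> - \<nu>) = - 1 / (\<mu> + \<nu>)\<close>, that is \<open>\<mu> = 0\<close>.\<close>

lemma zero_conullity_not_integral:
  assumes \<kappa>: "principal_curvature_function B4_tilde \<xi> \<kappa>"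
    and S: "p \<in> S" "S \<subseteq> B4_tilde" "integral_manifold (conullity B4_tilde \<xi> \<kappa>) S" and 0: "\<kappa> p = 0"
  shows False
proof -
  have p: "p \<in> B4_tilde" using S by blast
  obtain k where emb: "embedded_submanifold k S" and T: "\<And>x. x \<in> S \<Longrightarrow> tangent_space S x = conullity B4_tilde \<xi> \<kappa> x"
    using S(3) unfolding integral_manifold_def by blast
  obtain e1 e2 e3 e4 \<mu> \<nu> where f: "normal_frame p (\<xi> p) e1 e2 e3 e4 \<mu> \<nu>"
    using p by (rule normal_frame_exists_unsigned)
  note fr = normal_frameD[OF f] and nz = normal_frame_values[OF p f]
  note o = orthonormal4_inner[OF fr(1)]
  have con: "sym_outer q e3 \<in> conullity B4_tilde \<xi> \<kappa> p" if "q = e1 \<or> q = e2" for q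
    unfolding conullity_def principal_distribution_def 0
  proof (intro CollectI conjI ballI)
    show "sym_outer q e3 \<in> tangent_space B4_tilde p"
      using that unfolding tangent_space_normal_frame[OF p f] by (auto simp: transpose_sym_outer sym_outer_mult_vector o)
    fix w assume w: "w \<in> principal_space B4_tilde \<xi> 0 p"
    then have wT: "w \<in> tangent_space B4_tilde p" by (simp add: principal_space_def)
    then have sw: "transpose w = w" by (simp add: tangent_space_B4[OF p])
    have "q \<bullet> (w *v e3) = 0"
      using w that unfolding principal_space_normal_frame[OF p f wT] by auto
    then show "sym_outer q e3 \<bullet> w = 0" by (simp add: inner_commute[of _ w] inner_sym_outer[OF sw])
  qed
  define u v where "u = sym_outer e1 e3" and "v = sym_outer e2 e3"
  have uT: "u \<in> tangent_space S p" and vT: "v \<in> tangent_space S p"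
    using con T[OF S(1)] by (simp_all add: u_def v_def)
  then have uM: "u \<in> tangent_space B4_tilde p" and vM: "v \<in> tangent_space B4_tilde p"
    using T[OF S(1)] by (simp_all add: conullity_def)
  obtain e \<alpha> \<beta> X Y w where e: "e > 0" and ab: "\<alpha> ` {-e<..<e} \<subseteq> S" "\<beta> ` {-e<..<e} \<subseteq> S" "\<alpha> 0 = p" "\<beta> 0 = p"
    "(\<alpha> has_vector_derivative u) (at 0)" "(\<beta> has_vector_derivative v) (at 0)"
    and X: "\<And>t. t \<in> {-e<..<e} \<Longrightarrow> X t \<in> tangent_space S (\<beta> t)" "X 0 = u" "(X has_vector_derivative w) (at 0)"
    and Y: "\<And>t. t \<in> {-e<..<e} \<Longrightarrow> Y t \<in> tangent_space S (\<alpha> t)" "Y 0 = v" "(Y has_vector_derivative w) (at 0)"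
    using submanifold_commuting_fields[OF emb S(1) uT vT] by metis
  define Zu Zv where "Zu = - shape_operator B4_tilde \<xi> p u" and "Zv = - shape_operator B4_tilde \<xi> p v"
  have der: "(\<xi> p ** w + - shape_operator B4_tilde \<xi> p b ** a) + (a ** - shape_operator B4_tilde \<xi> p b + w ** \<xi> p) = 0"
    if g: "\<gamma> ` {-e<..<e} \<subseteq> S" "\<gamma> 0 = p" "(\<gamma> has_vector_derivative b) (at 0)"
      and V: "\<And>t. t \<in> {-e<..<e} \<Longrightarrow> V t \<in> tangent_space S (\<gamma> t)" "V 0 = a" "(V has_vector_derivative w) (at 0)" for \<gamma> V a b
  proof -
    have gB: "\<gamma> ` {-e<..<e} \<subseteq> B4_tilde" using g(1) S(2) by blast
    obtain d where d: "d > 0" "d \<le> e" "\<And>t. t \<in> {-d<..<d} \<Longrightarrow> \<kappa> (\<gamma> t) = 0"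
      using curvature_zero_along_curve[OF \<kappa> e gB g(3)] 0 g(2) by metis
    have "\<xi> (\<gamma> t) ** V t + V t ** \<xi> (\<gamma> t) = 0" if t: "t \<in> {-d<..<d}" for t
    proof -
      have te: "t \<in> {-e<..<e}" using t d(2) by auto
      then have "V t \<in> conullity B4_tilde \<xi> \<kappa> (\<gamma> t)" using V(1) T g(1) by blast
      then show ?thesis using conullity_zero_anticommutes[where \<kappa>=\<kappa>, OF _ _ d(3)[OF t]] gB te by blast
    qed
    from anticommutation_derivative[OF d(1) _ g(3) V(3) this] gB d(2) show ?thesis
      by (simp add: g(2) V(2) image_subset_iff)
  qed
  note su = normal_derivative_identities(1)[OF p uM, folded Zu_def]
  note sv = normal_derivative_identities(1)[OF p vM, folded Zv_def]
  have sym: "transpose u = u" "transpose v = v" by (simp_all add: u_def v_def transpose_sym_outer)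
  have uv: "u *v e1 = e3" "u *v e2 = 0" "v *v e1 = 0" "v *v e2 = e3"
    by (simp_all add: u_def v_def sym_outer_mult_vector o)
  have entry: "e1 \<bullet> (((\<xi> p ** w + A ** a) + (a ** A + w ** \<xi> p)) *v e2) =
      e1 \<bullet> (w *v e2) + e1 \<bullet> (A *v (a *v e2)) + (a *v e1) \<bullet> (A *v e2)" if "transpose a = a" for A a :: "real^4^4"
    by (simp add: matrix_vector_mult_add_rdistrib matrix_vector_mul_assoc[symmetric] inner_add_right fr
        matrix_vector_mult_scaleR symmetric_inner[OF that] flip: symmetric_inner[OF normal_identities(1)[OF p]])
  have "e1 \<bullet> (w *v e2) + e3 \<bullet> (Zv *v e2) = 0"
    using arg_cong[OF der[OF ab(2,4,6) X], of "\<lambda>m. e1 \<bullet> (m *v e2)", folded Zv_def, unfolded entry[OF sym(1)]]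
    by (simp add: uv)
  moreover have "e1 \<bullet> (w *v e2) + e1 \<bullet> (Zu *v e3) = 0"
    using arg_cong[OF der[OF ab(1,3,5) Y], of "\<lambda>m. e1 \<bullet> (m *v e2)", folded Zu_def, unfolded entry[OF sym(2)]]
    by (simp add: uv)
  moreover have "e3 \<bullet> (Zv *v e2) = e2 \<bullet> (Zv *v e3)" using symmetric_inner[OF sv, of e2 e3] by (simp add: inner_commute)
  ultimately have eq: "e2 \<bullet> (Zv *v e3) = e1 \<bullet> (Zu *v e3)" by linarith
  have "(\<mu> - \<nu>) * (e1 \<bullet> (Zu *v e3)) = 1"
    using normal_derivative_entries(7)[OF p f uM, folded Zu_def] by (simp add: u_def sym_outer_mult_vector o)
  moreover have "(- \<mu> - \<nu>) * (e2 \<bullet> (Zv *v e3)) = 1"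
    using normal_derivative_entries(9)[OF p f vM, folded Zv_def] by (simp add: v_def sym_outer_mult_vector o)
  ultimately have "\<mu> * (e1 \<bullet> (Zu *v e3)) = 0" "e1 \<bullet> (Zu *v e3) \<noteq> 0" unfolding eq by (auto simp: algebra_simps)
  then show False using nz(1) by simp
qed

text \<open>In a frame with \<open>\<kappa> p = - 1 / (\<mu> - \<nu>)\<close>, let \<open>u = e1 e2\<close> and \<open>v = e2 e3\<close>.  The \<open>(1, 3)\<close>
  entries of the two differentiated equations share the contribution \<open>4 \<mu> \<nu> w 1 3\<close>, and comparing them gives
  \<open>4 \<mu> \<nu> / (\<mu> + \<nu>) = 2 \<nu>\<close>, that is \<open>\<mu> = \<nu>\<close>.\<close>

lemma simple_conullity_not_integral:
  assumes \<kappa>: "principal_curvature_function B4_tilde \<xi> \<kappa>"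
    and S: "p \<in> S" "S \<subseteq> B4_tilde" "integral_manifold (conullity B4_tilde \<xi> \<kappa>) S" and 0: "\<kappa> p \<noteq> 0"
  shows False
proof -
  have p: "p \<in> B4_tilde" using S by blast
  obtain k where emb: "embedded_submanifold k S" and T: "\<And>x. x \<in> S \<Longrightarrow> tangent_space S x = conullity B4_tilde \<xi> \<kappa> x"
    using S(3) unfolding integral_manifold_def by blast
  have "\<kappa> p \<in> principal_curvatures B4_tilde \<xi> p" using \<kappa> p by (simp add: principal_curvature_function_def)
  then obtain \<sigma> \<tau> where st: "\<sigma> \<in> {1, - 1}" "\<tau> \<in> {1, - 1}" and \<kappa>p: "\<kappa> p = curvature_branch \<sigma> \<tau> (block_gap \<xi> p)"
    using 0 unfolding principal_curvatures_B4[OF p] by blast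
  \<comment> \<open>The eigenvalue functions whose signs are those of the branch that \<open>\<kappa>\<close> follows near \<open>p\<close>.\<close>
  define M N where "M = (\<lambda>y. \<sigma> * sqrt (1/4 + block_gap \<xi> y / 2))" and "N = (\<lambda>y. \<tau> * sqrt (1/4 - block_gap \<xi> y / 2))"
  define \<mu> \<nu> where "\<mu> = M p" and "\<nu> = N p"
  obtain e1 e2 e3 e4 where f: "normal_frame p (\<xi> p) e1 e2 e3 e4 \<mu> \<nu>"
    using normal_frame_signed[OF p st] unfolding \<mu>_def \<nu>_def M_def N_def by metis
  note fr = normal_frameD[OF f] and nz = normal_frame_values[OF p f]
  note o = orthonormal4_inner[OF fr(1)]
  have c: "\<kappa> p * (\<mu> - \<nu>) = - 1"
    using nz(3) by (simp add: \<kappa>p curvature_branch_def \<mu>_def \<nu>_def M_def N_def)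
  define u v where "u = sym_outer e1 e2" and "v = sym_outer e2 e3"
  have uM: "u \<in> tangent_space B4_tilde p" and vM: "v \<in> tangent_space B4_tilde p"
    unfolding tangent_space_normal_frame[OF p f] by (simp_all add: u_def v_def transpose_sym_outer sym_outer_mult_vector o)
  have con: "u \<bullet> w = 0" "v \<bullet> w = 0" if w: "w \<in> principal_space B4_tilde \<xi> (\<kappa> p) p" for w
  proof -
    have wT: "w \<in> tangent_space B4_tilde p" using w by (simp add: principal_space_def)
    then have sw: "transpose w = w" by (simp add: tangent_space_B4[OF p])
    note R = w[unfolded principal_space_normal_frame[OF p f wT]]
    have "e1 \<bullet> (w *v e2) = 0" using R 0 by simp
    then show "u \<bullet> w = 0" by (simp add: u_def inner_commute[of _ w] inner_sym_outer[OF sw])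
    \<comment> \<open>The principal direction between \<open>e2\<close> and \<open>e3\<close> belongs to a different curvature.\<close>
    have "\<kappa> p * (- \<mu> - \<nu>) + 1 = - 2 * \<mu> * \<kappa> p" using c by (simp add: algebra_simps)
    then have "\<kappa> p * (- \<mu> - \<nu>) + 1 \<noteq> 0" using 0 nz(1) by simp
    then have "e2 \<bullet> (w *v e3) = 0" using R by simp
    then show "v \<bullet> w = 0" by (simp add: v_def inner_commute[of _ w] inner_sym_outer[OF sw])
  qed
  have uT: "u \<in> tangent_space S p" and vT: "v \<in> tangent_space S p"
    using con uM vM by (simp_all add: T[OF S(1)] conullity_def principal_distribution_def)
  obtain e \<alpha> \<beta> X Y w where e: "e > 0" and ab: "\<alpha> ` {-e<..<e} \<subseteq> S" "\<beta> ` {-e<..<e} \<subseteq> S" "\<alpha> 0 = p" "\<beta> 0 = p"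
    "(\<alpha> has_vector_derivative u) (at 0)" "(\<beta> has_vector_derivative v) (at 0)"
    and X: "\<And>t. t \<in> {-e<..<e} \<Longrightarrow> X t \<in> tangent_space S (\<beta> t)" "X 0 = u" "(X has_vector_derivative w) (at 0)"
    and Y: "\<And>t. t \<in> {-e<..<e} \<Longrightarrow> Y t \<in> tangent_space S (\<alpha> t)" "Y 0 = v" "(Y has_vector_derivative w) (at 0)"
    using submanifold_commuting_fields[OF emb S(1) uT vT] by metis
  let ?L = "left_factor p (\<xi> p) \<mu>" and ?R = "right_factor p (\<xi> p) \<nu>"
  note fac = factors_normal_frame[OF p f]
  have der: "\<exists>m n. (?L ** a) ** (((1/2) *\<^sub>R mat 1 - \<xi> p) ** (b + n *\<^sub>R mat 1) - (- shape_operator B4_tilde \<xi> p b) ** (p + \<nu> *\<^sub>R mat 1)) +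
      (?L ** w + (((1/2) *\<^sub>R mat 1 + \<xi> p) ** (b + m *\<^sub>R mat 1) + (- shape_operator B4_tilde \<xi> p b) ** (p + \<mu> *\<^sub>R mat 1)) ** a) ** ?R = 0"
    if g: "\<gamma> ` {-e<..<e} \<subseteq> S" "\<gamma> 0 = p" "(\<gamma> has_vector_derivative b) (at 0)" and b: "b \<in> tangent_space B4_tilde p"
      and V: "\<And>t. t \<in> {-e<..<e} \<Longrightarrow> V t \<in> tangent_space S (\<gamma> t)" "V 0 = a" "(V has_vector_derivative w) (at 0)" for \<gamma> V a b
  proof -
    have gB: "\<gamma> ` {-e<..<e} \<subseteq> B4_tilde" using g(1) S(2) by blast
    have b': "b \<in> tangent_space B4_tilde (\<gamma> 0)" using b g(2) by simp
    obtain d where d: "d > 0" "d \<le> e" "\<And>t. t \<in> {-d<..<d} \<Longrightarrow> \<kappa> (\<gamma> t) = curvature_branch \<sigma> \<tau> (block_gap \<xi> (\<gamma> t))"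
      using curvature_branch_along_curve[OF \<kappa> e gB g(3) b' st] \<kappa>p unfolding g(2) by metis
    have sub: "{-d<..<d} \<subseteq> {-e<..<e}" using d(2) by auto
    have fact: "left_factor (\<gamma> t) (\<xi> (\<gamma> t)) (M (\<gamma> t)) ** V t ** right_factor (\<gamma> t) (\<xi> (\<gamma> t)) (N (\<gamma> t)) = 0"
      if t: "t \<in> {-d<..<d}" for t
    proof -
      have y: "\<gamma> t \<in> B4_tilde" "\<gamma> t \<in> S" using gB g(1) t sub by blast+
      obtain f1 f2 f3 f4 where h: "normal_frame (\<gamma> t) (\<xi> (\<gamma> t)) f1 f2 f3 f4 (M (\<gamma> t)) (N (\<gamma> t))"
        using normal_frame_signed[OF y(1) st] unfolding M_def N_def by metis
      have "V t \<in> conullity B4_tilde \<xi> \<kappa> (\<gamma> t)" using V(1) T y(2) t sub by blast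
      moreover have "\<kappa> (\<gamma> t) * (M (\<gamma> t) - N (\<gamma> t)) = - 1"
        using normal_frame_values(3)[OF y(1) h] by (simp add: d(3)[OF t] curvature_branch_def M_def N_def)
      ultimately show ?thesis using conullity_simple_factors[OF y(1) h] by blast
    qed
    have gap: "((\<lambda>t. block_gap \<xi> (\<gamma> t)) has_vector_derivative 2 * trace (b ** (\<gamma> 0 ** \<xi> (\<gamma> 0)))) (at 0)"
      by (rule block_gap_along_curve[OF e gB g(3) b'])
    have "\<bar>block_gap \<xi> (\<gamma> 0)\<bar> < 1/2" using block_gap_bound[OF p] g(2) by simp
    then have pos: "0 < 1/4 + 1/2 * block_gap \<xi> (\<gamma> 0)" "0 < 1/4 + (- 1/2) * block_gap \<xi> (\<gamma> 0)" by linarith+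
    obtain m where m: "((\<lambda>t. M (\<gamma> t)) has_vector_derivative m) (at 0)"
      using signed_root_along_curve[OF gap pos(1), of \<sigma>] unfolding M_def by auto
    obtain n where n: "((\<lambda>t. N (\<gamma> t)) has_vector_derivative n) (at 0)"
      using signed_root_along_curve[OF gap pos(2), of \<tau>] unfolding N_def by auto
    have "\<gamma> ` {-d<..<d} \<subseteq> B4_tilde" using gB sub by blast
    from factor_derivative[OF d(1) this g(3) V(3) m n fact] show ?thesis
      unfolding g(2) V(2) \<mu>_def \<nu>_def by blast
  qed
  define Zu Zv where "Zu = - shape_operator B4_tilde \<xi> p u" and "Zv = - shape_operator B4_tilde \<xi> p v"
  have sym: "transpose u = u" "transpose v = v" by (simp_all add: u_def v_def transpose_sym_outer)
  have uv: "u *v e1 = e2" "u *v e2 = e1" "u *v e3 = 0" "v *v e1 = 0" "v *v e2 = e3" "v *v e3 = e2"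
    by (simp_all add: u_def v_def sym_outer_mult_vector o)
  have entry: "e1 \<bullet> (((?L ** a) ** H + (?L ** w + G ** a) ** ?R) *v e3) =
      2 * \<mu> * ((a *v e1) \<bullet> (H *v e3)) + 2 * \<nu> * (2 * \<mu> * (e1 \<bullet> (w *v e3)) + e1 \<bullet> (G *v (a *v e3)))"
    if "transpose a = a" for H G a :: "real^4^4"
    by (simp add: matrix_vector_mult_add_rdistrib matrix_vector_mul_assoc[symmetric] inner_add_right fac
        matrix_vector_mult_scaleR symmetric_inner[OF that])
  obtain m1 n1 where 1: "(?L ** u) ** (((1/2) *\<^sub>R mat 1 - \<xi> p) ** (v + n1 *\<^sub>R mat 1) - Zv ** (p + \<nu> *\<^sub>R mat 1)) +
      (?L ** w + (((1/2) *\<^sub>R mat 1 + \<xi> p) ** (v + m1 *\<^sub>R mat 1) + Zv ** (p + \<mu> *\<^sub>R mat 1)) ** u) ** ?R = 0"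
    using der[OF ab(2,4,6) vM X] unfolding Zv_def by blast
  obtain m2 n2 where 2: "(?L ** v) ** (((1/2) *\<^sub>R mat 1 - \<xi> p) ** (u + n2 *\<^sub>R mat 1) - Zu ** (p + \<nu> *\<^sub>R mat 1)) +
      (?L ** w + (((1/2) *\<^sub>R mat 1 + \<xi> p) ** (u + m2 *\<^sub>R mat 1) + Zu ** (p + \<mu> *\<^sub>R mat 1)) ** v) ** ?R = 0"
    using der[OF ab(1,3,5) uM Y] unfolding Zu_def by blast
  note flip = symmetric_inner[OF normal_identities(1)[OF p], symmetric]
  note s = matrix_vector_mult_add_rdistrib matrix_vector_mult_diff_rdistrib matrix_vector_mul_assoc[symmetric]
    scaleR_matrix_vector_assoc[symmetric] matrix_vector_right_distrib matrix_vector_mult_scaleR inner_add_right inner_diff_right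
  have H: "e2 \<bullet> ((((1/2) *\<^sub>R mat 1 - \<xi> p) ** (v + n1 *\<^sub>R mat 1) - Zv ** (p + \<nu> *\<^sub>R mat 1)) *v e3) = - 2 * \<nu> * (e2 \<bullet> (Zv *v e3))"
    by (simp add: s fr uv o flip scaleR_add_left[symmetric])
  have G: "e1 \<bullet> ((((1/2) *\<^sub>R mat 1 + \<xi> p) ** (u + m2 *\<^sub>R mat 1) + Zu ** (p + \<mu> *\<^sub>R mat 1)) *v e2) = 1"
    by (simp add: s fr uv o flip linear_neg[OF matrix_vector_mul_linear])
  have "2 * \<mu> * (- 2 * \<nu> * (e2 \<bullet> (Zv *v e3))) + 2 * \<nu> * (2 * \<mu> * (e1 \<bullet> (w *v e3))) = 0"
    using arg_cong[OF 1, of "\<lambda>m. e1 \<bullet> (m *v e3)", unfolded entry[OF sym(1)] uv H] by simp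
  then have "e2 \<bullet> (Zv *v e3) = e1 \<bullet> (w *v e3)" using nz(1,2) by simp
  moreover have "2 * \<nu> * (2 * \<mu> * (e1 \<bullet> (w *v e3)) + 1) = 0"
    using arg_cong[OF 2, of "\<lambda>m. e1 \<bullet> (m *v e3)", unfolded entry[OF sym(2)] uv G] by simp
  then have "2 * \<mu> * (e1 \<bullet> (w *v e3)) = - 1" using nz(2) by (simp add: add_eq_0_iff2)
  ultimately have "2 * \<mu> * (e2 \<bullet> (Zv *v e3)) = - 1" by simp
  moreover have "(- \<mu> - \<nu>) * (e2 \<bullet> (Zv *v e3)) = 1"
    using normal_derivative_entries(9)[OF p f vM, folded Zv_def] by (simp add: v_def sym_outer_mult_vector o)
  moreover have "(\<mu> - \<nu>) * (e2 \<bullet> (Zv *v e3)) = 2 * \<mu> * (e2 \<bullet> (Zv *v e3)) + (- \<mu> - \<nu>) * (e2 \<bullet> (Zv *v e3))"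
    by (simp add: algebra_simps)
  ultimately have "(\<mu> - \<nu>) * (e2 \<bullet> (Zv *v e3)) = 0" "e2 \<bullet> (Zv *v e3) \<noteq> 0" by auto
  then show False using nz(3) by simp
qed

end

lemma proper_dupin_B4: "proper_dupin E4 B4_tilde"
  unfolding proper_dupin_def
  using sphere_hypersurface_B4 unit_normal_field_B4 card_principal_curvatures_B4
    curvature_constant_on_curvature_surface by blast

theorem proposition4p11:
  shows "weakly_irreducible E4 B4_tilde"
proof -
  have "\<not> weakly_reducible E4 B4_tilde"
  proof
    assume "weakly_reducible E4 B4_tilde"
    then obtain \<xi> \<kappa> where nf: "unit_normal_field E4 B4_tilde \<xi>" and \<kappa>: "principal_curvature_function B4_tilde \<xi> \<kappa>"
      and int: "integrable_distribution B4_tilde (conullity B4_tilde \<xi> \<kappa>)"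
      unfolding weakly_reducible_def by blast
    obtain p where "p \<in> B4_tilde" using B4_tilde_nonempty by blast
    then obtain S where S: "p \<in> S" "S \<subseteq> B4_tilde" "integral_manifold (conullity B4_tilde \<xi> \<kappa>) S"
      using int unfolding integrable_distribution_def by blast
    then show False
      using zero_conullity_not_integral[OF nf \<kappa> S] simple_conullity_not_integral[OF nf \<kappa> S] by blast
  qed
  then show ?thesis using proper_dupin_B4 by (simp add: weakly_irreducible_def)
qed

end
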